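(* For all $n \geq 0$, $$p_{\xi}(45n+33) \equiv 0 \pmod{5}\qquad\text{and}\qquad p_{\xi}(45n+42) \equiv 0 \pmod{5}.$$
   Context: $(a;q)_n=(1-a)(1-aq)\cdots(1-aq^{n-1})$, $(a;q)_0=1$. The coefficients $p_\xi(n)$ are defined by $\sum_{n\ge0}p_\xi(n)q^n=\xi(q)=1+2\sum_{n\ge1}\frac{q^{6n^2-6n+1}}{(q;q^6)_n(q^5;q^6)_n}$. *)

theory Defs
  imports "HOL-Computational_Algebra.Formal_Power_Series" "HOL-Number_Theory.Cong"
begin

definition qpoch :: "'a::comm_ring_1 \<Rightarrow> 'a \<Rightarrow> nat \<Rightarrow> 'a"
  where "qpoch a q n = (\<Prod>k<n. 1 - a * q ^ k)"

definition xi_denom :: "nat \<Rightarrow> int fps"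
  where "xi_denom n = qpoch fps_X (fps_X ^ 6) n * qpoch (fps_X ^ 5) (fps_X ^ 6) n"

text \<open>
  The type \<^typ>\<open>int fps\<close> has no division. The denominator has constant coefficient 1, so
  \<open>fps_right_inverse _ 1\<close> is its reciprocal; see \<open>xi_term_mult_denom\<close> below.
  The exponent is nonnegative, so truncated subtraction is harmless here.
\<close>

definition xi_term :: "nat \<Rightarrow> int fps"
  where "xi_term n = fps_X ^ (6 * n ^ 2 - 6 * n + 1) * fps_right_inverse (xi_denom n) 1"

text \<open>
  The infinite sum is taken in the usual topology on formal power series; it converges by
  \<open>summable_xi_term\<close> below. The shift by \<^const>\<open>Suc\<close> makes it start at 1.
\<close>

definition xi :: "int fps"
  where "xi = 1 + 2 * (\<Sum>n. xi_term (Suc n))"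

definition p_xi :: "nat \<Rightarrow> int"
  where "p_xi n = fps_nth xi n"

lemma xi_denom_nth_0: "fps_nth (xi_denom n) 0 = 1"
proof -
  have "fps_nth (qpoch (fps_X ^ Suc j) (fps_X ^ 6) n) 0 = (1 :: int)" for j
    unfolding qpoch_def by (induction n) (simp_all add: fps_mult_nth_0)
  from this[of 0] this[of 4] show ?thesis
    by (simp add: xi_denom_def)
qed

lemma xi_term_mult_denom: "xi_term n * xi_denom n = fps_X ^ (6 * n ^ 2 - 6 * n + 1)"
proof -
  have "xi_denom n * fps_right_inverse (xi_denom n) 1 = 1"
    by (rule fps_right_inverse) (simp add: xi_denom_nth_0)
  then show ?thesis
    unfolding xi_term_def by (simp only: mult.assoc mult.commute[of "fps_right_inverse (xi_denom n) 1"] mult_1_right)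
qed

lemma xi_term_nth_eq_0:
  assumes "k < 6 * n ^ 2 - 6 * n + 1"
  shows "fps_nth (xi_term n) k = 0"
  using assms unfolding xi_term_def fps_X_power_mult_nth by (rule if_P)

lemma summable_xi_term: "summable (\<lambda>n. xi_term (Suc n))"
proof -
  let ?S = "Abs_fps (\<lambda>k. \<Sum>n\<le>k. fps_nth (xi_term (Suc n)) k)"
  have "(\<lambda>N. \<Sum>n<N. xi_term (Suc n)) \<longlonglongrightarrow> ?S"
  proof (rule tendsto_fpsI)
    fix k
    have "fps_nth (\<Sum>n<N. xi_term (Suc n)) k = fps_nth ?S k" if "N > k" for N
    proof -
      have "fps_nth (xi_term (Suc n)) k = 0" if "n > k" for n
      proof (rule xi_term_nth_eq_0)
        have "6 * (Suc n) ^ 2 - 6 * Suc n + 1 = 6 * n * n + 6 * n + 1"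
          by (simp add: power2_eq_square algebra_simps)
        with that show "k < 6 * (Suc n) ^ 2 - 6 * Suc n + 1" by linarith
      qed
      then have "(\<Sum>n<N. fps_nth (xi_term (Suc n)) k) = (\<Sum>n\<le>k. fps_nth (xi_term (Suc n)) k)"
        using that by (intro sum.mono_neutral_right) auto
      then show ?thesis by (simp add: fps_sum_nth)
    qed
    then show "eventually (\<lambda>N. fps_nth (\<Sum>n<N. xi_term (Suc n)) k = fps_nth ?S k) sequentially"
      by (rule eventually_mono[OF eventually_gt_at_top])
  qed
  then show ?thesis unfolding summable_def sums_def by blast
qed

end

theory Submission
  imports Defs "HOL-Analysis.FPS_Convergence" "HOL-Analysis.Infinite_Products" "HOL-Analysis.Infinite_Sum"
begin

text \<open>
  Write \<open>J(k)\<close> for the product of \<open>1 - q^(k n)\<close> over \<open>n \<ge> 1\<close>. A partial fraction expansion of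
  \<open>1 / ((x;q)_(n+1) (q/x;q)_(n+1))\<close> in \<open>x\<close>, summed over \<open>n\<close> by means of Durfee rectangles, turns the universal
  mock theta function into an Appell sum; \<open>\<xi>\<close> is the case of base \<open>q^6\<close> and \<open>x = q\<close>. Expanding
  \<open>1 / (1 - q^m) = (1 + q^m + q^(2m)) / (1 - q^(3m))\<close> isolates the exponents divisible by 3, and there the
  Appell sum degenerates to the sum of \<open>(-1)^n q^(3n^2+n) (1 + q^(6n+1)) / (1 - q^(6n+1))\<close>. This one is a
  quotient of theta functions: multiplied by a theta function it becomes entire in the elliptic variable and
  quasi-periodic, which determines its Laurent coefficients up to a constant. Hence the series of \<open>p\<^sub>\<xi>(3n)\<close> is
  \<open>J(2) J(3)^4 / (J(1)^2 J(6)^2)\<close>. Dissecting \<open>J(2) / J(1)^2\<close> with cube roots of unity gives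
  \<open>4 J(6)^3 / J(1)^2\<close> for the series of \<open>p\<^sub>\<xi>(9n+6)\<close>. Modulo 5, \<open>J(1)^5\<close> is a series in \<open>q^5\<close>, while by
  Jacobi's identity \<open>J(1)^3 J(6)^3\<close> has no exponents congruent to 3 or 4.
\<close>

text \<open>The identities are proved pointwise for complex q with 0 < |q| < 1, since theta series
  involve negative powers of q and the dissections rotate q by cube roots of unity. Only the
  finished formula for p_xi(9k+6) is carried back to integer power series, by uniqueness of
  coefficients.

  Why a single constant is left undetermined: the n-th term of the Appell sum, times the theta
  function in its denominator, is a sum over k of c(k) q^(m(m-1)/2) z^m with m = 2n + k and with c
  independent of n and z. Summing over n pairs each parity class of k with the m of the same parity,
  and c(1 - k) = c(k) makes the two class sums of c equal; so the total is E theta(q, z). At z = 1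
  only n = 0 contributes, and Jacobi's cube identity gives E theta(q, 1).

  The residues 3 and 4 come from 6 = 1 modulo 5: in J(1)^3 and J(6)^3 alike, the coefficients 2n + 1
  that survive modulo 5 have exponents 0 or 1 modulo 5, and two such residues add up to 0, 1 or
  2.\<close>

section \<open>Sums over the integers and \<open>q\<close>-Pochhammer symbols\<close>

text \<open>Tannery's theorem. The Weierstrass M-test makes the finite partial sums converge
  uniformly in N, so the limit in N may be exchanged with the limit over finite subsets. It turns
  the finite identities below into infinite ones.\<close>

lemma has_sum_dominated_limit:
  fixes f :: "nat \<Rightarrow> 'a \<Rightarrow> 'b :: banach"
  assumes sums: "\<And>N. (f N has_sum S N) A"
    and lim: "\<And>x. x \<in> A \<Longrightarrow> (\<lambda>N. f N x) \<longlonglongrightarrow> g x"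
    and bound: "\<And>N x. x \<in> A \<Longrightarrow> norm (f N x) \<le> M x"
    and M: "M summable_on A"
    and S: "S \<longlonglongrightarrow> L"
  shows "(g has_sum L) A"
proof -
  have unif: "uniform_limit UNIV (\<lambda>X N. \<Sum>x\<in>X. f N x) S (finite_subsets_at_top A)"
    by (rule Weierstrass_m_test_general'[OF _ _ M]) (use bound sums in auto)
  have "norm (g x) \<le> M x" if "x \<in> A" for x
    using tendsto_upperbound[OF tendsto_norm[OF lim[OF that]]] bound[OF that] by simp
  then have "g abs_summable_on A"
    by (intro summable_on_comparison_test[OF M]) auto
  then have "g summable_on A" by (rule abs_summable_summable)
  then have g: "((\<lambda>X. sum g X) \<longlongrightarrow> infsum g A) (finite_subsets_at_top A)"
    by (rule infsum_tendsto)
  have "S \<longlonglongrightarrow> infsum g A"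
  proof (rule swap_uniform_limit'[OF _ g unif])
    show "\<forall>\<^sub>F X in finite_subsets_at_top A. (\<lambda>N. \<Sum>x\<in>X. f N x) \<longlonglongrightarrow> sum g X"
      by (rule eventually_finite_subsets_at_top_weakI) (intro tendsto_sum lim, auto)
  qed auto
  with S have "L = infsum g A" by (rule LIMSEQ_unique)
  with \<open>g summable_on A\<close> show ?thesis by (simp add: has_sum_infsum)
qed

lemma abs_summable_on_times:
  fixes f :: "'a \<Rightarrow> 'c :: real_normed_div_algebra" and g :: "'b \<Rightarrow> 'c"
  assumes "f abs_summable_on A" "g abs_summable_on B"
  shows "(\<lambda>(x, y). f x * g y) abs_summable_on A \<times> B"
proof -
  have "(\<lambda>x. norm (f x) * infsum (\<lambda>y. norm (g y)) B) summable_on A"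
    by (intro summable_on_cmult_left assms)
  moreover have "norm (infsum (\<lambda>y. norm (f x * g y)) B) = norm (f x) * infsum (\<lambda>y. norm (g y)) B" for x
    by (simp add: norm_mult infsum_cmult_right' infsum_nonneg abs_mult)
  moreover have "(\<lambda>y. norm (f x * g y)) summable_on B" for x
    unfolding norm_mult by (intro summable_on_cmult_right assms)
  ultimately show ?thesis
    unfolding abs_summable_on_Sigma_iff by simp
qed

section \<open>Theta series: exponents and absolute convergence\<close>

definition tri :: "int \<Rightarrow> int"
  where "tri n = n * (n - 1) div 2"

lemma two_tri: "2 * tri n = n * (n - 1)"
  unfolding tri_def by simp

lemma tri_0 [simp]: "tri 0 = 0" and tri_1 [simp]: "tri 1 = 0"
  by (simp_all add: tri_def)

lemma tri_add: "tri (m + n) = tri m + tri n + m * n"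
proof -
  have "2 * tri (m + n) = 2 * (tri m + tri n + m * n)"
    by (simp add: two_tri distrib_left) (simp add: algebra_simps)
  then show ?thesis by simp
qed

lemma tri_plus_1: "tri (n + 1) = tri n + n"
  by (simp add: tri_add)

lemma tri_minus_1: "tri (n - 1) = tri n - n + 1"
  using tri_plus_1[of "n - 1"] by simp

lemma tri_reflect: "tri (1 - n) = tri n"
  unfolding tri_def by (simp add: algebra_simps)

lemma tri_minus: "tri (- n) = tri n + n"
  using tri_reflect[of "n + 1"] by (simp add: tri_plus_1)

lemma tri_nonneg: "tri n \<ge> 0"
proof -
  have "n * (n - 1) \<ge> 0"
    by (cases "n \<ge> 1") (auto intro: mult_nonpos_nonpos)
  then show ?thesis by (simp add: tri_def)
qed

lemma tri_of_nat_Suc: "tri (int (Suc n)) = tri (int n) + int n"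
  using tri_plus_1[of "int n"] by (simp add: add.commute)

lemma summable_on_int_split:
  fixes f :: "int \<Rightarrow> 'a :: banach"
  assumes "(\<lambda>n::nat. f (int n)) summable_on UNIV" "(\<lambda>n::nat. f (- int n)) summable_on UNIV"
  shows "f summable_on UNIV"
proof -
  have eq1: "{0..} = int ` UNIV"
  proof -
    have "x \<in> range int" if "x \<ge> 0" for x :: int
      using that by (intro image_eqI[of _ _ "nat x"]) auto
    then show ?thesis by auto
  qed
  have 1: "f summable_on {0..}"
    unfolding eq1 by (subst summable_on_reindex) (use assms in \<open>auto simp: o_def\<close>)
  have eq2: "{..(0::int)} = (\<lambda>n. - int n) ` UNIV"
  proof -
    have "x \<in> range (\<lambda>n. - int n)" if "x \<le> 0" for x :: int
      using that by (intro image_eqI[of _ _ "nat (- x)"]) auto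
    then show ?thesis by auto
  qed
  have 2: "f summable_on {..0}"
    unfolding eq2 by (subst summable_on_reindex) (use assms in \<open>auto simp: o_def inj_on_def\<close>)
  \<comment> \<open>The index 0 occurs in both halves and is removed from one of them.\<close>
  have "f summable_on {..<0}"
    by (rule summable_on_subset_banach[OF 2]) auto
  with 1 have "f summable_on {0..} \<union> {..<0}"
    by (rule summable_on_Un_disjoint) auto
  moreover have "UNIV = {0..} \<union> {..<(0::int)}" by auto
  ultimately show ?thesis by simp
qed

lemma summable_tri_power_nat:
  fixes r z :: real
  assumes "0 \<le> r" "r < 1" "0 \<le> z"
  shows "summable (\<lambda>n::nat. r powi tri (int n) * z ^ n)"
proof -
  have "(\<lambda>n. r ^ n * z) \<longlonglongrightarrow> 0"
    using assms by (auto intro!: tendsto_mult_left_zero LIMSEQ_realpow_zero)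
  then have "eventually (\<lambda>n. r ^ n * z < 1/2) sequentially"
    by (rule order_tendstoD) simp
  then obtain N where N: "\<And>n. n \<ge> N \<Longrightarrow> r ^ n * z < 1/2"
    by (auto simp: eventually_sequentially)
  show ?thesis
  proof (rule summable_ratio_test[of "1/2" N])
    fix n assume "n \<ge> N"
    \<comment> \<open>Consecutive terms have ratio r^n z, which tends to 0. For base 0, splitting
      the power fails only if the exponents sum to 0, which forces n = 0.\<close>
    have "r powi tri (int (Suc n)) = r powi tri (int n) * r ^ n"
    proof (cases "r = 0 \<and> tri (int n) + int n = 0")
      case True
      then have "n = 0" "tri (int n) = 0" using tri_nonneg[of "int n"] by auto
      then show ?thesis by simp
    next
      case False
      then show ?thesis unfolding tri_of_nat_Suc by (subst power_int_add) auto
    qed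
    then have "norm (r powi tri (int (Suc n)) * z ^ Suc n) = (r ^ n * z) * norm (r powi tri (int n) * z ^ n)"
      using assms by (simp add: abs_mult algebra_simps)
    also have "\<dots> \<le> (1/2) * norm (r powi tri (int n) * z ^ n)"
      by (rule mult_right_mono) (use N[OF \<open>n \<ge> N\<close>] in auto)
    finally show "norm (r powi tri (int (Suc n)) * z ^ Suc n) \<le> 1/2 * norm (r powi tri (int n) * z ^ n)" .
  qed simp
qed

lemma summable_tri_power_real:
  fixes r z :: real
  assumes "0 < r" "r < 1" "0 < z"
  shows "(\<lambda>n::int. r powi tri n * z powi n) summable_on UNIV"
proof (rule summable_on_int_split)
  have "summable (\<lambda>n::nat. r powi tri (int n) * z ^ n)"
    using assms by (intro summable_tri_power_nat) auto
  then show "(\<lambda>n::nat. r powi tri (int n) * z powi (int n)) summable_on UNIV"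
    using assms by (intro summable_nonneg_imp_summable_on) auto
  \<comment> \<open>By \<open>tri_minus\<close>, the negative half is the same series with r / z in
    place of z.\<close>
  have "summable (\<lambda>n::nat. r powi tri (int n) * (r / z) ^ n)"
    using assms by (intro summable_tri_power_nat) auto
  also have "(\<lambda>n::nat. r powi tri (int n) * (r / z) ^ n) = (\<lambda>n. r powi tri (- int n) * z powi (- int n))"
    using assms by (simp add: fun_eq_iff tri_minus power_int_add power_int_minus power_divide field_simps)
  finally show "(\<lambda>n::nat. r powi tri (- int n) * z powi (- int n)) summable_on UNIV"
    using assms by (intro summable_nonneg_imp_summable_on) auto
qed

lemma abs_summable_theta:
  fixes q z :: complex
  assumes "q \<noteq> 0" "norm q < 1" "z \<noteq> 0"
  shows "(\<lambda>n::int. q powi tri n * z powi n) abs_summable_on UNIV"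
  using summable_tri_power_real[of "norm q" "norm z"] assms by (simp add: norm_mult norm_power_int)

lemma abs_summable_theta_deriv:
  fixes q z :: complex
  assumes "q \<noteq> 0" "norm q < 1" "z \<noteq> 0"
  shows "(\<lambda>n::int. of_int n * (q powi tri n * z powi n)) abs_summable_on UNIV"
proof -
  \<comment> \<open>The factor n is absorbed into theta series at 2 |z| and |z| / 2; the two powers
    of 2 serve the two signs of n.\<close>
  have *: "\<bar>real_of_int n\<bar> \<le> 2 powi n + (1/2) powi n" for n
  proof -
    have le: "real m \<le> 2 ^ m" for m by (simp add: less_imp_le of_nat_less_two_power)
    show ?thesis
    proof (cases "n \<ge> 0")
      case True
      then obtain m where "n = int m" by (rule nonneg_int_cases)
      with le[of m] show ?thesis by (simp add: add_increasing2)
    next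
      case False
      then obtain m where "n = - int m" using nonpos_int_cases[of n] by auto
      with le[of m] show ?thesis by (simp add: add_increasing power_int_minus power_one_over)
    qed
  qed
  have "(\<lambda>n. norm q powi tri n * (norm z * 2) powi n + norm q powi tri n * (norm z * (1/2)) powi n) summable_on UNIV"
    by (intro summable_on_add summable_tri_power_real) (use assms in auto)
  then show ?thesis
  proof (rule summable_on_comparison_test)
    fix n :: int
    have "norm (of_int n * (q powi tri n * z powi n)) = \<bar>real_of_int n\<bar> * (norm q powi tri n * norm z powi n)"
      by (simp add: norm_mult norm_power_int)
    also have "\<dots> \<le> (2 powi n + (1/2) powi n) * (norm q powi tri n * norm z powi n)"
      by (intro mult_right_mono *) simp
    finally show "norm (of_int n * (q powi tri n * z powi n))
        \<le> norm q powi tri n * (norm z * 2) powi n + norm q powi tri n * (norm z * (1/2)) powi n"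
      unfolding power_int_mult_distrib by (simp add: algebra_simps)
  qed auto
qed

section \<open>The symbols (a;q)_n and (a;q)_inf\<close>

definition qpinf :: "complex \<Rightarrow> complex \<Rightarrow> complex"
  where "qpinf a q = (\<Prod>n. 1 - a * q ^ n)"

lemma convergent_qpinf:
  assumes "norm (q :: complex) < 1"
  shows "convergent_prod (\<lambda>n. 1 - a * q ^ n)"
  by (rule abs_convergent_prod_imp_convergent_prod, subst abs_convergent_prod_conv_summable)
    (use assms in \<open>auto simp: norm_mult norm_power intro!: summable_mult summable_geometric\<close>)

lemma qpoch_LIMSEQ:
  assumes "norm q < 1"
  shows "qpoch a q \<longlonglongrightarrow> qpinf a q"
proof -
  have "(\<lambda>n. \<Prod>k\<le>n. 1 - a * q ^ k) \<longlonglongrightarrow> qpinf a q"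
    unfolding qpinf_def by (rule convergent_prod_LIMSEQ[OF convergent_qpinf[OF assms]])
  then have "(\<lambda>n. qpoch a q (Suc n)) \<longlonglongrightarrow> qpinf a q"
    by (simp add: qpoch_def lessThan_Suc_atMost)
  then show ?thesis by (rule LIMSEQ_imp_Suc)
qed

lemma qpinf_nonzero:
  assumes "norm q < 1" "\<And>n. a * q ^ n \<noteq> 1"
  shows "qpinf a q \<noteq> 0"
  unfolding qpinf_def by (rule prodinf_nonzero[OF convergent_qpinf[OF assms(1)]]) (use assms(2) in \<open>metis eq_iff_diff_eq_0\<close>)

lemma qpoch_0 [simp]: "qpoch a q 0 = 1"
  by (simp add: qpoch_def)

lemma qpoch_Suc: "qpoch a q (Suc n) = qpoch a q n * (1 - a * q ^ n)"
  by (simp add: qpoch_def)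

lemma qpoch_rec: "qpoch a q (Suc n) = (1 - a) * qpoch (a * q) q n"
  unfolding qpoch_def by (subst prod.lessThan_Suc_shift) (simp add: mult_ac)

lemma qpoch_nonzero:
  fixes q :: complex
  assumes "norm q < 1" "norm a < 1"
  shows "qpoch a q n \<noteq> 0"
proof -
  have "norm (a * q ^ k) < 1" for k
  proof -
    have "norm a * norm q ^ k \<le> norm a * 1"
      using assms by (intro mult_left_mono power_le_one) auto
    with assms show ?thesis by (simp add: norm_mult norm_power)
  qed
  then have "a * q ^ k \<noteq> 1" for k
    by (metis less_irrefl norm_one)
  then show ?thesis
    unfolding qpoch_def by simp
qed

section \<open>Jacobi's triple product and cube identities\<close>

text \<open>The value 0 at negative arguments lets the finite identities below be sums over all integers.\<close>

definition rpoch :: "complex \<Rightarrow> int \<Rightarrow> complex"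
  where "rpoch q k = (if k < 0 then 0 else 1 / qpoch q q (nat k))"

lemma rpoch_of_nat: "rpoch q (int n) = 1 / qpoch q q n"
  by (simp add: rpoch_def)

lemma rpoch_0 [simp]: "rpoch q 0 = 1"
  by (simp add: rpoch_def)

lemma rpoch_neg [simp]: "k < 0 \<Longrightarrow> rpoch q k = 0"
  by (simp add: rpoch_def)

text \<open>At k = 0 the factor 1 - q^0 vanishes, in accordance with the value 0 at -1. The
  recurrence thus holds for all integers, and boundary terms of finite sums need no separate
  treatment.\<close>

lemma rpoch_rec:
  assumes "norm q < 1"
  shows "rpoch q (k - 1) = (1 - q powi k) * rpoch q k"
proof (cases "k > 0")
  case True
  define n where "n = nat (k - 1)"
  then have k: "k = int (Suc n)" using True by simp
  have "qpoch q q n \<noteq> 0" "qpoch q q (Suc n) \<noteq> 0"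
    using assms by (intro qpoch_nonzero; simp)+
  moreover have "q powi k = q * q ^ n"
    by (simp only: k power_int_of_nat power_Suc)
  ultimately show ?thesis
    using k by (simp add: rpoch_def qpoch_Suc nat_add_distrib del: of_nat_Suc) (simp add: qpoch_Suc field_simps)
next
  case False
  then show ?thesis by (cases "k = 0") auto
qed

lemma power_neq_1:
  fixes q :: complex
  assumes "norm q < 1" "n > 0"
  shows "q ^ n \<noteq> 1"
  using power_strict_mono[of "norm q" 1 n] assms by (metis less_irrefl norm_ge_zero norm_one norm_power power_one)

lemma qpinf_self_nonzero:
  assumes "norm q < 1"
  shows "qpinf q q \<noteq> 0"
  using power_neq_1[OF assms, of "Suc _"] by (intro qpinf_nonzero[OF assms]) simp

lemma power_twice: "q ^ (n * 2) = q ^ n * q ^ n" for q :: complex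
  by (simp add: mult_2_right power_add)

lemma rpoch_LIMSEQ:
  assumes "norm q < 1"
  shows "(\<lambda>N. rpoch q (int N + j)) \<longlonglongrightarrow> 1 / qpinf q q"
proof -
  note nz = qpinf_self_nonzero[OF assms]
  have "(\<lambda>n. 1 / qpoch q q n) \<longlonglongrightarrow> 1 / qpinf q q"
    by (intro tendsto_intros qpoch_LIMSEQ assms nz)
  moreover have "filterlim (\<lambda>N. nat (int N + j)) sequentially sequentially"
    unfolding filterlim_at_top eventually_sequentially
  proof
    fix Z show "\<exists>N. \<forall>n\<ge>N. Z \<le> nat (int n + j)"
      by (rule exI[of _ "nat (int Z - j)"]) auto
  qed
  ultimately have "(\<lambda>N. 1 / qpoch q q (nat (int N + j))) \<longlonglongrightarrow> 1 / qpinf q q"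
    by (rule filterlim_compose)
  moreover have "eventually (\<lambda>N. rpoch q (int N + j) = 1 / qpoch q q (nat (int N + j))) sequentially"
    using eventually_ge_at_top[of "nat (- j)"] by eventually_elim (auto simp: rpoch_def)
  ultimately show ?thesis
    by (simp add: tendsto_cong)
qed

lemma rpoch_bounded:
  assumes "norm q < 1"
  obtains K where "K > 0" "\<And>k. norm (rpoch q k) \<le> K"
proof -
  have "Bseq (\<lambda>n. rpoch q (int n))"
    using rpoch_LIMSEQ[OF assms, of 0] by (intro convergent_imp_Bseq) (auto simp: convergent_def)
  then obtain K where K: "K > 0" "\<And>n. norm (rpoch q (int n)) \<le> K"
    by (auto elim: BseqE)
  have "norm (rpoch q k) \<le> K" for k
    using K(1) K(2)[of "nat k"] by (cases "k < 0") auto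
  with K(1) show thesis by (rule that)
qed

lemma has_sum_int_shift:
  fixes f :: "int \<Rightarrow> 'a :: {comm_monoid_add, topological_space}"
  assumes "(f has_sum S) UNIV"
  shows "((\<lambda>j. f (j + k)) has_sum S) UNIV"
proof -
  have "bij (\<lambda>j::int. j + k)" by (rule bij_plus_right)
  then show ?thesis using assms has_sum_reindex_bij_betw[of "\<lambda>j. j + k" UNIV UNIV f] by blast
qed

lemma has_sum_int_reflect:
  fixes f :: "int \<Rightarrow> 'a :: {comm_monoid_add, topological_space}"
  assumes "(f has_sum S) UNIV"
  shows "((\<lambda>j. f (k - j)) has_sum S) UNIV"
proof -
  have "bij (\<lambda>j::int. k - j)" by (rule bij_betwI[where g = "\<lambda>j. k - j"]) auto
  then show ?thesis using assms has_sum_reindex_bij_betw[of "\<lambda>j. k - j" UNIV UNIV f] by blast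
qed

text \<open>A Gaussian binomial coefficient, 2N over N + j, weighted by q^(j(j-1)/2): the
  coefficient of z^j in (-z;q)_N (-q/z;q)_N, as \<open>jtp_finite\<close> shows.\<close>

definition jtp_coeff :: "complex \<Rightarrow> nat \<Rightarrow> int \<Rightarrow> complex"
  where "jtp_coeff q N j = q powi tri j * (qpoch q q (2 * N) * rpoch q (int N - j) * rpoch q (int N + j))"

text \<open>Passing from N to N + 1 multiplies the finite product by (1 + z q^N)(1 + q^(N+1)/z) = 1
  + q^(2N+1) + z q^N + q^(N+1)/z. The recurrence compares coefficients of z^j; it is checked by
  expressing all reciprocals through those of largest index, R1 and R2.\<close>

lemma jtp_coeff_Suc:
  assumes q: "q \<noteq> 0" "norm q < 1"
  shows "jtp_coeff q (Suc N) j =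
    (1 + q ^ (2 * N + 1)) * jtp_coeff q N j + q ^ N * jtp_coeff q N (j - 1) + q ^ (N + 1) * jtp_coeff q N (j + 1)"
proof -
  define A B T Q R1 R2 where "A = q ^ N" and "B = q powi j" and "T = q powi tri j" and "Q = qpoch q q (2 * N)"
    and "R1 = rpoch q (int N + 1 - j)" and "R2 = rpoch q (int N + 1 + j)"
  have B: "B \<noteq> 0" using q by (simp add: B_def)
  have p: "q powi (int N + 1 - j) = q * A / B" "q powi (int N + 1 + j) = q * A * B"
     "q powi (int N + j) = A * B" "q powi (int N - j) = A / B"
    using q by (simp_all add: A_def B_def power_int_add power_int_diff)
  have i: "int N + 1 - j - 1 = int N - j" "int N + 1 + j - 1 = int N + j" by simp_all
  note rr = rpoch_rec[OF q(2), of "int N + 1 - j", unfolded i p, folded R1_def]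
    rpoch_rec[OF q(2), of "int N + 1 + j", unfolded i p, folded R2_def]
  have r: "rpoch q (int N - j) = (1 - q * A / B) * R1"
     "rpoch q (int N + j) = (1 - q * A * B) * R2"
     "rpoch q (int N + j - 1) = (1 - A * B) * ((1 - q * A * B) * R2)"
     "rpoch q (int N - j - 1) = (1 - A / B) * ((1 - q * A / B) * R1)"
    using rr rpoch_rec[OF q(2), of "int N + j"] rpoch_rec[OF q(2), of "int N - j"] unfolding p by simp_all
  have t: "q powi tri (j - 1) = T * q / B" "q powi tri (j + 1) = T * B"
    using q by (simp_all add: T_def B_def tri_minus_1 tri_plus_1 power_int_add power_int_diff)
  have Q2: "qpoch q q (2 * Suc N) = Q * (1 - q * A\<^sup>2) * (1 - q\<^sup>2 * A\<^sup>2)"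
    by (simp add: Q_def A_def qpoch_Suc power_twice power2_eq_square algebra_simps)
  have l: "jtp_coeff q (Suc N) j = T * (Q * (1 - q * A\<^sup>2) * (1 - q\<^sup>2 * A\<^sup>2) * R1 * R2)"
    unfolding jtp_coeff_def Q2 by (simp add: T_def R1_def R2_def algebra_simps)
  have m1: "jtp_coeff q N j = T * (Q * ((1 - q * A / B) * R1) * ((1 - q * A * B) * R2))"
    unfolding jtp_coeff_def r by (simp add: T_def Q_def)
  have e: "int N - (j - 1) = int N + 1 - j" "int N + (j - 1) = int N + j - 1"
     "int N - (j + 1) = int N - j - 1" "int N + (j + 1) = int N + 1 + j" by simp_all
  have m2: "jtp_coeff q N (j - 1) = (T * q / B) * (Q * R1 * ((1 - A * B) * ((1 - q * A * B) * R2)))"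
    unfolding jtp_coeff_def e r t by (simp add: R1_def Q_def)
  have m3: "jtp_coeff q N (j + 1) = (T * B) * (Q * ((1 - A / B) * ((1 - q * A / B) * R1)) * R2)"
    unfolding jtp_coeff_def e r t by (simp add: R2_def Q_def)
  have c: "q ^ (2 * N + 1) = q * A\<^sup>2" "q ^ (N + 1) = q * A"
    by (simp_all add: A_def power_add power2_eq_square mult_2)
  \<comment> \<open>With the inverse of B as a variable subject to B C = 1, the remaining identity
    is polynomial and within reach of \<open>algebra\<close>.\<close>
  define C where "C = inverse B"
  have C: "B * C = 1" "x / B = x * C" for x using B by (simp_all add: C_def field_simps)
  have id: "(1 - q * A\<^sup>2) * (1 - q\<^sup>2 * A\<^sup>2) = (1 + q * A\<^sup>2) * ((1 - q * A * C) * (1 - q * A * B))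
      + A * (q * C) * ((1 - A * B) * (1 - q * A * B)) + q * A * B * ((1 - A * C) * (1 - q * A * C))"
    using C(1) by algebra
  show ?thesis
    unfolding l m1 m2 m3 c A_def[symmetric] C(2)
    using arg_cong[OF id, of "\<lambda>x. T * Q * R1 * R2 * x"] by (simp add: algebra_simps)
qed

lemma jtp_finite:
  assumes q: "q \<noteq> 0" "norm q < 1" and z: "z \<noteq> 0"
  shows "((\<lambda>j. jtp_coeff q N j * z powi j) has_sum (qpoch (- z) q N * qpoch (- (q / z)) q N)) UNIV"
proof (induction N)
  case 0
  have "jtp_coeff q 0 j = (if j = 0 then 1 else 0)" for j
    by (simp add: jtp_coeff_def) (metis rpoch_neg linorder_neqE_linordered_idom neg_less_0_iff_less)
  then show ?case
    by (intro has_sum_finite_neutralI[of "{0}"]) auto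
next
  case (Suc N)
  let ?S = "qpoch (- z) q N * qpoch (- (q / z)) q N"
  have 1: "((\<lambda>j. (1 + q ^ (2 * N + 1)) * (jtp_coeff q N j * z powi j)) has_sum (1 + q ^ (2 * N + 1)) * ?S) UNIV"
    by (rule has_sum_cmult_right[OF Suc])
  have 2: "((\<lambda>j. z * q ^ N * (jtp_coeff q N (j - 1) * z powi (j - 1))) has_sum (z * q ^ N) * ?S) UNIV"
    using has_sum_int_shift[OF Suc, of "-1"] by (intro has_sum_cmult_right) simp
  have 3: "((\<lambda>j. q ^ (N + 1) / z * (jtp_coeff q N (j + 1) * z powi (j + 1))) has_sum (q ^ (N + 1) / z) * ?S) UNIV"
    by (rule has_sum_cmult_right[OF has_sum_int_shift[OF Suc]])
  have "(1 + q ^ (2 * N + 1)) * ?S + (z * q ^ N) * ?S + (q ^ (N + 1) / z) * ?S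
      = qpoch (- z) q (Suc N) * qpoch (- (q / z)) q (Suc N)"
    using z by (simp add: qpoch_Suc field_simps power_twice)
  moreover have "(1 + q ^ (2 * N + 1)) * (jtp_coeff q N j * z powi j)
      + z * q ^ N * (jtp_coeff q N (j - 1) * z powi (j - 1))
      + q ^ (N + 1) / z * (jtp_coeff q N (j + 1) * z powi (j + 1)) = jtp_coeff q (Suc N) j * z powi j" for j
    unfolding jtp_coeff_Suc[OF q] using z by (simp add: power_int_add power_int_diff field_simps)
  ultimately show ?case
    using has_sum_add[OF has_sum_add[OF 1 2] 3] by simp
qed

lemma jtp_coeff_LIMSEQ:
  assumes "norm q < 1"
  shows "(\<lambda>N. jtp_coeff q N j) \<longlonglongrightarrow> q powi tri j / qpinf q q"
proof -
  have "(\<lambda>N. qpoch q q (2 * N)) \<longlonglongrightarrow> qpinf q q"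
    by (rule filterlim_compose[OF qpoch_LIMSEQ[OF assms] filterlim_subseq]) (simp add: strict_mono_def)
  then have "(\<lambda>N. jtp_coeff q N j) \<longlonglongrightarrow> q powi tri j * (qpinf q q * (1 / qpinf q q) * (1 / qpinf q q))"
    unfolding jtp_coeff_def
    using rpoch_LIMSEQ[OF assms, of "- j"] rpoch_LIMSEQ[OF assms, of j] by (intro tendsto_intros) simp_all
  with qpinf_self_nonzero[OF assms] show ?thesis by (simp add: field_simps)
qed

lemma jtp_coeff_bounded:
  assumes "norm q < 1"
  obtains K where "\<And>N j. norm (jtp_coeff q N j) \<le> K * norm (q powi tri j)"
proof -
  obtain K where K: "K > 0" "\<And>k. norm (rpoch q k) \<le> K" by (rule rpoch_bounded[OF assms]) blast
  have "Bseq (qpoch q q)"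
    using qpoch_LIMSEQ[OF assms] by (intro convergent_imp_Bseq) (auto simp: convergent_def)
  then obtain L where L: "L > 0" "\<And>n. norm (qpoch q q n) \<le> L"
    by (auto elim: BseqE)
  have "norm (jtp_coeff q N j) \<le> norm (q powi tri j) * (L * K * K)" for N j
    unfolding jtp_coeff_def norm_mult
    by (intro mult_mono K L mult_nonneg_nonneg norm_ge_zero order_refl) (use K L in auto)
  then show thesis by (intro that[of "L * K * K"]) (simp add: mult_ac)
qed

text \<open>The limit of \<open>jtp_finite\<close>: the Gaussian binomials tend to 1 / (q;q)_inf and
  are bounded uniformly in N and j, so the theta series dominates.\<close>

theorem jacobi_triple_product:
  assumes q: "q \<noteq> 0" "norm q < 1" and z: "z \<noteq> 0"
  shows "((\<lambda>j. q powi tri j * z powi j) has_sum (qpinf (- z) q * qpinf (- (q / z)) q * qpinf q q)) UNIV"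
proof -
  obtain K where K: "\<And>N j. norm (jtp_coeff q N j) \<le> K * norm (q powi tri j)"
    by (rule jtp_coeff_bounded[OF q(2)]) blast
  have "((\<lambda>j. q powi tri j / qpinf q q * z powi j) has_sum (qpinf (- z) q * qpinf (- (q / z)) q)) UNIV"
  proof (rule has_sum_dominated_limit[OF jtp_finite[OF q z]])
    show "norm (jtp_coeff q N j * z powi j) \<le> K * norm (q powi tri j * z powi j)" for N j
      unfolding norm_mult mult.assoc[symmetric] by (intro mult_right_mono K norm_ge_zero)
    show "(\<lambda>j. K * norm (q powi tri j * z powi j)) summable_on UNIV"
      by (intro summable_on_cmult_right abs_summable_theta q z)
    show "(\<lambda>N. jtp_coeff q N j * z powi j) \<longlonglongrightarrow> q powi tri j / qpinf q q * z powi j" for j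
      by (intro tendsto_intros jtp_coeff_LIMSEQ q)
    show "(\<lambda>N. qpoch (- z) q N * qpoch (- (q / z)) q N) \<longlonglongrightarrow> qpinf (- z) q * qpinf (- (q / z)) q"
      by (intro tendsto_intros qpoch_LIMSEQ q)
  qed
  from has_sum_cmult_right[OF this, of "qpinf q q"] show ?thesis
    using qpinf_self_nonzero[OF q(2)] by (simp add: mult_ac)
qed

section \<open>Jacobi's cube identity\<close>

lemma jtp_coeff_alternating_sum:
  assumes q: "q \<noteq> 0" "norm q < 1"
  shows "((\<lambda>j. jtp_coeff q N j * (-1) powi j) has_sum (if N = 0 then 1 else 0)) UNIV"
proof -
  have "qpoch (1 :: complex) q N = (if N = 0 then 1 else 0)"
    by (cases N) (simp_all add: qpoch_rec)
  then show ?thesis using jtp_finite[OF q, of "-1" N] by (cases N) auto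
qed

text \<open>This is z d/dz of the finite triple product at z = -1, where its factor 1 + z has a
  simple zero. Instead of differentiating, the recurrence of \<open>jtp_coeff\<close> is applied to
  the first moment D; the index shifts bring in the zeroth moment, which is nonzero only at N =
  0.\<close>

lemma jtp_coeff_derivative_sum:
  assumes q: "q \<noteq> 0" "norm q < 1"
  shows "((\<lambda>j. of_int j * (jtp_coeff q (Suc N) j * (-1) powi j)) has_sum (- (qpoch q q N * qpoch q q (Suc N)))) UNIV"
proof -
  have step: "((\<lambda>j. of_int j * (jtp_coeff q (Suc N) j * (-1) powi j)) has_sum
      ((1 - q ^ N) * (1 - q ^ (N + 1)) * D - (q ^ N - q ^ (N + 1)) * (if N = 0 then 1 else 0))) UNIV"
    if D: "((\<lambda>j. of_int j * (jtp_coeff q N j * (-1) powi j)) has_sum D) UNIV" for N D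
  proof -
    let ?E = "if N = 0 then 1 else 0 :: complex"
    note E = jtp_coeff_alternating_sum[OF q, of N]
    have 1: "((\<lambda>j. (1 + q ^ (2 * N + 1)) * (of_int j * (jtp_coeff q N j * (-1) powi j))) has_sum (1 + q ^ (2 * N + 1)) * D) UNIV"
      by (rule has_sum_cmult_right[OF D])
    have s: "((\<lambda>j. (of_int j + c) * (jtp_coeff q N j * (-1) powi j)) has_sum (D + c * ?E)) UNIV" for c
      using has_sum_add[OF D has_sum_cmult_right[OF E, of c]] by (simp add: algebra_simps)
    have 2: "((\<lambda>j. - (q ^ N) * (of_int j * (jtp_coeff q N (j - 1) * (-1) powi (j - 1)))) has_sum (- (q ^ N)) * (D + ?E)) UNIV"
      using has_sum_int_shift[OF s[of 1], of "-1"] by (intro has_sum_cmult_right) simp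
    have 3: "((\<lambda>j. - (q ^ (N + 1)) * (of_int j * (jtp_coeff q N (j + 1) * (-1) powi (j + 1)))) has_sum (- (q ^ (N + 1))) * (D - ?E)) UNIV"
      using has_sum_int_shift[OF s[of "-1"], of 1] by (intro has_sum_cmult_right) simp
    have "(1 + q ^ (2 * N + 1)) * (of_int j * (jtp_coeff q N j * (-1) powi j))
      + - (q ^ N) * (of_int j * (jtp_coeff q N (j - 1) * (-1) powi (j - 1)))
      + - (q ^ (N + 1)) * (of_int j * (jtp_coeff q N (j + 1) * (-1) powi (j + 1)))
      = of_int j * (jtp_coeff q (Suc N) j * (-1) powi j)" for j
      unfolding jtp_coeff_Suc[OF q] by (simp add: power_int_add power_int_diff algebra_simps)
    moreover have "(1 + q ^ (2 * N + 1)) * D + (- (q ^ N)) * (D + ?E) + (- (q ^ (N + 1))) * (D - ?E)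
      = (1 - q ^ N) * (1 - q ^ (N + 1)) * D - (q ^ N - q ^ (N + 1)) * ?E"
      by (simp add: algebra_simps power_twice)
    ultimately show ?thesis
      using has_sum_add[OF has_sum_add[OF 1 2] 3] by simp
  qed
  show ?thesis
  proof (induction N)
    case 0
    have "jtp_coeff q 0 j = (if j = 0 then 1 else 0)" for j
      by (simp add: jtp_coeff_def) (metis rpoch_neg linorder_neqE_linordered_idom neg_less_0_iff_less)
    then have "((\<lambda>j. of_int j * (jtp_coeff q 0 j * (-1) powi j)) has_sum 0) UNIV"
      by (intro has_sum_finite_neutralI[of "{0}"]) auto
    from step[OF this] show ?case by (simp add: qpoch_Suc)
  next
    case (Suc N)
    from step[OF this] show ?case by (simp add: qpoch_Suc algebra_simps)
  qed
qed

theorem jacobi_cube_int: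
  assumes q: "q \<noteq> 0" "norm q < 1"
  shows "((\<lambda>j. of_int j * (q powi tri j * (-1) powi j)) has_sum (- (qpinf q q ^ 3))) UNIV"
proof -
  obtain K where K: "\<And>N j. norm (jtp_coeff q N j) \<le> K * norm (q powi tri j)"
    by (rule jtp_coeff_bounded[OF q(2)]) blast
  have "((\<lambda>j. of_int j * (q powi tri j / qpinf q q * (-1) powi j)) has_sum (- (qpinf q q * qpinf q q))) UNIV"
  proof (rule has_sum_dominated_limit[OF jtp_coeff_derivative_sum[OF q]])
    show "norm (of_int j * (jtp_coeff q (Suc N) j * (-1) powi j)) \<le> K * norm (of_int j * (q powi tri j * (-1) powi j))" for N j
      using mult_left_mono[OF K[of "Suc N" j], of "\<bar>real_of_int j\<bar>"] by (simp add: norm_mult norm_power_int mult_ac)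
    show "(\<lambda>j. K * norm (of_int j * (q powi tri j * (-1) powi j))) summable_on UNIV"
      by (intro summable_on_cmult_right abs_summable_theta_deriv q) simp
    show "(\<lambda>N. of_int j * (jtp_coeff q (Suc N) j * (-1) powi j)) \<longlonglongrightarrow> of_int j * (q powi tri j / qpinf q q * (-1) powi j)" for j
      by (intro tendsto_intros LIMSEQ_Suc jtp_coeff_LIMSEQ q)
    show "(\<lambda>N. - (qpoch q q N * qpoch q q (Suc N))) \<longlonglongrightarrow> - (qpinf q q * qpinf q q)"
      by (intro tendsto_intros LIMSEQ_Suc qpoch_LIMSEQ q)
  qed
  from has_sum_cmult_right[OF this, of "qpinf q q"] show ?thesis
    using qpinf_self_nonzero[OF q(2)] by (simp add: mult_ac power3_eq_cube)
qed

section \<open>The universal mock theta function as an Appell sum\<close>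

text \<open>The numerator over 1 - x q^j in the partial fraction expansion
  \<open>pf_expansion\<close>, whose poles x = q^(-j) have -N-1 \<le> j \<le> N.\<close>

definition pf_coeff :: "complex \<Rightarrow> nat \<Rightarrow> int \<Rightarrow> complex"
  where "pf_coeff q N j = (-1) powi j * q powi tri (j + 1) * (rpoch q (int N - j) * rpoch q (int N + 1 + j))"

lemma pf_coeff_eq_0: "j \<notin> {- int N - 1..int N} \<Longrightarrow> pf_coeff q N j = 0"
  by (auto simp: pf_coeff_def not_le)

lemma pf_coeff_rec:
  assumes q: "q \<noteq> 0" "norm q < 1"
  shows "pf_coeff q N j = (1 - q ^ (N + 1) / q powi j) * (1 - q ^ (N + 2) * q powi j) * pf_coeff q (Suc N) j"
proof -
  have p: "q powi (int (Suc N) - j) = q ^ (N + 1) / q powi j" "q powi (int (Suc N) + 1 + j) = q ^ (N + 2) * q powi j"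
    using q by (simp_all add: power_int_add power_int_diff power2_eq_square)
  have i: "int (Suc N) - j - 1 = int N - j" "int (Suc N) + 1 + j - 1 = int N + 1 + j" by simp_all
  show ?thesis
    unfolding pf_coeff_def
    using rpoch_rec[OF q(2), of "int (Suc N) - j", unfolded i p] rpoch_rec[OF q(2), of "int (Suc N) + 1 + j", unfolded i p]
    by simp
qed

text \<open>The reflection of j to -1 - j reverses the sign of every coefficient. In terms of
  \<open>pf_expansion\<close>, the sum is the value of the rational function at x = 0.\<close>

lemma pf_coeff_sum:
  assumes "q \<noteq> 0"
  shows "(pf_coeff q N has_sum 0) UNIV"
proof -
  let ?S = "sum (pf_coeff q N) {- int N - 1..int N}"
  have S: "(pf_coeff q N has_sum ?S) UNIV"
    by (intro has_sum_finite_neutralI[of "{- int N - 1..int N}"] pf_coeff_eq_0) auto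
  have "pf_coeff q N (-1 - j) = - pf_coeff q N j" for j
  proof -
    have "tri (-1 - j + 1) = tri (j + 1)"
      using tri_reflect[of "j + 1"] by simp
    moreover have "int N - (-1 - j) = int N + 1 + j" "int N + 1 + (-1 - j) = int N - j" by simp_all
    moreover have "(-1) powi (-1 - j) = - ((-1 :: complex) powi j)"
      by (simp add: power_int_diff power_int_minus_left)
    ultimately show ?thesis
      unfolding pf_coeff_def by (simp only: mult.commute mult_minus_left mult_minus_right)
  qed
  then have "((\<lambda>j. - pf_coeff q N j) has_sum ?S) UNIV"
    using has_sum_int_reflect[OF S, of "-1"] by simp
  from has_sum_add[OF S this] have "((\<lambda>j::int. 0) has_sum (?S + ?S)) UNIV" by simp
  then have "?S + ?S = 0" by (rule has_sum_unique) simp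
  then have "?S = 0" by simp
  with S show ?thesis by simp
qed

text \<open>In terms of \<open>pf_expansion\<close>: as x tends to infinity the rational function
  decays like x^(-N-1), so for N > 0 its 1/x coefficient vanishes.\<close>

lemma pf_coeff_weighted_sum:
  assumes q: "q \<noteq> 0" "norm q < 1" and "N > 0"
  shows "((\<lambda>j. pf_coeff q N j / q powi j) has_sum 0) UNIV"
proof -
  \<comment> \<open>The summands of the finite triple product at z = -1, divided by (q;q)_(2N).
    Their sum is 0 because (1;q)_N = 0 for N > 0, and e(j) - q^(N+1) e(j+1) is a multiple of the
    wanted summand.\<close>
  define e where "e j = (-1) powi j * q powi tri j * (rpoch q (int N - j) * rpoch q (int N + j))" for j
  have nz: "qpoch q q (2 * N) \<noteq> 0" "1 - q ^ (2 * N + 1) \<noteq> 0"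
    using qpoch_nonzero[OF q(2) q(2)] power_neq_1[OF q(2), of "2 * N + 1"] by auto
  have "((\<lambda>j. 1 / qpoch q q (2 * N) * (jtp_coeff q N j * (-1) powi j)) has_sum (1 / qpoch q q (2 * N) * 0)) UNIV"
    using jtp_coeff_alternating_sum[OF q, of N] \<open>N > 0\<close> by (intro has_sum_cmult_right) simp
  moreover have "1 / qpoch q q (2 * N) * (jtp_coeff q N j * (-1) powi j) = e j" for j
    using nz by (simp add: jtp_coeff_def e_def)
  ultimately have e: "(e has_sum 0) UNIV" by simp
  have e': "((\<lambda>j. - (q ^ (N + 1)) * e (j + 1)) has_sum (- (q ^ (N + 1)) * 0)) UNIV"
    by (rule has_sum_cmult_right[OF has_sum_int_shift[OF e]])
  have "e j + - (q ^ (N + 1)) * e (j + 1) = (1 - q ^ (2 * N + 1)) * (pf_coeff q N j / q powi j)" for j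
  proof -
    have p: "q powi (int N - j) = q ^ N / q powi j" "q powi (int N + 1 + j) = q ^ (N + 1) * q powi j"
      using q by (simp_all add: power_int_add power_int_diff)
    have i: "int N - j - 1 = int N - (j + 1)" "int N + 1 + j - 1 = int N + j" "int N + 1 + j = int N + (j + 1)" by simp_all
    have r: "rpoch q (int N - (j + 1)) = (1 - q ^ N / q powi j) * rpoch q (int N - j)"
      "rpoch q (int N + j) = (1 - q ^ (N + 1) * q powi j) * rpoch q (int N + (j + 1))"
      using rpoch_rec[OF q(2), of "int N - j"] rpoch_rec[OF q(2), of "int N + 1 + j"]
      unfolding i(1,2) p unfolding i(3) by simp_all
    define A B T P where "A = q ^ N" and "B = q powi j" and "T = q powi tri j" and "P = ((-1) powi j :: complex)"
    have B: "B \<noteq> 0" using q by (simp add: B_def)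
    have s: "(-1) powi (j + 1) = - ((-1) powi j :: complex)" and t: "q powi tri (j + 1) = q powi tri j * B" "q ^ (2 * N + 1) = A * A * q"
      using q by (simp_all add: tri_plus_1 power_int_add B_def A_def power_twice mult.commute[of 2])
    show ?thesis
      unfolding e_def pf_coeff_def r i(3) B_def[symmetric] s t
      unfolding power_add power_mult T_def[symmetric] P_def[symmetric] A_def[symmetric]
      using B by (simp add: field_simps power2_eq_square)
  qed
  with has_sum_add[OF e e'] have "((\<lambda>j. (1 - q ^ (2 * N + 1)) * (pf_coeff q N j / q powi j)) has_sum 0) UNIV"
    by simp
  with nz show ?thesis by (subst (asm) has_sum_cmult_right_iff) auto
qed

text \<open>Induction on N. The new factors W differ from their value at the pole x = q^(-j), which
  is the factor in \<open>pf_coeff_rec\<close>, by a multiple of 1 - x q^j. The quotient is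
  q^(N+1)/q^j - q^(N+2)/x, and its contributions cancel by the two preceding sums.\<close>

lemma pf_expansion:
  assumes q: "q \<noteq> 0" "norm q < 1" and x: "x \<noteq> 0" "\<And>j. x * q powi j \<noteq> 1"
  shows "((\<lambda>j. pf_coeff q N j / (1 - x * q powi j)) has_sum 
     (1 / (qpoch x q (Suc N) * qpoch (q / x) q (Suc N)))) UNIV"
proof (induction N)
  case 0
  have nz: "1 - x \<noteq> 0" "x \<noteq> q" "1 - q \<noteq> 0"
    using x(2)[of 0] x(2)[of "-1"] q by (auto simp: field_simps)
  have "rpoch q 1 = 1 / (1 - q)"
    using rpoch_of_nat[of q 1] by (simp add: qpoch_def)
  then have "pf_coeff q 0 0 = 1 / (1 - q)" "pf_coeff q 0 (-1) = - (1 / (1 - q))"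
    by (simp_all add: pf_coeff_def)
  moreover have "1 / ((1 - x) * (1 - q / x)) = - (1 / (1 - q)) / (1 - x * q powi (-1)) + 1 / (1 - q) / (1 - x)"
    using nz q x by (simp add: power_int_minus divide_simps) (simp add: algebra_simps)
  moreover have "{-1..0} = {-1, 0 :: int}" by auto
  ultimately have "1 / (qpoch x q (Suc 0) * qpoch (q / x) q (Suc 0)) = (\<Sum>j\<in>{-1..0}. pf_coeff q 0 j / (1 - x * q powi j))"
    by (simp add: qpoch_def)
  then show ?case
    by (intro has_sum_finite_neutralI[of "{-1..0}"]) (simp_all add: pf_coeff_eq_0)
next
  case (Suc N)
  let ?W = "(1 - x * q ^ (N + 1)) * (1 - q ^ (N + 2) / x)"
  let ?S = "1 / (qpoch x q (Suc N) * qpoch (q / x) q (Suc N))"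
  have "q ^ (N + 2) \<noteq> x"
  proof -
    have "q powi (- int (N + 2)) = inverse (q ^ (N + 2))" by (simp only: power_int_minus power_int_of_nat)
    then have "x * inverse (q ^ (N + 2)) \<noteq> 1" using x(2)[of "- int (N + 2)"] by simp
    then show ?thesis using q by (metis power_not_zero right_inverse)
  qed
  moreover have "x * q ^ (N + 1) \<noteq> 1"
    using x(2)[of "int (N + 1)", unfolded power_int_of_nat] .
  ultimately have W: "?W \<noteq> 0" using x(1) by (metis divide_eq_1_iff mult_eq_0_iff right_minus_eq)
  have 1: "((\<lambda>j. q ^ (N + 1) * (pf_coeff q (Suc N) j / q powi j)) has_sum q ^ (N + 1) * 0) UNIV"
    by (intro has_sum_cmult_right pf_coeff_weighted_sum q) simp
  have 2: "((\<lambda>j. - (q ^ (N + 2) / x) * pf_coeff q (Suc N) j) has_sum - (q ^ (N + 2) / x) * 0) UNIV"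
    by (intro has_sum_cmult_right pf_coeff_sum q)
  have "pf_coeff q N j / (1 - x * q powi j) + q ^ (N + 1) * (pf_coeff q (Suc N) j / q powi j)
      + - (q ^ (N + 2) / x) * pf_coeff q (Suc N) j = ?W * (pf_coeff q (Suc N) j / (1 - x * q powi j))" for j
  proof -
    define B c A where "B = q powi j" and "c = pf_coeff q (Suc N) j" and "A = q ^ (N + 1)"
    have B: "B \<noteq> 0" "1 - x * B \<noteq> 0" using q x(2)[of j] by (auto simp: B_def)
    have c: "pf_coeff q N j = (1 - A / B) * (1 - q * A * B) * c"
      using pf_coeff_rec[OF q, of N j] by (simp add: A_def B_def c_def)
    have "q ^ (N + 2) = q * A" by (simp add: A_def)
    show ?thesis
      unfolding c B_def[symmetric] c_def[symmetric] \<open>q ^ (N + 2) = q * A\<close> A_def[symmetric]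
      using B x(1) by (simp add: divide_simps) (simp add: algebra_simps)
  qed
  with has_sum_add[OF has_sum_add[OF Suc 1] 2]
  have "((\<lambda>j. ?W * (pf_coeff q (Suc N) j / (1 - x * q powi j))) has_sum ?S) UNIV"
    by simp
  then have "((\<lambda>j. pf_coeff q (Suc N) j / (1 - x * q powi j)) has_sum ?S / ?W) UNIV"
    using W by (subst (asm) has_sum_cmult_right_iff) auto
  moreover have "?S / ?W = 1 / (qpoch x q (Suc (Suc N)) * qpoch (q / x) q (Suc (Suc N)))"
    by (simp add: qpoch_Suc mult_ac)
  ultimately show ?case by simp
qed

text \<open>Combinatorially, partitions are sorted by the largest m by m + k rectangle in their
  diagram. The proof shows by telescoping that the sum does not depend on k, and then lets k tend to
  infinity, where only m = 0 survives.\<close>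

lemma durfee_rectangle:
  assumes q: "q \<noteq> 0" "norm q < 1"
  shows "((\<lambda>m. q ^ (m * (m + k)) * (rpoch q (int m) * rpoch q (int (m + k)))) has_sum (1 / qpinf q q)) UNIV"
proof -
  define t where "t k m = q ^ (m * (m + k)) * (rpoch q (int m) * rpoch q (int (m + k)))" for k m
  obtain K where K: "K > 0" "\<And>k. norm (rpoch q k) \<le> K" by (rule rpoch_bounded[OF q(2)]) blast
  have pw: "norm q ^ (m * (m + k)) \<le> norm q ^ m" for m k
    using q by (intro power_decreasing) (simp_all add: distrib_left trans_le_add1)
  have rb: "norm (rpoch q i * rpoch q j) \<le> K * K" for i j
    unfolding norm_mult using K by (intro mult_mono) auto
  have bound: "norm (t k m) \<le> K * K * norm q ^ m" for k m
    using mult_mono[OF pw[of m k] rb[of "int m" "int (m + k)"]] K(1)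
    by (simp add: t_def norm_mult norm_power mult_ac)
  have sg: "summable (\<lambda>m. K * K * norm q ^ m)"
    using q by (intro summable_mult summable_geometric) auto
  have t_summable: "summable (\<lambda>m. norm (t k m))" for k
    by (rule summable_comparison_test'[OF sg]) (use bound in auto)
  note t_summable' = summable_norm_cancel[OF t_summable]
  have suminf_step: "suminf (t k) = suminf (t (Suc k))" for k
  proof -
    \<comment> \<open>The telescoping witness: the terms for k and k + 1 differ by u(m) - u(m+1).
      Its value at m = 0 is 0 since \<open>rpoch\<close> vanishes at -1.\<close>
    define u where "u m = q ^ (m * (m + k)) * (rpoch q (int m - 1) * rpoch q (int (m + k)))" for m
    have "t k m - t (Suc k) m = u m - u (Suc m)" for m
    proof -
      have i: "int (m + Suc k) - 1 = int (m + k)" by simp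
      have p: "q powi int m = q ^ m" "q powi int (m + Suc k) = q ^ (m + Suc k)" by (simp_all only: power_int_of_nat)
      note r = rpoch_rec[OF q(2), of "int m", unfolded p] rpoch_rec[OF q(2), of "int (m + Suc k)", unfolded i p]
      have u1: "u (Suc m) = q ^ (Suc m * (Suc m + k)) * (rpoch q (int m) * rpoch q (int (m + Suc k)))"
        by (simp add: u_def)
      define P a b where "P = q ^ (m * (m + k))" and "a = q ^ m" and "b = q ^ (m + Suc k)"
      have e: "m * (m + Suc k) = m * (m + k) + m" "Suc m * (Suc m + k) = m * (m + k) + m + (m + Suc k)"
        by (simp_all add: algebra_simps)
      have w: "q ^ (m * (m + Suc k)) = P * a" "q ^ (Suc m * (Suc m + k)) = P * a * b"
        unfolding e power_add P_def a_def b_def by (rule refl)+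
      show ?thesis
        unfolding t_def u1 unfolding u_def r w P_def[symmetric] a_def[symmetric] b_def[symmetric]
        by (simp add: algebra_simps)
    qed
    moreover have "u \<longlonglongrightarrow> 0"
    proof (rule Lim_null_comparison)
      show "eventually (\<lambda>m. norm (u m) \<le> K * K * norm q ^ m) sequentially"
      proof (intro always_eventually allI)
        fix m show "norm (u m) \<le> K * K * norm q ^ m"
          using mult_mono[OF pw[of m k] rb[of "int m - 1" "int (m + k)"]] K(1)
          by (simp add: u_def norm_mult norm_power mult_ac)
      qed
    qed (use summable_LIMSEQ_zero[OF sg] in simp)
    ultimately have "(\<lambda>m. t k m - t (Suc k) m) sums (u 0)"
      using telescope_sums'[of u 0] by simp
    moreover have "u 0 = 0" by (simp add: u_def)
    moreover have "(\<lambda>m. t k m - t (Suc k) m) sums (suminf (t k) - suminf (t (Suc k)))"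
      by (intro sums_diff summable_sums t_summable')
    ultimately show ?thesis by (auto dest: sums_unique2)
  qed
  then have const: "suminf (t k) = suminf (t 0)" for k
    by (induction k) metis+
  have hs: "(t k has_sum suminf (t 0)) UNIV" for k
    unfolding const[of k, symmetric]
    by (intro norm_summable_imp_has_sum t_summable summable_sums t_summable')
  have "((\<lambda>m::nat. if m = 0 then 1 / qpinf q q else 0) has_sum suminf (t 0)) UNIV"
  proof (rule has_sum_dominated_limit[where f = t and S = "\<lambda>_. suminf (t 0)"])
    show "(t k has_sum suminf (t 0)) UNIV" for k by (rule hs)
    show "norm (t k m) \<le> K * K * norm q ^ m" for k m by (rule bound)
    show "(\<lambda>m. K * K * norm q ^ m) summable_on UNIV"
      by (intro summable_nonneg_imp_summable_on sg) (use K in auto)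
    fix m
    show "(\<lambda>k. t k m) \<longlonglongrightarrow> (if m = 0 then 1 / qpinf q q else 0)"
    proof (cases "m = 0")
      case True
      then show ?thesis using rpoch_LIMSEQ[OF q(2), of 0] by (simp add: t_def)
    next
      case False
      have "(\<lambda>k. K * K * norm q ^ k) \<longlonglongrightarrow> 0"
        using summable_LIMSEQ_zero[OF sg] .
      moreover have "norm (t k m) \<le> K * K * norm q ^ k" for k
      proof -
        have "norm q ^ (m * (m + k)) \<le> norm q ^ k"
          using q False mult_le_mono[of 1 m k "m + k"] by (intro power_decreasing) simp_all
        from mult_mono[OF this rb[of "int m" "int (m + k)"]] K(1) show ?thesis
          by (simp add: t_def norm_mult norm_power mult_ac)
      qed
      ultimately have "(\<lambda>k. t k m) \<longlonglongrightarrow> 0"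
        by (intro Lim_null_comparison[of "\<lambda>k. t k m"]) auto
      with False show ?thesis by simp
    qed
  qed auto
  moreover have "((\<lambda>m::nat. if m = 0 then 1 / qpinf q q else 0) has_sum (1 / qpinf q q)) UNIV"
    by (intro has_sum_finite_neutralI[of "{0}"]) auto
  ultimately have "suminf (t 0) = 1 / qpinf q q"
    by (rule has_sum_unique)
  with hs[of k] show ?thesis by (simp add: t_def[abs_def])
qed

text \<open>For j \<ge> 0 these are rectangles with side difference 2j + 1, reindexed by n = m + j;
  the terms with n < j vanish.\<close>

lemma durfee_rectangle_int:
  assumes q: "q \<noteq> 0" "norm q < 1"
  shows "((\<lambda>n::nat. q ^ (n * (n + 1)) * (rpoch q (int n - j) * rpoch q (int n + 1 + j)))
    has_sum (q powi (2 * tri (j + 1)) / qpinf q q)) UNIV"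
proof -
  have nonneg: "((\<lambda>n::nat. q ^ (n * (n + 1)) * (rpoch q (int n - int k) * rpoch q (int n + 1 + int k)))
    has_sum (q powi (2 * tri (int k + 1)) / qpinf q q)) UNIV" (is "(?f has_sum _) _") for k
  proof -
    have e: "q powi (2 * tri (int k + 1)) = q ^ (k * (k + 1))"
    proof -
      have "2 * tri (int k + 1) = int (k * (k + 1))"
        by (simp add: two_tri algebra_simps)
      then show ?thesis by (simp only: power_int_of_nat)
    qed
    have "((\<lambda>m. q ^ (k * (k + 1)) * (q ^ (m * (m + (2 * k + 1))) * (rpoch q (int m) * rpoch q (int (m + (2 * k + 1))))))
       has_sum (q ^ (k * (k + 1)) * (1 / qpinf q q))) UNIV"
      by (intro has_sum_cmult_right durfee_rectangle q)
    also have "(\<lambda>m. q ^ (k * (k + 1)) * (q ^ (m * (m + (2 * k + 1))) * (rpoch q (int m) * rpoch q (int (m + (2 * k + 1))))))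
      = (\<lambda>m. ?f (m + k))"
    proof
      fix m
      have "k * (k + 1) + m * (m + (2 * k + 1)) = (m + k) * (m + k + 1)" by (simp add: algebra_simps)
      then have "q ^ (k * (k + 1)) * q ^ (m * (m + (2 * k + 1))) = q ^ ((m + k) * (m + k + 1))"
        by (metis power_add)
      moreover have "int (m + k) - int k = int m" "int (m + k) + 1 + int k = int (m + (2 * k + 1))" by simp_all
      ultimately show "q ^ (k * (k + 1)) * (q ^ (m * (m + (2 * k + 1))) * (rpoch q (int m) * rpoch q (int (m + (2 * k + 1))))) = ?f (m + k)"
        by (simp only: mult.assoc[symmetric])
    qed
    finally have "(?f has_sum (q ^ (k * (k + 1)) * (1 / qpinf q q))) ((\<lambda>m. m + k) ` UNIV)"
      by (subst has_sum_reindex) (auto simp: o_def)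
    moreover have "?f n = 0" if "n \<notin> (\<lambda>m. m + k) ` UNIV" for n
    proof -
      have "n < k"
      proof (rule ccontr)
        assume "\<not> n < k"
        then have "n = (n - k) + k" by simp
        then show False using that by (metis rangeI)
      qed
      then show ?thesis by simp
    qed
    ultimately show ?thesis
      unfolding e by (subst (asm) has_sum_cong_neutral[where T = UNIV and g = ?f]) auto
  qed
  show ?thesis
  proof (cases "j \<ge> 0")
    case True
    then show ?thesis using nonneg[of "nat j"] by simp
  next
    case False
    \<comment> \<open>Replacing j by -1 - j exchanges the two \<open>rpoch\<close> factors and keeps
      \<open>tri (j + 1)\<close>.\<close>
    define k where "k = nat (- 1 - j)"
    have k: "j = - 1 - int k" using False by (simp add: k_def)
    have "tri (j + 1) = tri (int k + 1)"
      using tri_reflect[of "int k + 1"] by (simp add: k)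
    moreover have "int n - j = int n + 1 + int k" "int n + 1 + j = int n - int k" for n
      by (simp_all add: k)
    ultimately show ?thesis
      using nonneg[of k] by (simp only: mult.commute)
  qed
qed

lemma bounded_pole_terms:
  fixes q x :: complex
  assumes q: "q \<noteq> 0" "norm q < 1" and x: "x \<noteq> 0" "\<And>j. x * q powi j \<noteq> 1"
  obtains K where "K > 0" "\<And>j. norm (1 / (1 - x * q powi j)) \<le> K"
proof -
  have z: "(\<lambda>n. q ^ n) \<longlonglongrightarrow> 0" using q by (intro LIMSEQ_power_zero)
  have "(\<lambda>n. 1 / (1 - x * q ^ n)) \<longlonglongrightarrow> 1 / (1 - x * 0)"
    by (intro tendsto_intros z) auto
  then have "Bseq (\<lambda>n. 1 / (1 - x * q ^ n))" by (intro convergent_imp_Bseq) (auto simp: convergent_def)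
  then obtain K1 where K1: "K1 > 0" "\<And>n. norm (1 / (1 - x * q ^ n)) \<le> K1" by (auto elim: BseqE)
  \<comment> \<open>For j = -n the power q^j is unbounded, so the fraction is expanded by
    q^n.\<close>
  have "(\<lambda>n. q ^ n / (q ^ n - x)) \<longlonglongrightarrow> 0 / (0 - x)"
    by (intro tendsto_intros z) (use x in auto)
  then have "Bseq (\<lambda>n. q ^ n / (q ^ n - x))" by (intro convergent_imp_Bseq) (auto simp: convergent_def)
  then obtain K2 where K2: "K2 > 0" "\<And>n. norm (q ^ n / (q ^ n - x)) \<le> K2" by (auto elim: BseqE)
  have "norm (1 / (1 - x * q powi j)) \<le> K1 + K2" for j
  proof (cases "j \<ge> 0")
    case True
    then obtain n where "j = int n" by (rule nonneg_int_cases)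
    with K1(2)[of n] K2(1) show ?thesis by simp
  next
    case False
    then obtain n where n: "j = - int n" using nonpos_int_cases[of j] by auto
    have "1 / (1 - x * q powi j) = q ^ n / (q ^ n - x)"
      using q x(2)[of j] by (simp add: n power_int_minus divide_simps)
    with K2(2)[of n] K1(1) show ?thesis by simp
  qed
  with K1(1) K2(1) show thesis by (intro that[of "K1 + K2"]) auto
qed

lemma pole_series_abs_summable:
  fixes p q w x :: complex
  assumes q: "q \<noteq> 0" "norm q < 1" and x: "x \<noteq> 0" "\<And>j. x * q powi j \<noteq> 1"
    and p: "p \<noteq> 0" "norm p < 1" and w: "w \<noteq> 0"
  shows "(\<lambda>j. p powi tri (j + 1) * w powi j / (1 - x * q powi j)) abs_summable_on UNIV"
proof -
  obtain K where K: "K > 0" "\<And>j. norm (1 / (1 - x * q powi j)) \<le> K"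
    by (rule bounded_pole_terms[OF q x]) blast
  have "(\<lambda>j. norm (p powi tri (j + 1) * w powi (j + 1))) summable_on UNIV"
    using abs_summable_theta[OF p w] has_sum_int_shift[of "\<lambda>j. norm (p powi tri j * w powi j)" _ 1]
    unfolding summable_on_def by blast
  then have "(\<lambda>j. K / norm w * norm (p powi tri (j + 1) * w powi (j + 1))) summable_on UNIV"
    by (rule summable_on_cmult_right)
  then show ?thesis
  proof (rule summable_on_comparison_test)
    fix j :: int
    have "norm (p powi tri (j + 1) * w powi j / (1 - x * q powi j))
      = norm (1 / (1 - x * q powi j)) * norm (p powi tri (j + 1) * w powi j)"
      by (simp add: norm_mult norm_divide)
    also have "\<dots> \<le> K * norm (p powi tri (j + 1) * w powi j)"
      by (intro mult_right_mono K) simp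
    also have "\<dots> = K / norm w * norm (p powi tri (j + 1) * w powi (j + 1))"
      using w by (simp add: norm_mult power_int_add)
    finally show "norm (p powi tri (j + 1) * w powi j / (1 - x * q powi j))
      \<le> K / norm w * norm (p powi tri (j + 1) * w powi (j + 1))" .
  qed auto
qed

text \<open>A double sum over n and j evaluated in two ways. For fixed n it is the partial fraction
  expansion; for fixed j it is a sum over Durfee rectangles, whose exponent
  \<open>2 * tri (j + 1)\<close> joins the \<open>tri (j + 1)\<close> of \<open>pf_coeff\<close>.
  Since q^(n(n+1)) is dominated by |q|^n and the reciprocal products are bounded, the double sum
  converges absolutely.\<close>

theorem universal_mock_theta_appell:
  fixes q x :: complex
  assumes q: "q \<noteq> 0" "norm q < 1" and x: "x \<noteq> 0" "\<And>j. x * q powi j \<noteq> 1"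
    and S: "((\<lambda>j. (-1) powi j * q powi (3 * tri (j + 1)) / (1 - x * q powi j)) has_sum S) UNIV"
  shows "((\<lambda>n. q ^ (n * (n + 1)) / (qpoch x q (Suc n) * qpoch (q / x) q (Suc n))) has_sum (S / qpinf q q)) UNIV"
proof -
  define w where "w j = (-1) powi j * q powi tri (j + 1) / (1 - x * q powi j)" for j
  define f where "f = (\<lambda>(n, j). q ^ (n * (n + 1)) * (rpoch q (int n - j) * rpoch q (int n + 1 + j)) * w j)"
  obtain K where K: "K > 0" "\<And>k. norm (rpoch q k) \<le> K" by (rule rpoch_bounded[OF q(2)]) blast
  have rb: "norm (rpoch q i * rpoch q j) \<le> K * K" for i j
    unfolding norm_mult using K by (intro mult_mono) auto
  have 1: "(\<lambda>n::nat. K * K * norm q ^ n) summable_on UNIV"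
    using q K by (intro summable_nonneg_imp_summable_on summable_mult summable_geometric) auto
  have 2: "w abs_summable_on UNIV"
    using pole_series_abs_summable[OF q x q, of "-1"] by (simp add: w_def[abs_def] mult.commute)
  have "(\<lambda>(n, j). complex_of_real (K * K * norm q ^ n) * w j) abs_summable_on UNIV \<times> UNIV"
    by (rule abs_summable_on_times[OF _ 2]) (use 1 K in \<open>simp add: norm_mult norm_power abs_mult\<close>)
  then have "f abs_summable_on UNIV \<times> UNIV"
  proof (rule abs_summable_on_comparison_test)
    fix p :: "nat \<times> int"
    obtain n j where p: "p = (n, j)" by (cases p)
    have "norm q ^ (n * (n + 1)) \<le> norm q ^ n"
      using q by (intro power_decreasing) auto
    then have "norm q ^ (n * (n + 1)) * norm (rpoch q (int n - j) * rpoch q (int n + 1 + j)) \<le> norm q ^ n * (K * K)"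
      by (intro mult_mono rb) auto
    then have "norm q ^ (n * (n + 1)) * norm (rpoch q (int n - j) * rpoch q (int n + 1 + j)) * norm (w j)
      \<le> norm q ^ n * (K * K) * norm (w j)"
      by (rule mult_right_mono) simp
    moreover have "norm (f p) = norm q ^ (n * (n + 1)) * norm (rpoch q (int n - j) * rpoch q (int n + 1 + j)) * norm (w j)"
      by (simp only: p f_def norm_mult norm_power case_prod_conv)
    moreover have "norm (case p of (n, j) \<Rightarrow> complex_of_real (K * K * norm q ^ n) * w j) = norm q ^ n * (K * K) * norm (w j)"
      using K(1) by (simp add: p norm_mult norm_power)
    ultimately show "norm (f p) \<le> norm (case p of (n, j) \<Rightarrow> complex_of_real (K * K * norm q ^ n) * w j)"
      by simp
  qed
  then have fs: "(f has_sum infsum f (UNIV \<times> UNIV)) (UNIV \<times> UNIV)"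
    by (rule has_sum_infsum[OF abs_summable_summable])
  have rows: "((\<lambda>n. q ^ (n * (n + 1)) * (1 / (qpoch x q (Suc n) * qpoch (q / x) q (Suc n)))) has_sum infsum f (UNIV \<times> UNIV)) UNIV"
  proof (rule has_sum_SigmaD[OF fs])
    fix n
    have "(\<lambda>j. f (n, j)) = (\<lambda>j. q ^ (n * (n + 1)) * (pf_coeff q n j / (1 - x * q powi j)))"
      by (simp add: f_def w_def pf_coeff_def fun_eq_iff)
    moreover have "((\<lambda>j. q ^ (n * (n + 1)) * (pf_coeff q n j / (1 - x * q powi j))) has_sum
        q ^ (n * (n + 1)) * (1 / (qpoch x q (Suc n) * qpoch (q / x) q (Suc n)))) UNIV"
      by (intro has_sum_cmult_right pf_expansion q x)
    ultimately show "((\<lambda>j. f (n, j)) has_sum q ^ (n * (n + 1)) * (1 / (qpoch x q (Suc n) * qpoch (q / x) q (Suc n)))) UNIV"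
      by (simp only:)
  qed
  have cols: "((\<lambda>j. w j * (q powi (2 * tri (j + 1)) / qpinf q q)) has_sum infsum f (UNIV \<times> UNIV)) UNIV"
  proof (rule has_sum_SigmaD[OF fs[THEN has_sum_swap[THEN iffD1]]])
    fix j
    show "((\<lambda>n. case (j, n) of (x, y) \<Rightarrow> f (y, x)) has_sum w j * (q powi (2 * tri (j + 1)) / qpinf q q)) UNIV"
      using has_sum_cmult_right[OF durfee_rectangle_int[OF q, of j], of "w j"]
      by (simp add: f_def mult.commute)
  qed
  have "((\<lambda>j. 1 / qpinf q q * ((-1) powi j * q powi (3 * tri (j + 1)) / (1 - x * q powi j))) has_sum (1 / qpinf q q * S)) UNIV"
    by (rule has_sum_cmult_right[OF S])
  also have "(\<lambda>j. 1 / qpinf q q * ((-1) powi j * q powi (3 * tri (j + 1)) / (1 - x * q powi j))) =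
     (\<lambda>j. w j * (q powi (2 * tri (j + 1)) / qpinf q q))"
  proof
    fix j
    have "q powi (3 * tri (j + 1)) = q powi tri (j + 1) * q powi (2 * tri (j + 1))"
      using q power_int_add[of q "tri (j + 1)" "2 * tri (j + 1)"] by simp
    then show "1 / qpinf q q * ((-1) powi j * q powi (3 * tri (j + 1)) / (1 - x * q powi j)) =
     w j * (q powi (2 * tri (j + 1)) / qpinf q q)"
      by (simp add: w_def mult.commute)
  qed
  finally have "infsum f (UNIV \<times> UNIV) = 1 / qpinf q q * S"
    using cols has_sum_unique by blast
  with rows show ?thesis by simp
qed

section \<open>An Appell sum that is a theta quotient\<close>

definition theta :: "complex \<Rightarrow> complex \<Rightarrow> complex"
  where "theta q z = (\<Sum>\<^sub>\<infinity>j. q powi tri j * z powi j)"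

lemma theta_has_sum:
  assumes "q \<noteq> 0" "norm q < 1" "z \<noteq> 0"
  shows "((\<lambda>j. q powi tri j * z powi j) has_sum theta q z) UNIV"
  unfolding theta_def by (rule has_sum_infsum[OF abs_summable_summable[OF abs_summable_theta[OF assms]]])

lemma theta_product:
  assumes "q \<noteq> 0" "norm q < 1" "z \<noteq> 0"
  shows "theta q z = qpinf (- z) q * qpinf (- (q / z)) q * qpinf q q"
  using theta_has_sum[OF assms] jacobi_triple_product[OF assms] by (rule has_sum_unique)

definition theta_alt_coeff :: "complex \<Rightarrow> int \<Rightarrow> complex"
  where "theta_alt_coeff q l = (-1) powi l * q powi (2 * tri l)"

text \<open>The Laurent coefficients of \<open>theta (q\<^sup>2) (- w) / (1 - w)\<close>, see \<open>theta_alt_quot_mult\<close>.\<close>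

definition theta_alt_tail :: "complex \<Rightarrow> int \<Rightarrow> complex"
  where "theta_alt_tail q k = infsum (theta_alt_coeff q) {..k}"

lemma square_lt_1:
  fixes q :: complex
  assumes "q \<noteq> 0" "norm q < 1"
  shows "q\<^sup>2 \<noteq> 0" "norm (q\<^sup>2) < 1"
  using assms power_strict_mono[of "norm q" 1 2] by (simp_all add: norm_power)

lemma square_powi: "(q\<^sup>2) powi k = q powi (2 * k)" for q :: complex
  by (simp add: power_int_mult)

lemma theta_alt_coeff_term: "theta_alt_coeff q k * w powi k = (q\<^sup>2) powi tri k * (- w) powi k"
proof -
  have "(- w) powi k = (-1) powi k * w powi k"
    using power_int_mult_distrib[of "-1" w k] by simp
  then show ?thesis by (simp add: theta_alt_coeff_def square_powi)
qed

lemma theta_alt_coeff_abs_summable: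
  assumes "q \<noteq> 0" "norm q < 1" "w \<noteq> 0"
  shows "(\<lambda>k. theta_alt_coeff q k * w powi k) abs_summable_on UNIV"
  unfolding theta_alt_coeff_term using assms square_lt_1[OF assms(1,2)] by (intro abs_summable_theta) auto

lemma theta_alt_coeff_summable:
  assumes "q \<noteq> 0" "norm q < 1"
  shows "theta_alt_coeff q summable_on A"
proof -
  have "theta_alt_coeff q summable_on UNIV"
    using abs_summable_summable[OF theta_alt_coeff_abs_summable[OF assms, of 1]] by simp
  then show ?thesis by (rule summable_on_subset_banach) simp
qed

lemma theta_alt_coeff_reflect: "theta_alt_coeff q (1 - l) = - theta_alt_coeff q l"
  by (simp add: theta_alt_coeff_def tri_reflect power_int_diff) (simp add: power_int_minus_left)

lemma theta_alt_tail_rec: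
  assumes "q \<noteq> 0" "norm q < 1"
  shows "theta_alt_tail q k = theta_alt_tail q (k - 1) + theta_alt_coeff q k"
proof -
  have "{..k} = insert k {..k - 1}" by auto
  then show ?thesis
    unfolding theta_alt_tail_def using infsum_insert[OF theta_alt_coeff_summable[OF assms], of k "{..k - 1}"] by simp
qed

text \<open>By \<open>theta_alt_coeff_reflect\<close>, the sum over l > k is minus the tail at -k.
  So the tail at k minus the tail at -k is the total sum, whatever k is, and k = 0 shows that this
  total is 0.\<close>

lemma theta_alt_tail_minus:
  assumes "q \<noteq> 0" "norm q < 1"
  shows "theta_alt_tail q (- k) = theta_alt_tail q k"
proof -
  have 1: "(theta_alt_coeff q has_sum theta_alt_tail q k) {..k}" for k
    unfolding theta_alt_tail_def by (rule has_sum_infsum[OF theta_alt_coeff_summable[OF assms]])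
  have 2: "(theta_alt_coeff q has_sum (- theta_alt_tail q (- k))) {k<..}" for k
  proof -
    have "bij_betw (\<lambda>l. 1 - l) {k<..} {.. - k}"
      by (rule bij_betwI[where g = "\<lambda>l. 1 - l"]) auto
    then have "((\<lambda>l. theta_alt_coeff q (1 - l)) has_sum theta_alt_tail q (- k)) {k<..}"
      using 1[of "- k"] by (subst has_sum_reindex_bij_betw)
    then have "((\<lambda>l. - theta_alt_coeff q (1 - l)) has_sum - theta_alt_tail q (- k)) {k<..}"
      by (subst has_sum_uminus) simp
    then show ?thesis by (simp add: theta_alt_coeff_reflect)
  qed
  have "(theta_alt_coeff q has_sum (theta_alt_tail q k + - theta_alt_tail q (- k))) ({..k} \<union> {k<..})" for k
    by (rule has_sum_Un_disjoint[OF 1 2]) auto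
  moreover have "{..k} \<union> {k<..} = UNIV" for k :: int by auto
  ultimately have total: "(theta_alt_coeff q has_sum (theta_alt_tail q k - theta_alt_tail q (- k))) UNIV" for k by simp
  have "theta_alt_tail q k - theta_alt_tail q (- k) = theta_alt_tail q 0 - theta_alt_tail q (- 0)"
    by (rule has_sum_unique[OF total total])
  then show ?thesis by simp
qed

text \<open>A sum over all l \<le> k is visibly small only for k \<le> 0, where a geometric series
  dominates it; the evenness of the tails settles positive k. This decay in both directions makes
  the quotient by 1 - w converge for every nonzero w.\<close>

lemma theta_alt_tail_bound:
  assumes q: "q \<noteq> 0" "norm q < 1"
  obtains C where "C > 0" "\<And>k. norm (theta_alt_tail q k) \<le> C * norm q powi (2 * tri (k + 1))"
proof -
  let ?C = "1 / (1 - norm q)"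
  have bound: "norm (theta_alt_tail q (- int k)) \<le> ?C * norm q ^ (k * (k + 1))" for k
  proof (rule norm_infsum_le)
    have "bij_betw (\<lambda>m. - int k - int m) UNIV {.. - int k}"
      by (rule bij_betwI[where g = "\<lambda>l. nat (- int k - l)"]) auto
    moreover have "(theta_alt_coeff q has_sum theta_alt_tail q (- int k)) {.. - int k}"
      unfolding theta_alt_tail_def by (rule has_sum_infsum[OF theta_alt_coeff_summable[OF q]])
    ultimately show "((\<lambda>m. theta_alt_coeff q (- int k - int m)) has_sum theta_alt_tail q (- int k)) UNIV"
      by (subst has_sum_reindex_bij_betw)
    have "(\<lambda>m. norm q ^ m) sums ?C" using q by (intro geometric_sums) simp
    then have "((\<lambda>m. norm q ^ m) has_sum ?C) UNIV" by (intro sums_nonneg_imp_has_sum) auto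
    then show "((\<lambda>m. norm q ^ m * norm q ^ (k * (k + 1))) has_sum ?C * norm q ^ (k * (k + 1))) UNIV"
      by (rule has_sum_cmult_left)
    fix m
    have "2 * tri (- int k - int m) = int ((k + m) * (k + m + 1))"
      by (simp add: two_tri algebra_simps)
    then have "norm (theta_alt_coeff q (- int k - int m)) = norm q ^ ((k + m) * (k + m + 1))"
      by (simp only: theta_alt_coeff_def norm_mult norm_power_int power_int_of_nat norm_power) simp
    also have "\<dots> \<le> norm q ^ (m + k * (k + 1))"
      using q by (intro power_decreasing) (auto simp: algebra_simps)
    finally show "norm (theta_alt_coeff q (- int k - int m)) \<le> norm q ^ m * norm q ^ (k * (k + 1))"
      by (simp add: power_add)
  qed
  have "norm (theta_alt_tail q k) \<le> ?C * norm q powi (2 * tri (k + 1))" for k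
  proof -
    have "theta_alt_tail q k = theta_alt_tail q (- int (nat \<bar>k\<bar>))"
      using theta_alt_tail_minus[OF q, of k] by (cases "k \<ge> 0") auto
    then have "norm (theta_alt_tail q k) \<le> ?C * norm q ^ (nat \<bar>k\<bar> * (nat \<bar>k\<bar> + 1))"
      using bound[of "nat \<bar>k\<bar>"] by simp
    also have "norm q ^ (nat \<bar>k\<bar> * (nat \<bar>k\<bar> + 1)) \<le> norm q powi (2 * tri (k + 1))"
    proof -
      have "norm q ^ (nat \<bar>k\<bar> * (nat \<bar>k\<bar> + 1)) = norm q powi (\<bar>k\<bar> * (\<bar>k\<bar> + 1))"
        by (subst power_int_of_nat[symmetric]) (simp add: algebra_simps)
      also have "\<dots> \<le> norm q powi (2 * tri (k + 1))"
        using q by (intro power_int_decreasing) (auto simp: two_tri abs_if algebra_simps)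
      finally show ?thesis .
    qed
    finally show ?thesis using q by (simp add: mult_left_mono divide_right_mono)
  qed
  with q show thesis by (intro that[of ?C]) auto
qed

lemma theta_alt_tail_abs_summable:
  assumes q: "q \<noteq> 0" "norm q < 1" and w: "w \<noteq> 0"
  shows "(\<lambda>k. theta_alt_tail q k * w powi k) abs_summable_on UNIV"
    and "(\<lambda>k. of_int k * theta_alt_tail q k) abs_summable_on UNIV"
proof -
  obtain C where C: "C > 0" "\<And>k. norm (theta_alt_tail q k) \<le> C * norm q powi (2 * tri (k + 1))"
    by (rule theta_alt_tail_bound[OF q]) blast
  note q2 = square_lt_1[OF q]
  have shift: "(\<lambda>k. f (k + 1)) summable_on UNIV" if "f summable_on UNIV" for f :: "int \<Rightarrow> real"
    using that unfolding summable_on_def by (blast intro: has_sum_int_shift)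
  have "(\<lambda>k. norm ((q\<^sup>2) powi tri (k + 1) * w powi (k + 1))) summable_on UNIV"
    by (rule shift) (intro abs_summable_theta q2 w)
  then have "(\<lambda>k. C / norm w * norm ((q\<^sup>2) powi tri (k + 1) * w powi (k + 1))) summable_on UNIV"
    by (rule summable_on_cmult_right)
  then show "(\<lambda>k. theta_alt_tail q k * w powi k) abs_summable_on UNIV"
  proof (rule summable_on_comparison_test)
    fix k :: int
    have "norm (theta_alt_tail q k * w powi k) \<le> (C * norm q powi (2 * tri (k + 1))) * norm w powi k"
      unfolding norm_mult norm_power_int by (intro mult_right_mono C) simp
    also have "\<dots> = C / norm w * norm ((q\<^sup>2) powi tri (k + 1) * w powi (k + 1))"
      using w by (simp add: norm_mult norm_power_int square_powi power_int_add)
    finally show "norm (theta_alt_tail q k * w powi k) \<le> C / norm w * norm ((q\<^sup>2) powi tri (k + 1) * w powi (k + 1))" .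
  qed auto
  have "(\<lambda>k. norm (of_int (k + 1) * ((q\<^sup>2) powi tri (k + 1) * 1 powi (k + 1)))) summable_on UNIV"
    by (rule shift) (intro abs_summable_theta_deriv q2, simp)
  moreover have "(\<lambda>k. norm ((q\<^sup>2) powi tri (k + 1) * 1 powi (k + 1))) summable_on UNIV"
    by (rule shift) (intro abs_summable_theta q2, simp)
  ultimately have "(\<lambda>k. C * (norm (of_int (k + 1) * ((q\<^sup>2) powi tri (k + 1) * 1 powi (k + 1))) +
      norm ((q\<^sup>2) powi tri (k + 1) * 1 powi (k + 1)))) summable_on UNIV"
    by (intro summable_on_cmult_right summable_on_add)
  then show "(\<lambda>k. of_int k * theta_alt_tail q k) abs_summable_on UNIV"
  proof (rule summable_on_comparison_test)
    fix k :: int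
    have n: "norm (of_int j :: complex) = \<bar>real_of_int j\<bar>" for j by simp
    have "\<bar>real_of_int k\<bar> * norm (theta_alt_tail q k) \<le> (\<bar>real_of_int (k + 1)\<bar> + 1) * (C * norm q powi (2 * tri (k + 1)))"
      by (intro mult_mono C) auto
    then show "norm (of_int k * theta_alt_tail q k) \<le> C * (norm (of_int (k + 1) * ((q\<^sup>2) powi tri (k + 1) * 1 powi (k + 1))) +
      norm ((q\<^sup>2) powi tri (k + 1) * 1 powi (k + 1)))"
      unfolding norm_mult n norm_power_int square_powi[of q] by (simp add: square_powi[symmetric] norm_power_int norm_power power_int_mult algebra_simps)
  qed auto
qed

text \<open>Defined by its Laurent series rather than by division, so that at w = 1, where the zero
  of the theta function cancels the pole, it has the value of the continued quotient.\<close>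

definition theta_alt_quot :: "complex \<Rightarrow> complex \<Rightarrow> complex"
  where "theta_alt_quot q w = (\<Sum>\<^sub>\<infinity>k. theta_alt_tail q k * w powi k)"

lemma theta_alt_quot_has_sum:
  assumes "q \<noteq> 0" "norm q < 1" "w \<noteq> 0"
  shows "((\<lambda>k. theta_alt_tail q k * w powi k) has_sum theta_alt_quot q w) UNIV"
  unfolding theta_alt_quot_def by (rule has_sum_infsum[OF abs_summable_summable[OF theta_alt_tail_abs_summable(1)[OF assms]]])

lemma theta_alt_coeff_has_sum:
  assumes "q \<noteq> 0" "norm q < 1" "w \<noteq> 0"
  shows "((\<lambda>k. theta_alt_coeff q k * w powi k) has_sum theta (q\<^sup>2) (- w)) UNIV"
  unfolding theta_alt_coeff_term using assms square_lt_1[OF assms(1,2)] by (intro theta_has_sum) auto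

lemma theta_alt_quot_mult:
  assumes "q \<noteq> 0" "norm q < 1" "w \<noteq> 0"
  shows "(1 - w) * theta_alt_quot q w = theta (q\<^sup>2) (- w)"
proof (rule has_sum_unique[OF _ theta_alt_coeff_has_sum[OF assms]])
  have "((\<lambda>k. - w * (theta_alt_tail q (k - 1) * w powi (k - 1))) has_sum (- w * theta_alt_quot q w)) UNIV"
    using has_sum_int_shift[OF theta_alt_quot_has_sum[OF assms], of "-1"] by (intro has_sum_cmult_right) simp
  from has_sum_add[OF theta_alt_quot_has_sum[OF assms] this]
  have "((\<lambda>k. theta_alt_tail q k * w powi k + - w * (theta_alt_tail q (k - 1) * w powi (k - 1))) has_sum ((1 - w) * theta_alt_quot q w)) UNIV"
    by (simp add: algebra_simps)
  moreover have "theta_alt_tail q k * w powi k + - w * (theta_alt_tail q (k - 1) * w powi (k - 1)) = theta_alt_coeff q k * w powi k" for k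
    using assms(3) by (simp add: theta_alt_tail_rec[OF assms(1,2), of k] power_int_diff algebra_simps)
  ultimately show "((\<lambda>k. theta_alt_coeff q k * w powi k) has_sum ((1 - w) * theta_alt_quot q w)) UNIV" by simp
qed

text \<open>Summation by parts: the sum of all tails is minus the sum of k times the k-th theta
  coefficient, to which Jacobi's cube identity applies in base q^2.\<close>

lemma theta_alt_quot_1:
  assumes q: "q \<noteq> 0" "norm q < 1"
  shows "theta_alt_quot q 1 = qpinf (q\<^sup>2) (q\<^sup>2) ^ 3"
proof -
  obtain X where X: "((\<lambda>k. of_int k * theta_alt_tail q k) has_sum X) UNIV"
    using abs_summable_summable[OF theta_alt_tail_abs_summable(2)[OF q, of 1]] by (auto simp: summable_on_def)
  have 1: "((\<lambda>k. theta_alt_tail q k) has_sum theta_alt_quot q 1) UNIV"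
    using theta_alt_quot_has_sum[OF q, of 1] by simp
  have "((\<lambda>k. (of_int k + 1) * theta_alt_tail q k) has_sum (X + theta_alt_quot q 1)) UNIV"
    using has_sum_add[OF X 1] by (simp add: algebra_simps)
  from has_sum_int_shift[OF this, of "-1"]
  have "((\<lambda>k. - (of_int k * theta_alt_tail q (k - 1))) has_sum - (X + theta_alt_quot q 1)) UNIV"
    by (subst has_sum_uminus) (simp add: add.commute)
  from has_sum_add[OF X this]
  have "((\<lambda>k. of_int k * (theta_alt_tail q k - theta_alt_tail q (k - 1))) has_sum (- theta_alt_quot q 1)) UNIV"
    by (simp add: algebra_simps)
  moreover have "of_int k * (theta_alt_tail q k - theta_alt_tail q (k - 1)) = of_int k * ((q\<^sup>2) powi tri k * (-1) powi k)" for k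
    using theta_alt_coeff_term[of q k 1] by (simp add: theta_alt_tail_rec[OF q, of k])
  ultimately have "((\<lambda>k. of_int k * ((q\<^sup>2) powi tri k * (-1) powi k)) has_sum (- theta_alt_quot q 1)) UNIV"
    by simp
  from has_sum_unique[OF this jacobi_cube_int[OF square_lt_1[OF q]]] show ?thesis by simp
qed

lemma theta_quasiperiodic:
  assumes q: "q \<noteq> 0" "norm q < 1" and z: "z \<noteq> 0"
  shows "theta_alt_coeff q n * z powi n * theta (q\<^sup>2) (- (q powi (2 * n) * z)) = theta (q\<^sup>2) (- z)"
proof (rule has_sum_unique)
  have "((\<lambda>k. theta_alt_coeff q k * (q powi (2 * n) * z) powi k) has_sum theta (q\<^sup>2) (- (q powi (2 * n) * z))) UNIV"
    using q z by (intro theta_alt_coeff_has_sum) auto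
  from has_sum_cmult_right[OF this, of "theta_alt_coeff q n * z powi n"]
  show "((\<lambda>k. theta_alt_coeff q n * z powi n * (theta_alt_coeff q k * (q powi (2 * n) * z) powi k)) has_sum
      theta_alt_coeff q n * z powi n * theta (q\<^sup>2) (- (q powi (2 * n) * z))) UNIV" .
  have "theta_alt_coeff q (k + n) * z powi (k + n) = theta_alt_coeff q n * z powi n * (theta_alt_coeff q k * (q powi (2 * n) * z) powi k)" for k
  proof -
    have "2 * tri (k + n) = 2 * tri n + 2 * tri k + 2 * n * k" by (simp add: tri_add)
    then have "q powi (2 * tri (k + n)) = q powi (2 * tri n) * q powi (2 * tri k) * (q powi (2 * n)) powi k"
      using q by (simp only: power_int_add power_int_mult simp_thms)
    then show ?thesis
      using z by (simp add: theta_alt_coeff_def power_int_add power_int_mult_distrib)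
  qed
  with has_sum_int_shift[OF theta_alt_coeff_has_sum[OF q z], of n]
  show "((\<lambda>k. theta_alt_coeff q n * z powi n * (theta_alt_coeff q k * (q powi (2 * n) * z) powi k)) has_sum theta (q\<^sup>2) (- z)) UNIV"
    by simp
qed

text \<open>The tails add up to the coefficient of w^k in (1 + w) times
  \<open>theta_alt_quot q w\<close>. Dividing by q^(k(k-1)/2) leaves the weight c(k) for which the
  expansion of \<open>appell_theta_term\<close> depends on n only through 2n + k.\<close>

definition parity_coeff :: "complex \<Rightarrow> int \<Rightarrow> complex"
  where "parity_coeff q k = (theta_alt_tail q k + theta_alt_tail q (k - 1)) * q powi (- tri k)"

lemma parity_coeff_reflect:
  assumes "q \<noteq> 0" "norm q < 1"
  shows "parity_coeff q (1 - k) = parity_coeff q k"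
  using theta_alt_tail_minus[OF assms, of k] theta_alt_tail_minus[OF assms, of "k - 1"]
  by (simp add: parity_coeff_def tri_reflect)

lemma parity_coeff_abs_summable:
  assumes q: "q \<noteq> 0" "norm q < 1"
  shows "parity_coeff q abs_summable_on UNIV"
proof -
  obtain C where C: "C > 0" "\<And>k. norm (theta_alt_tail q k) \<le> C * norm q powi (2 * tri (k + 1))"
    by (rule theta_alt_tail_bound[OF q]) blast
  \<comment> \<open>The tails decay like q^(k(k+1)), which outweighs the division by q^(k(k-1)/2).
    The other half of \<open>parity_coeff q k\<close> is v(1 - k), since the tails are even.\<close>
  define v where "v k = theta_alt_tail q k * q powi (- tri k)" for k
  have bound: "norm (v k) \<le> C * norm (q powi tri k * (q\<^sup>2) powi k)" for k
  proof -
    have "2 * tri (k + 1) + - tri k = tri k + 2 * k" by (simp add: tri_plus_1)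
    then have e: "norm q powi (2 * tri (k + 1)) * norm q powi (- tri k) = norm q powi tri k * norm q powi (2 * k)"
      using q by (metis norm_eq_zero power_int_add)
    have "norm (v k) \<le> C * norm q powi (2 * tri (k + 1)) * norm q powi (- tri k)"
      unfolding v_def norm_mult norm_power_int by (intro mult_right_mono C) simp
    then show ?thesis by (simp add: e mult.assoc norm_mult norm_power_int square_powi)
  qed
  have v: "v abs_summable_on UNIV"
    by (rule summable_on_comparison_test[of "\<lambda>k. C * norm (q powi tri k * (q\<^sup>2) powi k)"])
      (use bound q in \<open>auto intro!: summable_on_cmult_right abs_summable_theta\<close>)
  have v': "(\<lambda>k. norm (v (1 - k))) summable_on UNIV"
    using v has_sum_int_reflect[of "\<lambda>k. norm (v k)" _ 1] unfolding summable_on_def by blast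
  have "parity_coeff q k = v k + v (1 - k)" for k
    using theta_alt_tail_minus[OF q, of "k - 1"] by (simp add: parity_coeff_def v_def tri_reflect algebra_simps)
  then show ?thesis
    by (intro summable_on_comparison_test[OF summable_on_add[OF v v']]) (auto intro: norm_triangle_ineq)
qed

text \<open>The n-th term of the Appell sum in \<open>appell_theta_quotient\<close> times
  \<open>theta (q\<^sup>2) (- z)\<close>, with the theta function moved to w = q^(2n) z by
  quasi-periodicity. In this form it makes sense also at the pole w = 1.\<close>

definition appell_theta_term :: "complex \<Rightarrow> complex \<Rightarrow> int \<Rightarrow> complex"
  where "appell_theta_term q z n = q powi tri (2 * n) * z powi (2 * n) * (1 + q powi (2 * n) * z) * theta_alt_quot q (q powi (2 * n) * z)"

lemma appell_theta_term_has_sum: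
  assumes q: "q \<noteq> 0" "norm q < 1" and z: "z \<noteq> 0"
  shows "((\<lambda>k. parity_coeff q k * (q powi tri (2 * n + k) * z powi (2 * n + k))) has_sum appell_theta_term q z n) UNIV"
proof -
  define w where "w = q powi (2 * n) * z"
  have w: "w \<noteq> 0" using q z by (simp add: w_def)
  have "((\<lambda>k. w * (theta_alt_tail q (k - 1) * w powi (k - 1))) has_sum (w * theta_alt_quot q w)) UNIV"
    using has_sum_int_shift[OF theta_alt_quot_has_sum[OF q w], of "-1"] by (intro has_sum_cmult_right) simp
  from has_sum_add[OF theta_alt_quot_has_sum[OF q w] this]
  have "((\<lambda>k. theta_alt_tail q k * w powi k + w * (theta_alt_tail q (k - 1) * w powi (k - 1))) has_sum ((1 + w) * theta_alt_quot q w)) UNIV"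
    by (simp add: algebra_simps)
  from has_sum_cmult_right[OF this, of "q powi tri (2 * n) * z powi (2 * n)"]
  have "((\<lambda>k. q powi tri (2 * n) * z powi (2 * n) * (theta_alt_tail q k * w powi k + w * (theta_alt_tail q (k - 1) * w powi (k - 1))))
     has_sum appell_theta_term q z n) UNIV"
    by (simp add: appell_theta_term_def w_def mult_ac)
  moreover have "q powi tri (2 * n) * z powi (2 * n) * (theta_alt_tail q k * w powi k + w * (theta_alt_tail q (k - 1) * w powi (k - 1)))
    = parity_coeff q k * (q powi tri (2 * n + k) * z powi (2 * n + k))" for k
  proof -
    have 1: "theta_alt_tail q k * w powi k + w * (theta_alt_tail q (k - 1) * w powi (k - 1)) = (theta_alt_tail q k + theta_alt_tail q (k - 1)) * w powi k"
      using w by (simp add: power_int_diff algebra_simps)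
    have 2: "q powi tri (2 * n + k) = q powi tri (2 * n) * q powi tri k * (q powi (2 * n)) powi k"
      using q by (simp only: tri_add power_int_add power_int_mult simp_thms)
    have 3: "q powi (- tri k) * q powi tri k = 1" using q by (simp add: power_int_minus)
    have "parity_coeff q k * (q powi tri (2 * n + k) * z powi (2 * n + k)) =
      (theta_alt_tail q k + theta_alt_tail q (k - 1)) * (q powi (- tri k) * q powi tri k) * q powi tri (2 * n) * (q powi (2 * n)) powi k * (z powi (2 * n) * z powi k)"
      using z by (simp add: parity_coeff_def 2 power_int_add)
    then show ?thesis unfolding 1 3 by (simp add: w_def power_int_mult_distrib)
  qed
  ultimately show ?thesis by simp
qed

text \<open>
  The rows below exhaust the pairs of indices of equal parity; by the reflection symmetry of
  \<^const>\<open>parity_coeff\<close> these carry exactly half of the full double sum.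
\<close>

lemma appell_theta_sum:
  assumes q: "q \<noteq> 0" "norm q < 1"
  obtains E where "\<And>z. z \<noteq> 0 \<Longrightarrow> (appell_theta_term q z has_sum (E * theta q z)) UNIV"
proof -
  let ?U = "infsum (parity_coeff q) UNIV"
  have main: "(appell_theta_term q z has_sum (?U / 2 * theta q z)) UNIV" if z: "z \<noteq> 0" for z
  proof -
    define t where "t m = q powi tri m * z powi m" for m
    define f where "f = (\<lambda>(k, m). parity_coeff q k * t m)"
    define P where "P = {(k, m :: int). even (m - k)}"
    define P' where "P' = {(k, m :: int). odd (m - k)}"
    have t: "t abs_summable_on UNIV" and t_sum: "(t has_sum theta q z) UNIV"
      unfolding t_def using abs_summable_theta[OF q z] theta_has_sum[OF q z] by simp_all
    have "f abs_summable_on UNIV \<times> UNIV"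
      unfolding f_def by (rule abs_summable_on_times[OF parity_coeff_abs_summable[OF q] t])
    then have f: "f summable_on UNIV \<times> UNIV" by (rule abs_summable_summable)
    have U: "(parity_coeff q has_sum ?U) UNIV"
      by (rule has_sum_infsum[OF abs_summable_summable[OF parity_coeff_abs_summable[OF q]]])
    have full: "(f has_sum (?U * theta q z)) (UNIV \<times> UNIV)"
    proof (rule has_sum_SigmaI[OF _ _ f])
      show "((\<lambda>m. f (k, m)) has_sum (parity_coeff q k * theta q z)) UNIV" for k
        unfolding f_def using t_sum by (auto intro: has_sum_cmult_right)
      show "((\<lambda>k. parity_coeff q k * theta q z) has_sum (?U * theta q z)) UNIV"
        by (rule has_sum_cmult_left[OF U])
    qed
    have fP: "f summable_on A" for A
      by (rule summable_on_subset_banach[OF f]) auto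
    let ?T = "infsum f P"
    have T: "(f has_sum ?T) P" by (rule has_sum_infsum[OF fP])
    have "bij_betw (\<lambda>(k, m). (1 - k, m)) P' P"
      by (rule bij_betwI[where g = "\<lambda>(k, m). (1 - k, m)"]) (auto simp: P_def P'_def)
    then have "((\<lambda>p. f (case p of (k, m) \<Rightarrow> (1 - k, m))) has_sum ?T) P'"
      using T by (subst has_sum_reindex_bij_betw)
    moreover have "(\<lambda>p. f (case p of (k, m) \<Rightarrow> (1 - k, m))) = f"
      by (auto simp: f_def fun_eq_iff parity_coeff_reflect[OF q])
    ultimately have "(f has_sum ?T) P'" by simp
    with T have "(f has_sum (?T + ?T)) (P \<union> P')"
      by (rule has_sum_Un_disjoint) (auto simp: P_def P'_def)
    moreover have "P \<union> P' = UNIV \<times> UNIV" by (auto simp: P_def P'_def)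
    ultimately have "?T + ?T = ?U * theta q z"
      using full has_sum_unique by metis
    then have T2: "?T = ?U / 2 * theta q z" by (simp add: field_simps)
    have "bij_betw (\<lambda>(n, k). (k, 2 * n + k)) (UNIV \<times> UNIV) P"
      by (rule bij_betwI[where g = "\<lambda>(k, m). ((m - k) div 2, k)"]) (auto simp: P_def)
    then have "((\<lambda>p. f (case p of (n, k) \<Rightarrow> (k, 2 * n + k))) has_sum ?T) (UNIV \<times> UNIV)"
      using T by (subst has_sum_reindex_bij_betw)
    then have "(appell_theta_term q z has_sum ?T) UNIV"
    proof (rule has_sum_SigmaD)
      fix n
      show "((\<lambda>k. f (case (n, k) of (n, k) \<Rightarrow> (k, 2 * n + k))) has_sum appell_theta_term q z n) UNIV"
        using appell_theta_term_has_sum[OF q z, of n] by (simp add: f_def t_def)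
    qed
    then show ?thesis unfolding T2 .
  qed
  then show thesis by (rule that)
qed

lemma theta_minus_power_eq_0:
  assumes q: "q \<noteq> 0" "norm q < 1"
  shows "theta (q\<^sup>2) (- (q powi (2 * n))) = 0"
proof -
  have "theta (q\<^sup>2) (- 1) = 0" using theta_alt_quot_mult[OF q, of 1] by simp
  then have "theta_alt_coeff q n * theta (q\<^sup>2) (- (q powi (2 * n))) = 0"
    using theta_quasiperiodic[OF q, of 1 n] by simp
  moreover have "theta_alt_coeff q n \<noteq> 0" using q by (simp add: theta_alt_coeff_def)
  ultimately show ?thesis by simp
qed

text \<open>The constant is found at z = 1. For n \<noteq> 0 the theta function vanishes at q^(2n)
  while 1 - q^(2n) does not, so the term is 0; the term n = 0 is twice
  \<open>theta_alt_quot q 1\<close>.\<close>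

lemma appell_theta_sum_normalized:
  assumes q: "q \<noteq> 0" "norm q < 1" and z: "z \<noteq> 0"
  obtains S where "(appell_theta_term q z has_sum S) UNIV" "S * theta q 1 = 2 * qpinf (q\<^sup>2) (q\<^sup>2) ^ 3 * theta q z"
proof -
  obtain E where E: "\<And>z. z \<noteq> 0 \<Longrightarrow> (appell_theta_term q z has_sum (E * theta q z)) UNIV"
    by (rule appell_theta_sum[OF q]) blast
  have 0: "appell_theta_term q 1 n = 0" if "n \<noteq> 0" for n
  proof -
    have "q powi (2 * n) \<noteq> 1"
    proof
      assume "q powi (2 * n) = 1"
      then have "norm q powi (2 * n) = 1" by (metis norm_one norm_power_int)
      moreover have "norm q powi (2 * \<bar>n\<bar>) = 1"
        using \<open>norm q powi (2 * n) = 1\<close> by (cases "n \<ge> 0") (auto simp: power_int_minus)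
      ultimately have "norm q ^ (2 * nat \<bar>n\<bar>) = 1"
        by (subst power_int_of_nat[symmetric]) simp
      then show False
        using power_strict_mono[of "norm q" 1 "2 * nat \<bar>n\<bar>"] q that by simp
    qed
    moreover have "(1 - q powi (2 * n)) * theta_alt_quot q (q powi (2 * n)) = 0"
      using theta_alt_quot_mult[OF q, of "q powi (2 * n)"] q by (simp add: theta_minus_power_eq_0[OF q])
    ultimately show ?thesis by (simp add: appell_theta_term_def)
  qed
  have "(appell_theta_term q 1 has_sum (2 * theta_alt_quot q 1)) UNIV"
    by (rule has_sum_finite_neutralI[of "{0}"]) (simp_all add: 0, simp add: appell_theta_term_def)
  then have "E * theta q 1 = 2 * qpinf (q\<^sup>2) (q\<^sup>2) ^ 3"
    using has_sum_unique[OF E[of 1]] by (simp add: theta_alt_quot_1[OF q])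
  then show thesis
    by (intro that[OF E[OF z]]) (simp add: mult_ac)
qed

theorem appell_theta_quotient:
  assumes q: "q \<noteq> 0" "norm q < 1" and z: "z \<noteq> 0" "\<And>n. q powi (2 * n) * z \<noteq> 1"
    and nz: "theta (q\<^sup>2) (- z) \<noteq> 0" "theta q 1 \<noteq> 0"
  shows "((\<lambda>n. (-1) powi n * q powi (n * n) * z powi n * (1 + q powi (2 * n) * z) / (1 - q powi (2 * n) * z)) has_sum
    (2 * qpinf (q\<^sup>2) (q\<^sup>2) ^ 3 * theta q z / (theta q 1 * theta (q\<^sup>2) (- z)))) UNIV"
proof -
  obtain S where S: "(appell_theta_term q z has_sum S) UNIV" "S * theta q 1 = 2 * qpinf (q\<^sup>2) (q\<^sup>2) ^ 3 * theta q z"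
    by (rule appell_theta_sum_normalized[OF q z(1)])
  let ?J = "theta (q\<^sup>2) (- z)"
  have "((\<lambda>n. appell_theta_term q z n * (1 / ?J)) has_sum (S * (1 / ?J))) UNIV"
    by (rule has_sum_cmult_left[OF S(1)])
  moreover have "appell_theta_term q z n * (1 / ?J) =
    (-1) powi n * q powi (n * n) * z powi n * (1 + q powi (2 * n) * z) / (1 - q powi (2 * n) * z)" for n
  proof -
    define w where "w = q powi (2 * n) * z"
    have w: "1 - w \<noteq> 0" "w \<noteq> 0" using z q by (auto simp: w_def)
    have "theta_alt_quot q w = theta (q\<^sup>2) (- w) / (1 - w)"
      using theta_alt_quot_mult[OF q w(2)] w(1) by (simp add: field_simps)
    moreover have "theta (q\<^sup>2) (- w) = ?J / (theta_alt_coeff q n * z powi n)"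
      using theta_quasiperiodic[OF q z(1), of n] q z(1) by (simp add: w_def theta_alt_coeff_def field_simps)
    ultimately have t: "theta_alt_quot q w = ?J / (theta_alt_coeff q n * z powi n) / (1 - w)" by simp
    \<comment> \<open>The exponent of \<open>appell_theta_term\<close> splits into the n^2 of the
      Appell sum and the exponent of the quasi-periodicity factor, which cancels.\<close>
    have "tri (2 * n) = n * n + 2 * tri n"
      using two_tri[of "2 * n"] two_tri[of n] by (simp add: algebra_simps)
    then have e: "q powi tri (2 * n) = q powi (n * n) * q powi (2 * tri n)"
      using q by (simp only: power_int_add simp_thms)
    have e2: "z powi (2 * n) = z powi n * z powi n" 
      using z(1) by (simp add: power_int_add[symmetric])
    have p: "(-1) powi n * (-1) powi n = (1 :: complex)" by (rule power_int_minus_one_mult_self)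
    have p': "1 / (-1) powi n = ((-1) powi n :: complex)"
      using p by (metis mult_zero_left nonzero_eq_divide_eq zero_neq_one)
    have "appell_theta_term q z n * (1 / ?J) = q powi (n * n) * z powi n * (1 + w) * (1 / (-1) powi n) / (1 - w)"
      unfolding appell_theta_term_def w_def[symmetric] t e e2 theta_alt_coeff_def using nz(1) q z(1) w(1)
      by (simp add: field_simps)
    then show ?thesis unfolding p' by (simp add: w_def mult_ac)
  qed
  moreover have "S * (1 / ?J) = 2 * qpinf (q\<^sup>2) (q\<^sup>2) ^ 3 * theta q z / (theta q 1 * ?J)"
    using S(2) nz by (simp add: field_simps)
  ultimately show ?thesis by simp
qed

section \<open>Euler products\<close>

lemma norm_power_lt_1:
  fixes q :: complex
  assumes "norm q < 1" "k > 0"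
  shows "norm (q ^ k) < 1"
  using power_strict_mono[of "norm q" 1 k] assms by (simp add: norm_power)

lemma qpoch_split:
  "qpoch a q (n * k) = (\<Prod>i<k. qpoch (a * q ^ i) (q ^ k) n)"
proof -
  have "qpoch a q (n * k) = (\<Prod>m<n. \<Prod>j\<in>{m * k..<m * k + k}. 1 - a * q ^ j)"
    unfolding qpoch_def by (rule prod.nat_group[symmetric])
  also have "\<dots> = (\<Prod>m<n. \<Prod>i<k. 1 - a * q ^ i * (q ^ k) ^ m)"
  proof (rule prod.cong[OF refl])
    fix m
    have "(\<Prod>j\<in>{m * k..<m * k + k}. 1 - a * q ^ j) = (\<Prod>i\<in>{0..<k}. 1 - a * q ^ (i + m * k))"
      using prod.shift_bounds_nat_ivl[of "\<lambda>j. 1 - a * q ^ j" 0 "m * k" k] by (simp add: add.commute)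
    then show "(\<Prod>j\<in>{m * k..<m * k + k}. 1 - a * q ^ j) = (\<Prod>i<k. 1 - a * q ^ i * (q ^ k) ^ m)"
      by (simp add: power_add power_mult[symmetric] mult_ac atLeast0LessThan)
  qed
  also have "\<dots> = (\<Prod>i<k. \<Prod>m<n. 1 - a * q ^ i * (q ^ k) ^ m)"
    by (rule prod.swap)
  finally show ?thesis by (simp add: qpoch_def)
qed

lemma qpinf_split:
  assumes q: "norm q < 1" and k: "k > 0"
  shows "qpinf a q = (\<Prod>i<k. qpinf (a * q ^ i) (q ^ k))"
proof (rule LIMSEQ_unique)
  have "filterlim (\<lambda>n. n * k) sequentially sequentially"
    using k by (intro filterlim_subseq) (simp add: strict_mono_def)
  from filterlim_compose[OF qpoch_LIMSEQ[OF q] this]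
  show "(\<lambda>n. qpoch a q (n * k)) \<longlonglongrightarrow> qpinf a q" .
  show "(\<lambda>n. qpoch a q (n * k)) \<longlonglongrightarrow> (\<Prod>i<k. qpinf (a * q ^ i) (q ^ k))"
    unfolding qpoch_split by (intro tendsto_prod qpoch_LIMSEQ norm_power_lt_1 q k)
qed

lemma qpinf_split_2:
  assumes "norm q < 1"
  shows "qpinf a q = qpinf a (q ^ 2) * qpinf (a * q) (q ^ 2)"
  using qpinf_split[OF assms, of 2 a] by (simp add: numeral_2_eq_2)

lemma qpinf_split_3:
  assumes "norm q < 1"
  shows "qpinf a q = qpinf a (q ^ 3) * qpinf (a * q) (q ^ 3) * qpinf (a * q ^ 2) (q ^ 3)"
  using qpinf_split[OF assms, of 3 a] by (simp add: numeral_3_eq_3 numeral_2_eq_2)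

lemma qpinf_neg:
  assumes "norm q < 1"
  shows "qpinf a q * qpinf (- a) q = qpinf (a ^ 2) (q ^ 2)"
proof (rule LIMSEQ_unique)
  show "(\<lambda>n. qpoch a q n * qpoch (- a) q n) \<longlonglongrightarrow> qpinf a q * qpinf (- a) q"
    by (intro tendsto_intros qpoch_LIMSEQ assms)
  have "qpoch a q n * qpoch (- a) q n = qpoch (a ^ 2) (q ^ 2) n" for n
    unfolding qpoch_def prod.distrib[symmetric]
    by (intro prod.cong) (auto simp: algebra_simps power2_eq_square power_mult_distrib)
  then show "(\<lambda>n. qpoch a q n * qpoch (- a) q n) \<longlonglongrightarrow> qpinf (a ^ 2) (q ^ 2)"
    using qpoch_LIMSEQ[OF norm_power_lt_1[OF assms], of 2 "a ^ 2"] by simp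
qed

lemma qpinf_rec:
  assumes "norm q < 1"
  shows "qpinf a q = (1 - a) * qpinf (a * q) q"
proof (rule LIMSEQ_unique)
  show "(\<lambda>n. qpoch a q (Suc n)) \<longlonglongrightarrow> qpinf a q"
    by (rule LIMSEQ_Suc[OF qpoch_LIMSEQ[OF assms]])
  show "(\<lambda>n. qpoch a q (Suc n)) \<longlonglongrightarrow> (1 - a) * qpinf (a * q) q"
    unfolding qpoch_rec by (intro tendsto_intros qpoch_LIMSEQ assms)
qed

text \<open>\<open>euler (q ^ k)\<close> is the product J(k).\<close>

definition euler :: "complex \<Rightarrow> complex"
  where "euler q = qpinf q q"

lemma euler_nonzero: "norm q < 1 \<Longrightarrow> euler q \<noteq> 0"
  unfolding euler_def by (rule qpinf_self_nonzero)

lemma euler_power_nonzero: "norm q < 1 \<Longrightarrow> k > 0 \<Longrightarrow> euler (q ^ k) \<noteq> 0"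
  by (rule euler_nonzero[OF norm_power_lt_1])

lemma qpinf_neg_self:
  assumes "norm q < 1"
  shows "qpinf (- q) q = euler (q ^ 2) / euler q"
  using qpinf_neg[OF assms, of q] euler_nonzero[OF assms] by (simp add: euler_def field_simps)

lemma qpinf_odd:
  assumes "norm q < 1"
  shows "qpinf q (q ^ 2) = euler q / euler (q ^ 2)"
  using qpinf_split_2[OF assms, of q] euler_power_nonzero[OF assms, of 2]
  by (simp add: euler_def field_simps power2_eq_square)

text \<open>The odd exponents are split modulo 6; those congruent to 3 form an odd product in q^3
  and are divided out.\<close>

lemma qpinf_1_5:
  assumes q: "norm q < 1"
  shows "qpinf q (q ^ 6) * qpinf (q ^ 5) (q ^ 6) = euler q * euler (q ^ 6) / (euler (q ^ 2) * euler (q ^ 3))"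
proof -
  have "qpinf q (q ^ 2) = qpinf q (q ^ 6) * qpinf (q ^ 3) (q ^ 6) * qpinf (q ^ 5) (q ^ 6)"
    using qpinf_split_3[OF norm_power_lt_1[OF q, of 2], of q] by (simp flip: power_mult power_Suc power_Suc2)
  moreover have "qpinf (q ^ 3) (q ^ 6) = euler (q ^ 3) / euler (q ^ 6)"
    using qpinf_odd[OF norm_power_lt_1[OF q, of 3]] by (simp flip: power_mult)
  ultimately have "euler q / euler (q ^ 2) = qpinf q (q ^ 6) * (euler (q ^ 3) / euler (q ^ 6)) * qpinf (q ^ 5) (q ^ 6)"
    using qpinf_odd[OF q] by simp
  with euler_power_nonzero[OF q] show ?thesis by (simp add: field_simps)
qed

lemma theta_6_1:
  assumes q: "q \<noteq> 0" "norm q < 1"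
  shows "theta (q ^ 6) (- q) = euler q * euler (q ^ 6) ^ 2 / (euler (q ^ 2) * euler (q ^ 3))"
proof -
  have "theta (q ^ 6) (- q) = qpinf q (q ^ 6) * qpinf (q ^ 6 / q) (q ^ 6) * euler (q ^ 6)"
    using theta_product[of "q ^ 6" "- q"] norm_power_lt_1[OF q(2), of 6] q(1) by (simp add: euler_def)
  also have "q ^ 6 / q = q ^ 5" using q(1) by (simp add: field_simps flip: power_Suc)
  finally show ?thesis using qpinf_1_5[OF q(2)] by (simp add: power2_eq_square)
qed

lemma theta_6_5:
  assumes q: "q \<noteq> 0" "norm q < 1"
  shows "theta (q ^ 6) (- (q ^ 5)) = euler q * euler (q ^ 6) ^ 2 / (euler (q ^ 2) * euler (q ^ 3))"
proof -
  have "theta (q ^ 6) (- (q ^ 5)) = qpinf (q ^ 5) (q ^ 6) * qpinf (q ^ 6 / q ^ 5) (q ^ 6) * euler (q ^ 6)"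
    using theta_product[of "q ^ 6" "- (q ^ 5)"] norm_power_lt_1[OF q(2), of 6] q(1) by (simp add: euler_def)
  also have "q ^ 6 / q ^ 5 = q" using q(1) by (simp add: field_simps flip: power_Suc)
  finally show ?thesis using qpinf_1_5[OF q(2)] by (simp add: power2_eq_square mult_ac)
qed

text \<open>The three factors of the triple product are the residue classes modulo 3 of the Euler
  product. As a series this is Euler's pentagonal number theorem.\<close>

lemma theta_3_2:
  assumes q: "q \<noteq> 0" "norm q < 1"
  shows "theta (q ^ 3) (- (q ^ 2)) = euler q"
proof -
  have "theta (q ^ 3) (- (q ^ 2)) = qpinf (q ^ 2) (q ^ 3) * qpinf (q ^ 3 / q ^ 2) (q ^ 3) * qpinf (q ^ 3) (q ^ 3)"
    using theta_product[of "q ^ 3" "- (q ^ 2)"] norm_power_lt_1[OF q(2), of 3] q(1) by simp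
  also have "q ^ 3 / q ^ 2 = q" using q(1) by (simp add: field_simps flip: power_Suc)
  also have "qpinf (q ^ 2) (q ^ 3) * qpinf q (q ^ 3) * qpinf (q ^ 3) (q ^ 3) = euler q"
    using qpinf_split_3[OF q(2), of q] by (simp add: euler_def power2_eq_square power3_eq_cube mult_ac)
  finally show ?thesis .
qed

lemma theta_6_4:
  assumes q: "q \<noteq> 0" "norm q < 1"
  shows "theta (q ^ 6) (- (q ^ 4)) = euler (q ^ 2)"
  using theta_3_2[of "q ^ 2"] q norm_power_lt_1[OF q(2), of 2] by (simp flip: power_mult)

lemma theta_3_1:
  assumes q: "q \<noteq> 0" "norm q < 1"
  shows "theta (q ^ 3) q = euler (q ^ 2) * euler (q ^ 3) ^ 2 / (euler q * euler (q ^ 6))"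
proof -
  have "theta (q ^ 3) q = qpinf (- q) (q ^ 3) * qpinf (- (q ^ 3 / q)) (q ^ 3) * euler (q ^ 3)"
    using theta_product[of "q ^ 3" q] norm_power_lt_1[OF q(2), of 3] q(1) by (simp add: euler_def)
  also have "q ^ 3 / q = q ^ 2" using q(1) by (simp add: field_simps flip: power_Suc)
  finally have 1: "theta (q ^ 3) q = qpinf (- q) (q ^ 3) * qpinf (- (q ^ 2)) (q ^ 3) * euler (q ^ 3)" .
  have "qpinf (- q) q = qpinf (- q) (q ^ 3) * qpinf (- (q ^ 2)) (q ^ 3) * qpinf (- (q ^ 3)) (q ^ 3)"
    using qpinf_split_3[OF q(2), of "- q"] by (simp add: power2_eq_square power3_eq_cube mult.assoc)
  moreover have "qpinf (- (q ^ 3)) (q ^ 3) = euler (q ^ 6) / euler (q ^ 3)"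
    using qpinf_neg_self[OF norm_power_lt_1[OF q(2), of 3]] by (simp flip: power_mult)
  ultimately have "euler (q ^ 2) / euler q = qpinf (- q) (q ^ 3) * qpinf (- (q ^ 2)) (q ^ 3) * (euler (q ^ 6) / euler (q ^ 3))"
    using qpinf_neg_self[OF q(2)] by simp
  then have 2: "qpinf (- q) (q ^ 3) * qpinf (- (q ^ 2)) (q ^ 3) = euler (q ^ 2) * euler (q ^ 3) / (euler q * euler (q ^ 6))"
    using euler_power_nonzero[OF q(2)] euler_nonzero[OF q(2)] by (simp add: field_simps)
  show ?thesis unfolding 1 2 by (simp add: power2_eq_square)
qed

lemma theta_1:
  assumes q: "q \<noteq> 0" "norm q < 1"
  shows "theta q 1 = 2 * euler (q ^ 2) ^ 2 / euler q"
proof -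
  have "theta q 1 = qpinf (- 1) q * qpinf (- q) q * euler q"
    using theta_product[OF q, of 1] by (simp add: euler_def)
  also have "qpinf (- 1) q = 2 * qpinf (- q) q"
    using qpinf_rec[OF q(2), of "- 1"] by simp
  finally show ?thesis
    unfolding qpinf_neg_self[OF q(2)] using euler_nonzero[OF q(2)] by (simp add: power2_eq_square field_simps)
qed

lemma theta_2_1:
  assumes q: "q \<noteq> 0" "norm q < 1"
  shows "theta (q ^ 2) (- q) = euler q ^ 2 / euler (q ^ 2)"
proof -
  have "theta (q ^ 2) (- q) = qpinf q (q ^ 2) * qpinf (q ^ 2 / q) (q ^ 2) * euler (q ^ 2)"
    using theta_product[of "q ^ 2" "- q"] norm_power_lt_1[OF q(2), of 2] q(1) by (simp add: euler_def)
  also have "q ^ 2 / q = q" using q(1) by (simp add: power2_eq_square)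
  finally show ?thesis
    unfolding qpinf_odd[OF q(2)] using euler_power_nonzero[OF q(2), of 2] by (simp add: power2_eq_square field_simps)
qed

section \<open>The Appell sum at base q^3 and z = q\<close>

lemma powi_neq_1:
  fixes q :: complex
  assumes q: "q \<noteq> 0" "norm q < 1" and n: "n \<noteq> 0"
  shows "q powi n \<noteq> 1"
proof (cases "n > 0")
  case True
  then show ?thesis using power_neq_1[OF q(2), of "nat n"] by (simp add: power_int_def)
next
  case False
  then have "q ^ nat (- n) \<noteq> 1" using n by (intro power_neq_1 q) auto
  then show ?thesis using False n by (simp add: power_int_def power_inverse)
qed

text \<open>\<open>appell_theta_quotient\<close> with q^3 for q and z = q, where every theta value
  is a quotient of Euler products. The exponent 3n^2 + n is rewritten as 6 tri(n) + 4n to match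
  \<open>lambert_part\<close>.\<close>

lemma level_6_lambert_sum:
  assumes q: "q \<noteq> 0" "norm q < 1"
  shows "((\<lambda>n. (q ^ 6) powi tri n * (- (q ^ 4)) powi n * (1 + q powi (6 * n + 1)) / (1 - q powi (6 * n + 1))) has_sum
    (euler (q ^ 2) ^ 2 * euler (q ^ 3) ^ 4 / (euler q ^ 2 * euler (q ^ 6) ^ 2))) UNIV"
proof -
  note nz = euler_power_nonzero[OF q(2)] euler_nonzero[OF q(2)]
  have q3: "q ^ 3 \<noteq> 0" "norm (q ^ 3) < 1" using q norm_power_lt_1[OF q(2), of 3] by simp_all
  have e: "(q ^ 3) powi (2 * n) * q = q powi (6 * n + 1)" for n
    using q by (simp add: power_int_add power_int_power)
  have t1: "theta ((q ^ 3)\<^sup>2) (- q) = euler q * euler (q ^ 6) ^ 2 / (euler (q ^ 2) * euler (q ^ 3))"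
    using theta_6_1[OF q] by (simp flip: power_mult)
  have t2: "theta (q ^ 3) 1 = 2 * euler (q ^ 6) ^ 2 / euler (q ^ 3)"
    using theta_1[OF q3] by (simp flip: power_mult)
  have ev: "qpinf ((q ^ 3)\<^sup>2) ((q ^ 3)\<^sup>2) = euler (q ^ 6)"
    by (simp add: euler_def flip: power_mult)
  have "((\<lambda>n. (-1) powi n * (q ^ 3) powi (n * n) * q powi n * (1 + (q ^ 3) powi (2 * n) * q) / (1 - (q ^ 3) powi (2 * n) * q)) has_sum
    (2 * qpinf ((q ^ 3)\<^sup>2) ((q ^ 3)\<^sup>2) ^ 3 * theta (q ^ 3) q / (theta (q ^ 3) 1 * theta ((q ^ 3)\<^sup>2) (- q)))) UNIV"
  proof (rule appell_theta_quotient[OF q3 q(1)])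
    show "(q ^ 3) powi (2 * n) * q \<noteq> 1" for n
      unfolding e by (rule powi_neq_1[OF q]) presburger
    show "theta ((q ^ 3)\<^sup>2) (- q) \<noteq> 0" "theta (q ^ 3) 1 \<noteq> 0"
      unfolding t1 t2 using nz by simp_all
  qed
  moreover have "2 * qpinf ((q ^ 3)\<^sup>2) ((q ^ 3)\<^sup>2) ^ 3 * theta (q ^ 3) q / (theta (q ^ 3) 1 * theta ((q ^ 3)\<^sup>2) (- q))
     = euler (q ^ 2) ^ 2 * euler (q ^ 3) ^ 4 / (euler q ^ 2 * euler (q ^ 6) ^ 2)"
    unfolding ev t1 t2 theta_3_1[OF q] using nz by (simp add: field_simps eval_nat_numeral)
  moreover have "(-1) powi n * (q ^ 3) powi (n * n) * q powi n = (q ^ 6) powi tri n * (- (q ^ 4)) powi n" for n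
  proof -
    have "(- (q ^ 4)) powi n = (-1) powi n * (q ^ 4) powi n"
      using power_int_mult_distrib[of "-1" "q ^ 4" n] by simp
    moreover have "(q ^ 3) powi (n * n) * q powi n = (q ^ 6) powi tri n * (q ^ 4) powi n"
    proof -
      have "3 * (n * n) + n = 6 * tri n + 4 * n" using two_tri[of n] by (simp add: algebra_simps)
      then have "q powi (3 * (n * n)) * q powi n = q powi (6 * tri n) * q powi (4 * n)"
        using q(1) by (metis power_int_add)
      then show ?thesis by (simp add: power_int_power)
    qed
    ultimately show ?thesis by (simp add: mult_ac)
  qed
  ultimately show ?thesis unfolding e by simp
qed

section \<open>Three-dissections\<close>

definition omega :: complex
  where "omega = Complex (- 1 / 2) (sqrt 3 / 2)"

lemma omega_square: "omega ^ 2 = - 1 - omega"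
  by (simp add: omega_def power2_eq_square complex_eq_iff)

lemma omega_cube: "omega ^ 3 = 1"
proof -
  have "omega ^ 3 = omega * (- 1 - omega)"
    unfolding omega_square[symmetric] by (simp add: eval_nat_numeral)
  also have "\<dots> = - omega - omega ^ 2" by (simp add: algebra_simps power2_eq_square)
  also have "\<dots> = 1" by (simp add: omega_square)
  finally show ?thesis .
qed

lemma omega_power_6: "omega ^ 6 = 1"
  using power_mult[of omega 3 2] omega_cube by simp

lemma norm_omega: "norm omega = 1"
  by (simp add: omega_def cmod_def power2_eq_square)

lemma omega_nonzero: "omega \<noteq> 0"
  using norm_omega by auto

text \<open>Inversion of the discrete Fourier transform of order 3: as 1 + omega + omega^2 = 0, a
  suitably weighted sum of the equations isolates each unknown.\<close>

lemma omega_linear_system: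
  assumes q: "q \<noteq> 0"
    and 0: "a + q * b + q ^ 2 * c = 0"
    and 1: "a + (omega * q) * b + (omega * q) ^ 2 * c = 0"
    and 2: "a + (omega ^ 2 * q) * b + (omega ^ 2 * q) ^ 2 * c = 0"
  shows "a = 0" "b = 0" "c = 0"
proof -
  have w: "1 + omega + omega ^ 2 = 0" using omega_square by simp
  have w3: "omega ^ 3 = 1" by (rule omega_cube)
  have "3 * a = 0" using 0 1 2 w w3 by algebra
  then show a: "a = 0" by simp
  have "3 * (q * b) = 0" using 0 1 2 w w3 by algebra
  with q show b: "b = 0" by simp
  show "c = 0" using 0 q by (simp add: a b)
qed

lemma complex_cube_root:
  obtains q :: complex where "q ^ 3 = Q"
proof -
  have "rcis (root 3 (norm Q)) (Arg Q / 3) ^ 3 = Q"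
    by (simp add: DeMoivre2 rcis_cmod_Arg odd_real_root_pow)
  then show thesis by (rule that)
qed

lemma norm_less_1_of_cube:
  fixes q :: complex
  assumes "norm (q ^ 3) < 1"
  shows "norm q < 1"
proof (rule ccontr)
  assume "\<not> norm q < 1"
  then have "1 \<le> norm q ^ 3" by (intro one_le_power) simp
  with assms show False by (simp add: norm_power)
qed

lemma has_sum_nat_mod_3:
  fixes f :: "nat \<Rightarrow> 'a :: topological_comm_monoid_add"
  assumes "((\<lambda>k. f (3 * k)) has_sum a) UNIV" "((\<lambda>k. f (3 * k + 1)) has_sum b) UNIV"
    "((\<lambda>k. f (3 * k + 2)) has_sum c) UNIV"
  shows "(f has_sum (a + b + c)) UNIV"
proof -
  have r: "(f has_sum s) ((\<lambda>k. 3 * k + i) ` UNIV)" if "((\<lambda>k. f (3 * k + i)) has_sum s) UNIV" for i s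
    using that by (subst has_sum_reindex) (auto simp: inj_on_def o_def)
  have "(f has_sum (a + b + c)) (((\<lambda>k. 3 * k + 0) ` UNIV \<union> (\<lambda>k. 3 * k + 1) ` UNIV) \<union> (\<lambda>k. 3 * k + 2) ` UNIV)"
    by (intro has_sum_Un_disjoint r) (use assms in \<open>auto; presburger\<close>)+
  moreover have "((\<lambda>k. 3 * k + 0) ` UNIV \<union> (\<lambda>k. 3 * k + 1) ` UNIV) \<union> (\<lambda>k. 3 * k + 2) ` UNIV = (UNIV :: nat set)"
  proof -
    have "n \<in> ((\<lambda>k. 3 * k + 0) ` UNIV \<union> (\<lambda>k. 3 * k + 1) ` UNIV) \<union> (\<lambda>k. 3 * k + 2) ` UNIV" for n :: nat
    proof -
      have "n = 3 * (n div 3) + 0 \<or> n = 3 * (n div 3) + 1 \<or> n = 3 * (n div 3) + 2" by presburger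
      then show ?thesis by blast
    qed
    then show ?thesis by blast
  qed
  ultimately show ?thesis by simp
qed

lemma has_sum_int_mod_3:
  fixes f :: "int \<Rightarrow> 'a :: topological_comm_monoid_add"
  assumes "((\<lambda>k. f (3 * k)) has_sum a) UNIV" "((\<lambda>k. f (3 * k + 1)) has_sum b) UNIV"
    "((\<lambda>k. f (3 * k + 2)) has_sum c) UNIV"
  shows "(f has_sum (a + b + c)) UNIV"
proof -
  have r: "(f has_sum s) ((\<lambda>k. 3 * k + i) ` UNIV)" if "((\<lambda>k. f (3 * k + i)) has_sum s) UNIV" for i s
    using that by (subst has_sum_reindex) (auto simp: inj_on_def o_def)
  have "(f has_sum (a + b + c)) (((\<lambda>k. 3 * k + 0) ` UNIV \<union> (\<lambda>k. 3 * k + 1) ` UNIV) \<union> (\<lambda>k. 3 * k + 2) ` UNIV)"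
    by (intro has_sum_Un_disjoint r) (use assms in \<open>auto; presburger\<close>)+
  moreover have "((\<lambda>k. 3 * k + 0) ` UNIV \<union> (\<lambda>k. 3 * k + 1) ` UNIV) \<union> (\<lambda>k. 3 * k + 2) ` UNIV = (UNIV :: int set)"
  proof -
    have "n \<in> ((\<lambda>k. 3 * k + 0) ` UNIV \<union> (\<lambda>k. 3 * k + 1) ` UNIV) \<union> (\<lambda>k. 3 * k + 2) ` UNIV" for n :: int
    proof -
      have "n = 3 * (n div 3) + 0 \<or> n = 3 * (n div 3) + 1 \<or> n = 3 * (n div 3) + 2" by presburger
      then show ?thesis by blast
    qed
    then show ?thesis by blast
  qed
  ultimately show ?thesis by simp
qed

text \<open>The three cube roots of Q share the values F Q, G Q, H Q and also the sums N 0, N 1, N 2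
  of the series over the residue classes. The differences solve a homogeneous linear system with
  only the zero solution.\<close>

lemma three_dissection:
  fixes c :: "nat \<Rightarrow> complex"
  assumes hs: "\<And>q. q \<noteq> 0 \<Longrightarrow> norm q < 1 \<Longrightarrow>
      ((\<lambda>k. c k * q ^ k) has_sum (F (q ^ 3) + q * G (q ^ 3) + q ^ 2 * H (q ^ 3))) UNIV"
    and Q: "Q \<noteq> 0" "norm Q < 1"
  shows "((\<lambda>k. c (3 * k) * Q ^ k) has_sum F Q) UNIV"
    and "((\<lambda>k. c (3 * k + 2) * Q ^ k) has_sum H Q) UNIV"
proof -
  obtain q where q3: "q ^ 3 = Q" by (rule complex_cube_root)
  have q: "q \<noteq> 0" using Q(1) q3 by auto
  have nq: "norm q < 1" using Q(2) q3 norm_less_1_of_cube[of q] by simp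
  have pw: "x ^ (3 * k + i) = x ^ i * Q ^ k" if "x ^ 3 = Q" for x k i
    unfolding power_add power_mult that by (rule mult.commute)
  have summable: "(\<lambda>k. c (3 * k + i) * Q ^ k) summable_on UNIV" for i
  proof -
    have "(\<lambda>k. c k * q ^ k) summable_on range (\<lambda>k. 3 * k + i)"
      by (rule summable_on_subset_banach[OF has_sum_imp_summable[OF hs[OF q nq]]]) simp
    then have "(\<lambda>k. c (3 * k + i) * q ^ (3 * k + i)) summable_on UNIV"
      by (subst (asm) summable_on_reindex) (auto simp: inj_on_def o_def)
    also have "(\<lambda>k. c (3 * k + i) * q ^ (3 * k + i)) = (\<lambda>k. q ^ i * (c (3 * k + i) * Q ^ k))"
      unfolding pw[OF q3] by (simp add: mult_ac)
    finally have "(\<lambda>k. (1 / q ^ i) * (q ^ i * (c (3 * k + i) * Q ^ k))) summable_on UNIV"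
      by (rule summable_on_cmult_right)
    then show ?thesis using q by simp
  qed
  define N where "N i = (\<Sum>\<^sub>\<infinity>k. c (3 * k + i) * Q ^ k)" for i
  have N: "((\<lambda>k. c (3 * k + i) * Q ^ k) has_sum N i) UNIV" for i
    unfolding N_def by (rule has_sum_infsum[OF summable])
  have eq: "(N 0 - F Q) + x * (N 1 - G Q) + x ^ 2 * (N 2 - H Q) = 0" if x: "x ^ 3 = Q" "x \<noteq> 0" for x
  proof -
    have nx: "norm x < 1" using Q(2) x norm_less_1_of_cube[of x] by simp
    have part: "((\<lambda>k. c (3 * k + i) * x ^ (3 * k + i)) has_sum (x ^ i * N i)) UNIV" for i
      using has_sum_cmult_right[OF N[of i], of "x ^ i"] unfolding pw[OF x(1)] by (simp add: mult_ac)
    have "((\<lambda>k. c k * x ^ k) has_sum (N 0 + x * N 1 + x ^ 2 * N 2)) UNIV"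
      using part[of 0] part[of 1] part[of 2] by (intro has_sum_nat_mod_3) simp_all
    from has_sum_unique[OF this hs[OF x(2) nx]] show ?thesis
      by (simp add: x algebra_simps)
  qed
  have "(omega * q) ^ 3 = Q" "(omega ^ 2 * q) ^ 3 = Q"
    by (simp_all add: power_mult_distrib omega_cube omega_power_6 q3 flip: power_mult)
  with omega_linear_system[OF q eq[OF q3 q] eq[of "omega * q"] eq[of "omega ^ 2 * q"]] q omega_nonzero
  have "N 0 = F Q" "N 2 = H Q" by simp_all
  with N[of 0] N[of 2] show "((\<lambda>k. c (3 * k) * Q ^ k) has_sum F Q) UNIV"
    "((\<lambda>k. c (3 * k + 2) * Q ^ k) has_sum H Q) UNIV" by simp_all
qed

text \<open>The common shape of three Appell sums in Q = q^3. With x = q^(6j+1), the values -1,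
  -(Q^2) and -(Q^4) of w belong to the numerators 1, x and x^2 over 1 - x^3.\<close>

definition lambert_part :: "complex \<Rightarrow> complex \<Rightarrow> complex"
  where "lambert_part Q w = (\<Sum>\<^sub>\<infinity>j. (Q ^ 6) powi tri (j + 1) * w powi j / (1 - Q * (Q ^ 6) powi j))"

lemma mult_powi_6_neq_1:
  fixes q :: complex
  assumes q: "q \<noteq> 0" "norm q < 1"
  shows "q * (q ^ 6) powi j \<noteq> 1"
proof -
  have "q * (q ^ 6) powi j = q powi (6 * j + 1)"
    using q by (simp add: power_int_add power_int_power)
  also have "\<dots> \<noteq> 1" by (rule powi_neq_1[OF q]) presburger
  finally show ?thesis .
qed

lemma lambert_part_has_sum:
  assumes q: "q \<noteq> 0" "norm q < 1" and w: "w \<noteq> 0"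
  shows "((\<lambda>j. (q ^ 6) powi tri (j + 1) * w powi j / (1 - q * (q ^ 6) powi j)) has_sum lambert_part q w) UNIV"
proof -
  have q6: "q ^ 6 \<noteq> 0" "norm (q ^ 6) < 1" using q norm_power_lt_1[OF q(2), of 6] by auto
  show ?thesis unfolding lambert_part_def
    by (rule has_sum_infsum[OF abs_summable_summable[OF pole_series_abs_summable[OF q6 q(1) mult_powi_6_neq_1[OF q] q6 w]]])
qed

text \<open>With this function, \<open>\<xi>(q) = 1 + 2 q g\<^sub>3(q, q^6)\<close>.\<close>

definition xi_g3 :: "complex \<Rightarrow> complex"
  where "xi_g3 q = (\<Sum>\<^sub>\<infinity>n. (q ^ 6) ^ (n * (n + 1)) / (qpoch q (q ^ 6) (Suc n) * qpoch (q ^ 5) (q ^ 6) (Suc n)))"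

text \<open>The quadratic exponents 18 tri(j+1) and the denominators 1 - x^3 involve only q^3. The
  residue modulo 3 thus comes from q times a numerator 1, x or x^2 with x = q^(6j+1), that is from
  q, q^2 or q^3.\<close>

lemma xi_g3_dissection:
  assumes q: "q \<noteq> 0" "norm q < 1"
  shows "q * xi_g3 q * euler ((q ^ 3) ^ 2) = 
    q ^ 3 * lambert_part (q ^ 3) (- ((q ^ 3) ^ 4)) + q * lambert_part (q ^ 3) (- 1) + q ^ 2 * lambert_part (q ^ 3) (- ((q ^ 3) ^ 2))"
proof -
  define Q where "Q = q ^ 3"
  have Q: "Q \<noteq> 0" "norm Q < 1" using q norm_power_lt_1[OF q(2), of 3] by (auto simp: Q_def)
  have q6: "q ^ 6 \<noteq> 0" "norm (q ^ 6) < 1" using q norm_power_lt_1[OF q(2), of 6] by auto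
  define T where "T = Q * lambert_part Q (- (Q ^ 4)) + q * lambert_part Q (- 1) + q ^ 2 * lambert_part Q (- (Q ^ 2))"
  have 1: "((\<lambda>j. Q * ((Q ^ 6) powi tri (j + 1) * (- (Q ^ 4)) powi j / (1 - Q * (Q ^ 6) powi j))) has_sum (Q * lambert_part Q (- (Q ^ 4)))) UNIV"
    using Q by (intro has_sum_cmult_right lambert_part_has_sum) auto
  have 2: "((\<lambda>j. q * ((Q ^ 6) powi tri (j + 1) * (- 1) powi j / (1 - Q * (Q ^ 6) powi j))) has_sum (q * lambert_part Q (- 1))) UNIV"
    using Q by (intro has_sum_cmult_right lambert_part_has_sum) auto
  have 3: "((\<lambda>j. q ^ 2 * ((Q ^ 6) powi tri (j + 1) * (- (Q ^ 2)) powi j / (1 - Q * (Q ^ 6) powi j))) has_sum (q ^ 2 * lambert_part Q (- (Q ^ 2)))) UNIV"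
    using Q by (intro has_sum_cmult_right lambert_part_has_sum) auto
  have "Q * ((Q ^ 6) powi tri (j + 1) * (- (Q ^ 4)) powi j / (1 - Q * (Q ^ 6) powi j))
     + q * ((Q ^ 6) powi tri (j + 1) * (- 1) powi j / (1 - Q * (Q ^ 6) powi j))
     + q ^ 2 * ((Q ^ 6) powi tri (j + 1) * (- (Q ^ 2)) powi j / (1 - Q * (Q ^ 6) powi j))
    = q * ((-1) powi j * (q ^ 6) powi (3 * tri (j + 1)) / (1 - q * (q ^ 6) powi j))" for j
  proof -
    define B x C where "B = (q ^ 6) powi j" and "x = q * B" and "C = (-1) powi j * (Q ^ 6) powi tri (j + 1)"
    have e: "(Q ^ 6) powi j = B ^ 3" "(q ^ 6) powi (3 * tri (j + 1)) = (Q ^ 6) powi tri (j + 1)"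
      by (simp_all add: B_def Q_def power_int_power power_int_power' mult_ac flip: power_mult)
    have m: "(- a) powi j = (-1) powi j * a powi j" for a :: complex
      using power_int_mult_distrib[of "-1" a j] by simp
    have e2: "(Q ^ 4) powi j = B ^ 2" "(Q ^ 2) powi j = B"
      by (simp_all add: B_def Q_def power_int_power power_int_power' mult_ac flip: power_mult)
    have x: "1 - x \<noteq> 0" "1 - x ^ 3 \<noteq> 0"
      using mult_powi_6_neq_1[OF q, of j] mult_powi_6_neq_1[OF Q, of j] 
      by (auto simp: x_def B_def[symmetric] e power_mult_distrib Q_def[symmetric])
    have x3: "Q * B ^ 3 = x ^ 3" by (simp add: x_def Q_def power_mult_distrib)
    have "1 / (1 - x) = (1 + x + x ^ 2) / (1 - x ^ 3)"
      using x by (simp add: divide_simps) (simp add: algebra_simps eval_nat_numeral)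
    then have r: "q * (C / (1 - x)) = q * (C * ((1 + x + x ^ 2) / (1 - x ^ 3)))"
      by (metis divide_inverse inverse_eq_divide)
    have "q * ((-1) powi j * (q ^ 6) powi (3 * tri (j + 1)) / (1 - q * (q ^ 6) powi j)) = q * (C / (1 - x))"
      by (simp add: e C_def x_def B_def)
    also have "\<dots> = Q * ((Q ^ 6) powi tri (j + 1) * (- (Q ^ 4)) powi j / (1 - Q * (Q ^ 6) powi j))
     + q * ((Q ^ 6) powi tri (j + 1) * (- 1) powi j / (1 - Q * (Q ^ 6) powi j))
     + q ^ 2 * ((Q ^ 6) powi tri (j + 1) * (- (Q ^ 2)) powi j / (1 - Q * (Q ^ 6) powi j))"
    proof -
      have "q * (s * T * ((1 + x + x ^ 2) / D)) = Q * (T * (s * B ^ 2) / D) + q * (T * s / D) + q ^ 2 * (T * (s * B) / D)" for s T D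
        by (simp add: divide_inverse x_def Q_def algebra_simps eval_nat_numeral)
      then show ?thesis
        unfolding r unfolding m[of "Q ^ 4"] m[of "Q ^ 2"] e(1) e2 x3 C_def by blast
    qed
    finally show ?thesis by simp
  qed
  with has_sum_add[OF has_sum_add[OF 1 2] 3]
  have "((\<lambda>j. q * ((-1) powi j * (q ^ 6) powi (3 * tri (j + 1)) / (1 - q * (q ^ 6) powi j))) has_sum T) UNIV"
    by (simp add: T_def)
  then have "((\<lambda>j. (-1) powi j * (q ^ 6) powi (3 * tri (j + 1)) / (1 - q * (q ^ 6) powi j)) has_sum (T / q)) UNIV"
    using q by (subst (asm) has_sum_cmult_right_iff) auto
  from universal_mock_theta_appell[OF q6 q(1) mult_powi_6_neq_1[OF q] this]
  have "((\<lambda>n. (q ^ 6) ^ (n * (n + 1)) / (qpoch q (q ^ 6) (Suc n) * qpoch (q ^ 5) (q ^ 6) (Suc n))) has_sum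
     (T / q / euler (q ^ 6))) UNIV"
  proof -
    have "q ^ 6 / q = q ^ 5" using q(1) by (simp add: field_simps flip: power_Suc)
    then show "((\<lambda>n. (q ^ 6) ^ (n * (n + 1)) / (qpoch q (q ^ 6) (Suc n) * qpoch (q ^ 6 / q) (q ^ 6) (Suc n))) has_sum
       (T / q / qpinf (q ^ 6) (q ^ 6))) UNIV \<Longrightarrow> ?thesis"
      by (simp add: euler_def)
  qed
  then have "xi_g3 q = T / q / euler (q ^ 6)"
    unfolding xi_g3_def by (rule infsumI)
  moreover have "euler (q ^ 6) \<noteq> 0" by (rule euler_nonzero[OF q6(2)])
  moreover have "(q ^ 3) ^ 2 = q ^ 6" by (simp flip: power_mult)
  ultimately show ?thesis using q(1) by (simp add: T_def Q_def field_simps)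
qed

text \<open>By (1 + w)/(1 - w) = 1 + 2 w/(1 - w), the sum of level 6 splits into a theta series
  equal to J(2) and twice the Appell sum. After division by J(2), the first part is the summand 1 in
  the definition of xi.\<close>

lemma lambert_part_closed_form:
  assumes q: "q \<noteq> 0" "norm q < 1"
  shows "euler (q ^ 2) + 2 * (q * lambert_part q (- (q ^ 4))) = euler (q ^ 2) ^ 2 * euler (q ^ 3) ^ 4 / (euler q ^ 2 * euler (q ^ 6) ^ 2)"
proof (rule has_sum_unique[OF _ level_6_lambert_sum[OF q]])
  have q6: "q ^ 6 \<noteq> 0" "norm (q ^ 6) < 1" using q norm_power_lt_1[OF q(2), of 6] by auto
  have 1: "((\<lambda>n. (q ^ 6) powi tri n * (- (q ^ 4)) powi n) has_sum euler (q ^ 2)) UNIV"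
    unfolding theta_6_4[OF q, symmetric] using q by (intro theta_has_sum q6) simp
  have 2: "((\<lambda>n. 2 * (q * ((q ^ 6) powi tri (n + 1) * (- (q ^ 4)) powi n / (1 - q * (q ^ 6) powi n)))) has_sum
     (2 * (q * lambert_part q (- (q ^ 4))))) UNIV"
    using q by (intro has_sum_cmult_right lambert_part_has_sum) auto
  have "(q ^ 6) powi tri n * (- (q ^ 4)) powi n + 2 * (q * ((q ^ 6) powi tri (n + 1) * (- (q ^ 4)) powi n / (1 - q * (q ^ 6) powi n)))
    = (q ^ 6) powi tri n * (- (q ^ 4)) powi n * (1 + q powi (6 * n + 1)) / (1 - q powi (6 * n + 1))" for n
  proof -
    define w where "w = q * (q ^ 6) powi n"
    have w: "q powi (6 * n + 1) = w" "1 - w \<noteq> 0"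
      using q mult_powi_6_neq_1[OF q, of n] by (auto simp: w_def power_int_add power_int_power)
    have "q * (q ^ 6) powi tri (n + 1) = (q ^ 6) powi tri n * w"
      using q by (simp add: tri_plus_1 power_int_add w_def)
    then have "q * ((q ^ 6) powi tri (n + 1) * (- (q ^ 4)) powi n / (1 - w)) = (q ^ 6) powi tri n * (- (q ^ 4)) powi n * w / (1 - w)"
      by simp
    then show ?thesis unfolding w(1) w_def[symmetric] using w(2) by (simp add: field_simps)
  qed
  with has_sum_add[OF 1 2]
  show "((\<lambda>n. (q ^ 6) powi tri n * (- (q ^ 4)) powi n * (1 + q powi (6 * n + 1)) / (1 - q powi (6 * n + 1))) has_sum
    (euler (q ^ 2) + 2 * (q * lambert_part q (- (q ^ 4))))) UNIV" by simp
qed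

lemma xi_multiples_of_3:
  assumes c: "\<And>q. q \<noteq> 0 \<Longrightarrow> norm q < 1 \<Longrightarrow> ((\<lambda>k. c k * q ^ k) has_sum (1 + 2 * (q * xi_g3 q))) UNIV"
    and q: "q \<noteq> 0" "norm q < 1"
  shows "((\<lambda>k. c (3 * k) * q ^ k) has_sum
    (euler (q ^ 2) * euler (q ^ 3) ^ 4 / (euler q ^ 2 * euler (q ^ 6) ^ 2))) UNIV"
proof -
  define M0 where "M0 Q = 1 + 2 * (Q * lambert_part Q (- (Q ^ 4))) / euler (Q ^ 2)" for Q
  define M1 where "M1 Q = 2 * lambert_part Q (- 1) / euler (Q ^ 2)" for Q
  define M2 where "M2 Q = 2 * lambert_part Q (- (Q ^ 2)) / euler (Q ^ 2)" for Q
  have "((\<lambda>k. c (3 * k) * q ^ k) has_sum M0 q) UNIV"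
  proof (rule three_dissection(1)[OF _ q])
    fix q :: complex assume q: "q \<noteq> 0" "norm q < 1"
    have "(q ^ 3) ^ 2 = q ^ 6" by (simp flip: power_mult)
    then have nz: "euler ((q ^ 3) ^ 2) \<noteq> 0" using euler_power_nonzero[OF q(2), of 6] by simp
    have "1 + 2 * (q * xi_g3 q) = M0 (q ^ 3) + q * M1 (q ^ 3) + q ^ 2 * M2 (q ^ 3)"
    proof -
      have "q * xi_g3 q = (q ^ 3 * lambert_part (q ^ 3) (- ((q ^ 3) ^ 4)) + q * lambert_part (q ^ 3) (- 1) + q ^ 2 * lambert_part (q ^ 3) (- ((q ^ 3) ^ 2))) / euler ((q ^ 3) ^ 2)"
        using xi_g3_dissection[OF q] nz by (simp add: nonzero_eq_divide_eq)
      then show ?thesis by (simp add: M0_def M1_def M2_def add_divide_distrib distrib_left mult_ac)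
    qed
    with c[OF q] show "((\<lambda>k. c k * q ^ k) has_sum (M0 (q ^ 3) + q * M1 (q ^ 3) + q ^ 2 * M2 (q ^ 3))) UNIV"
      by simp
  qed
  moreover have "M0 q = euler (q ^ 2) * euler (q ^ 3) ^ 4 / (euler q ^ 2 * euler (q ^ 6) ^ 2)"
  proof -
    have nz: "euler (q ^ 2) \<noteq> 0" by (rule euler_power_nonzero[OF q(2)]) simp
    then have "M0 q = (euler (q ^ 2) + 2 * (q * lambert_part q (- (q ^ 4)))) / euler (q ^ 2)"
      by (simp add: M0_def add_divide_distrib)
    then show ?thesis unfolding lambert_part_closed_form[OF q] using nz by (simp add: power2_eq_square)
  qed
  ultimately show ?thesis by simp
qed

text \<open>The series is the sum of (-1)^n q^(n^2). Multiples of 3 give a series in q^9; the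
  classes 1 and 2 modulo 3 are exchanged by n -> -n, whence the factor 2.\<close>

lemma theta_2_1_dissection:
  assumes q: "q \<noteq> 0" "norm q < 1"
  shows "theta (q ^ 2) (- q) = theta ((q ^ 3) ^ 6) (- ((q ^ 3) ^ 3)) - 2 * q * theta ((q ^ 3) ^ 6) (- ((q ^ 3) ^ 5))"
proof -
  have q2: "q ^ 2 \<noteq> 0" "norm (q ^ 2) < 1" using q norm_power_lt_1[OF q(2), of 2] by auto
  define Q where "Q = q ^ 3"
  have Q: "Q \<noteq> 0" "norm Q < 1" using q norm_power_lt_1[OF q(2), of 3] by (auto simp: Q_def)
  have Q6: "Q ^ 6 \<noteq> 0" "norm (Q ^ 6) < 1" using Q norm_power_lt_1[OF Q(2), of 6] by auto
  have m: "(- a) powi j = (-1) powi j * a powi j" for a :: complex and j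
    using power_int_mult_distrib[of "-1" a j] by simp
  define f where "f n = (q ^ 2) powi tri n * (- q) powi n" for n
  have f: "f n = (-1) powi n * q powi (n * n)" for n
  proof -
    have "n * n = 2 * tri n + n" using two_tri[of n] by (simp add: algebra_simps)
    then have "q powi (n * n) = q powi (2 * tri n) * q powi n" using q by (metis power_int_add)
    then show ?thesis by (simp add: f_def m[of q] power_int_power mult_ac)
  qed
  have a: "((\<lambda>k. f (3 * k)) has_sum theta (Q ^ 6) (- (Q ^ 3))) UNIV"
  proof -
    have "f (3 * k) = (Q ^ 6) powi tri k * (- (Q ^ 3)) powi k" for k
    proof -
      have "3 * k * (3 * k) = 18 * tri k + 9 * k" using two_tri[of k] by (simp add: algebra_simps)
      then have "q powi (3 * k * (3 * k)) = q powi (18 * tri k) * q powi (9 * k)" using q by (metis power_int_add)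
      moreover have "(-1) powi (3 * k) = ((-1) powi k :: complex)" by (simp add: power_int_mult)
      ultimately show ?thesis
        unfolding f m[of "Q ^ 3"] by (simp add: Q_def power_int_power mult_ac flip: power_mult)
    qed
    then show ?thesis using theta_has_sum[OF Q6, of "- (Q ^ 3)"] Q by simp
  qed
  have b: "((\<lambda>k. f (3 * k + 1)) has_sum (- q * theta (Q ^ 6) (- (Q ^ 5)))) UNIV"
  proof -
    have "f (3 * k + 1) = - q * ((Q ^ 6) powi tri k * (- (Q ^ 5)) powi k)" for k
    proof -
      have "(3 * k + 1) * (3 * k + 1) = 18 * tri k + 15 * k + 1" using two_tri[of k] by (simp add: algebra_simps)
      then have "q powi ((3 * k + 1) * (3 * k + 1)) = q powi (18 * tri k) * q powi (15 * k) * q"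
        using q by (simp only: power_int_add power_int_1_right simp_thms)
      moreover have "(-1) powi (3 * k + 1) = - ((-1) powi k :: complex)" by (simp add: power_int_mult power_int_add)
      ultimately show ?thesis
        unfolding f m[of "Q ^ 5"] by (simp add: Q_def power_int_power mult_ac flip: power_mult)
    qed
    then show ?thesis using has_sum_cmult_right[OF theta_has_sum[OF Q6, of "- (Q ^ 5)"], of "- q"] Q by simp
  qed
  have "f (3 * k + 2) = f (3 * (-1 - k) + 1)" for k
  proof -
    have "3 * (-1 - k) + 1 = - (3 * k + 2)" by simp
    moreover have "f (- n) = f n" for n
      unfolding f by (simp add: power_int_minus_one_minus)
    ultimately show ?thesis by (metis (no_types))
  qed
  then have c: "((\<lambda>k. f (3 * k + 2)) has_sum (- q * theta (Q ^ 6) (- (Q ^ 5)))) UNIV"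
    using has_sum_int_reflect[OF b, of "-1"] by simp
  from has_sum_int_mod_3[OF a b c]
  have "(f has_sum (theta (Q ^ 6) (- (Q ^ 3)) - 2 * q * theta (Q ^ 6) (- (Q ^ 5)))) UNIV"
    by (simp add: algebra_simps)
  moreover have "(f has_sum theta (q ^ 2) (- q)) UNIV"
    unfolding f_def using q by (intro theta_has_sum q2) simp
  ultimately show ?thesis unfolding Q_def by (metis has_sum_unique)
qed

lemma qpinf_omega:
  assumes "norm p < 1"
  shows "qpinf a p * qpinf (omega * a) p * qpinf (omega ^ 2 * a) p = qpinf (a ^ 3) (p ^ 3)"
proof (rule LIMSEQ_unique)
  show "(\<lambda>n. qpoch a p n * qpoch (omega * a) p n * qpoch (omega ^ 2 * a) p n) \<longlonglongrightarrow>
    qpinf a p * qpinf (omega * a) p * qpinf (omega ^ 2 * a) p"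
    by (intro tendsto_intros qpoch_LIMSEQ assms)
  have id: "(1 - x) * (1 - omega * x) * (1 - omega ^ 2 * x) = 1 - x ^ 3" for x
    using omega_cube omega_square by algebra
  have "qpoch a p n * qpoch (omega * a) p n * qpoch (omega ^ 2 * a) p n = qpoch (a ^ 3) (p ^ 3) n" for n
    unfolding qpoch_def prod.distrib[symmetric] mult.assoc[of omega] mult.assoc[of "omega ^ 2"] id
    by (simp add: power_mult_distrib mult.commute flip: power_mult)
  then show "(\<lambda>n. qpoch a p n * qpoch (omega * a) p n * qpoch (omega ^ 2 * a) p n) \<longlonglongrightarrow> qpinf (a ^ 3) (p ^ 3)"
    using qpoch_LIMSEQ[OF norm_power_lt_1[OF assms], of 3 "a ^ 3"] by simp
qed

text \<open>Factors 1 - q^n with 3 dividing n are invariant under rotation by omega and contribute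
  J(3)^3; each other factor multiplies with its rotations to 1 - q^(3n), which contributes J(3) /
  J(9).\<close>

lemma euler_omega:
  assumes q: "norm q < 1"
  shows "euler q * euler (omega * q) * euler (omega ^ 2 * q) = euler (q ^ 3) ^ 4 / euler (q ^ 9)"
proof -
  define p where "p = q ^ 3"
  have p: "norm p < 1" unfolding p_def by (rule norm_power_lt_1[OF q]) simp
  have e: "euler x = qpinf x p * qpinf (x ^ 2) p * euler p" if "x ^ 3 = p" "norm x < 1" for x
    using qpinf_split_3[OF that(2), of x] that(1) by (simp add: euler_def power2_eq_square power3_eq_cube mult.assoc)
  have o4: "omega ^ 4 = omega"
    using power_add[of omega 3 1] omega_cube by simp
  have 1: "(omega * q) ^ 3 = p" "(omega ^ 2 * q) ^ 3 = p"
    by (simp_all add: power_mult_distrib omega_cube omega_power_6 p_def flip: power_mult)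
  have 2: "norm (omega * q) < 1" "norm (omega ^ 2 * q) < 1"
    using q by (simp_all add: norm_mult norm_power norm_omega)
  have s: "(omega * q) ^ 2 = omega ^ 2 * q ^ 2" "(omega ^ 2 * q) ^ 2 = omega * q ^ 2"
    by (simp_all add: power_mult_distrib o4 flip: power_mult)
  have A: "qpinf q p * qpinf (omega * q) p * qpinf (omega ^ 2 * q) p = qpinf p (p ^ 3)"
    using qpinf_omega[OF p, of q] by (simp add: p_def)
  have B: "qpinf (q ^ 2) p * qpinf (omega ^ 2 * q ^ 2) p * qpinf (omega * q ^ 2) p = qpinf (p ^ 2) (p ^ 3)"
    using qpinf_omega[OF p, of "q ^ 2"] by (simp add: p_def mult_ac flip: power_mult)
  have "euler q * euler (omega * q) * euler (omega ^ 2 * q) =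
    (qpinf q p * qpinf (omega * q) p * qpinf (omega ^ 2 * q) p) *
    (qpinf (q ^ 2) p * qpinf (omega ^ 2 * q ^ 2) p * qpinf (omega * q ^ 2) p) * euler p ^ 3"
    unfolding e[OF p_def[symmetric] q] e[OF 1(1) 2(1)] e[OF 1(2) 2(2)] s by (simp add: power3_eq_cube mult_ac)
  also have "\<dots> = qpinf p (p ^ 3) * qpinf (p ^ 2) (p ^ 3) * euler p ^ 3"
    unfolding A B ..
  also have "qpinf p (p ^ 3) * qpinf (p ^ 2) (p ^ 3) = euler p / euler (p ^ 3)"
    using qpinf_split_3[OF p, of p] euler_power_nonzero[OF p, of 3]
    by (simp add: euler_def field_simps power2_eq_square power3_eq_cube)
  also have "euler p / euler (p ^ 3) * euler p ^ 3 = euler p ^ 4 / euler (p ^ 3)"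
    by (simp add: eval_nat_numeral)
  finally show ?thesis
    by (simp add: p_def flip: power_mult)
qed

lemma theta_omega_product:
  assumes q: "q \<noteq> 0" "norm q < 1"
  shows "theta (q ^ 2) (- q) * theta ((omega * q) ^ 2) (- (omega * q)) * theta ((omega ^ 2 * q) ^ 2) (- (omega ^ 2 * q))
    = euler (q ^ 3) ^ 8 * euler (q ^ 18) / (euler (q ^ 9) ^ 2 * euler (q ^ 6) ^ 4)"
proof -
  have o4: "omega ^ 4 = omega"
    using power_add[of omega 3 1] omega_cube by simp
  have 2: "norm (omega * q) < 1" "norm (omega ^ 2 * q) < 1" "omega * q \<noteq> 0" "omega ^ 2 * q \<noteq> 0"
    using q omega_nonzero by (simp_all add: norm_mult norm_power norm_omega)
  have s: "(omega * q) ^ 2 = omega ^ 2 * q ^ 2" "(omega ^ 2 * q) ^ 2 = omega * q ^ 2"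
    by (simp_all add: power_mult_distrib o4 flip: power_mult)
  have q2: "norm (q ^ 2) < 1" by (rule norm_power_lt_1[OF q(2)]) simp
  have A: "euler q * euler (omega * q) * euler (omega ^ 2 * q) = euler (q ^ 3) ^ 4 / euler (q ^ 9)"
    by (rule euler_omega[OF q(2)])
  have B: "euler (q ^ 2) * euler (omega ^ 2 * q ^ 2) * euler (omega * q ^ 2) = euler (q ^ 6) ^ 4 / euler (q ^ 18)"
    using euler_omega[OF q2] by (simp add: mult_ac flip: power_mult)
  have "theta (q ^ 2) (- q) * theta ((omega * q) ^ 2) (- (omega * q)) * theta ((omega ^ 2 * q) ^ 2) (- (omega ^ 2 * q))
    = (euler q * euler (omega * q) * euler (omega ^ 2 * q)) ^ 2 / (euler (q ^ 2) * euler (omega ^ 2 * q ^ 2) * euler (omega * q ^ 2))"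
    unfolding theta_2_1[OF q] theta_2_1[OF 2(3) 2(1)] theta_2_1[OF 2(4) 2(2)] unfolding s
    by (simp add: power_mult_distrib)
  also have "\<dots> = (euler (q ^ 3) ^ 4 / euler (q ^ 9)) ^ 2 / (euler (q ^ 6) ^ 4 / euler (q ^ 18))"
    unfolding A B ..
  finally show ?thesis by (simp add: power_divide flip: power_mult)
qed

text \<open>The product of a - 2 q b over the three cube roots q of Q is a^3 - 8 Q b^3. By the
  dissection it is also the product of the rotated theta functions, known from
  \<open>theta_omega_product\<close>.\<close>

lemma theta_cubic:
  assumes Q: "Q \<noteq> 0" "norm Q < 1"
  shows "theta (Q ^ 6) (- (Q ^ 3)) ^ 3 - 8 * Q * theta (Q ^ 6) (- (Q ^ 5)) ^ 3
    = euler Q ^ 8 * euler (Q ^ 6) / (euler (Q ^ 3) ^ 2 * euler (Q ^ 2) ^ 4)"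
proof -
  obtain q where q3: "q ^ 3 = Q" by (rule complex_cube_root)
  have q: "q \<noteq> 0" using Q(1) q3 by auto
  have nq: "norm q < 1" using Q(2) q3 norm_less_1_of_cube[of q] by simp
  have 1: "(omega * q) ^ 3 = Q" "(omega ^ 2 * q) ^ 3 = Q"
    by (simp_all add: power_mult_distrib omega_cube omega_power_6 q3 flip: power_mult)
  have 2: "norm (omega * q) < 1" "norm (omega ^ 2 * q) < 1" "omega * q \<noteq> 0" "omega ^ 2 * q \<noteq> 0"
    using q nq omega_nonzero by (simp_all add: norm_mult norm_power norm_omega)
  have p: "q ^ 18 = Q ^ 6" "q ^ 9 = Q ^ 3" "q ^ 6 = Q ^ 2" unfolding q3[symmetric] by (simp_all flip: power_mult)
  have id': "(a - t) * (a - omega * t) * (a - omega ^ 2 * t) = a ^ 3 - t ^ 3" for a t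
    using omega_cube omega_square by algebra
  have id: "(a - 2 * q * b) * (a - 2 * (omega * q) * b) * (a - 2 * (omega ^ 2 * q) * b) = a ^ 3 - 8 * Q * b ^ 3" for a b
    using id'[of a "2 * q * b"] by (simp add: power_mult_distrib q3 mult_ac)
  show ?thesis
    using theta_omega_product[OF q nq]
    unfolding theta_2_1_dissection[OF q nq] theta_2_1_dissection[OF 2(3) 2(1)] theta_2_1_dissection[OF 2(4) 2(2)] 1 q3 p id .
qed

text \<open>J(3)^4 / J(6)^2 is already a function W of q^3, and J(2) / J(1)^2 is 1 / (a - 2 q b).
  Expanding this by a^2 + 2 q a b + 4 q^2 b^2 makes the denominator D a function of q^3, so 4 W b^2
  / D is the component of residue 2.\<close>

theorem xi_9k_plus_6:
  assumes c: "\<And>q. q \<noteq> 0 \<Longrightarrow> norm q < 1 \<Longrightarrow> ((\<lambda>k. c k * q ^ k) has_sum (1 + 2 * (q * xi_g3 q))) UNIV"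
    and q: "q \<noteq> 0" "norm q < 1"
  shows "((\<lambda>k. c (9 * k + 6) * q ^ k) has_sum (4 * euler (q ^ 6) ^ 3 / euler q ^ 2)) UNIV"
proof -
  define a b W D where "a Q = theta (Q ^ 6) (- (Q ^ 3))" and "b Q = theta (Q ^ 6) (- (Q ^ 5))"
    and "W Q = euler Q ^ 4 / euler (Q ^ 2) ^ 2" and "D Q = a Q ^ 3 - 8 * Q * b Q ^ 3" for Q
  have D: "D Q \<noteq> 0" if "Q \<noteq> 0" "norm Q < 1" for Q
    unfolding D_def a_def b_def theta_cubic[OF that]
    using euler_power_nonzero[OF that(2)] euler_nonzero[OF that(2)] by simp
  have "((\<lambda>k. c (3 * (3 * k + 2)) * q ^ k) has_sum (W q * (4 * b q ^ 2) / D q)) UNIV"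
  proof (rule three_dissection(2)[OF _ q, where c = "\<lambda>k. c (3 * k)"
        and F = "\<lambda>Q. W Q * a Q ^ 2 / D Q" and G = "\<lambda>Q. W Q * (2 * a Q * b Q) / D Q" and H = "\<lambda>Q. W Q * (4 * b Q ^ 2) / D Q"])
    fix q :: complex assume q: "q \<noteq> 0" "norm q < 1"
    have q3: "q ^ 3 \<noteq> 0" "norm (q ^ 3) < 1" using q norm_power_lt_1[OF q(2), of 3] by auto
    have "euler (q ^ 2) * euler (q ^ 3) ^ 4 / (euler q ^ 2 * euler (q ^ 6) ^ 2) = W (q ^ 3) / (euler q ^ 2 / euler (q ^ 2))"
      by (simp add: W_def mult_ac flip: power_mult)
    also have "euler q ^ 2 / euler (q ^ 2) = a (q ^ 3) - 2 * q * b (q ^ 3)"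
      using theta_2_1_dissection[OF q] theta_2_1[OF q] by (simp add: a_def b_def)
    also have "W (q ^ 3) / (a (q ^ 3) - 2 * q * b (q ^ 3)) =
       W (q ^ 3) * a (q ^ 3) ^ 2 / D (q ^ 3) + q * (W (q ^ 3) * (2 * a (q ^ 3) * b (q ^ 3)) / D (q ^ 3))
       + q ^ 2 * (W (q ^ 3) * (4 * b (q ^ 3) ^ 2) / D (q ^ 3))"
    proof -
      define x y where "x = a (q ^ 3)" and "y = b (q ^ 3)"
      have f: "D (q ^ 3) = (x - 2 * q * y) * (x ^ 2 + 2 * q * x * y + 4 * q ^ 2 * y ^ 2)"
        by (simp add: D_def x_def y_def algebra_simps eval_nat_numeral)
      with D[OF q3] have nz: "x - 2 * q * y \<noteq> 0" "x ^ 2 + 2 * q * x * y + 4 * q ^ 2 * y ^ 2 \<noteq> 0" by auto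
      have "W (q ^ 3) / (x - 2 * q * y) = W (q ^ 3) * (x ^ 2 + 2 * q * x * y + 4 * q ^ 2 * y ^ 2) / D (q ^ 3)"
        unfolding f using nz by simp
      then show ?thesis by (simp add: x_def y_def distrib_left add_divide_distrib mult_ac)
    qed
    finally show "((\<lambda>k. c (3 * k) * q ^ k) has_sum (W (q ^ 3) * a (q ^ 3) ^ 2 / D (q ^ 3) + q * (W (q ^ 3) * (2 * a (q ^ 3) * b (q ^ 3)) / D (q ^ 3))
       + q ^ 2 * (W (q ^ 3) * (4 * b (q ^ 3) ^ 2) / D (q ^ 3)))) UNIV"
      using xi_multiples_of_3[OF c q] by simp
  qed
  moreover have "W q * (4 * b q ^ 2) / D q = 4 * euler (q ^ 6) ^ 3 / euler q ^ 2"
  proof -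
    have id: "e1 ^ 4 / e2 ^ 2 * (4 * (e1 * e6 ^ 2 / (e2 * e3)) ^ 2) / (e1 ^ 8 * e6 / (e3 ^ 2 * e2 ^ 4)) = 4 * e6 ^ 3 / e1 ^ 2"
      if "e1 \<noteq> 0" "e2 \<noteq> 0" "e3 \<noteq> 0" "e6 \<noteq> 0" for e1 e2 e3 e6 :: complex
      using that by (simp add: field_simps eval_nat_numeral)
    show ?thesis
      unfolding D_def a_def unfolding b_def theta_cubic[OF q] unfolding W_def theta_6_5[OF q]
      using euler_power_nonzero[OF q(2)] euler_nonzero[OF q(2)] by (intro id) simp_all
  qed
  ultimately show ?thesis by (simp add: algebra_simps)
qed

section \<open>Power series with integer coefficients\<close>

definition embed_fps :: "int fps \<Rightarrow> complex fps"
  where "embed_fps f = Abs_fps (\<lambda>k. of_int (fps_nth f k))"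

lemma embed_fps_nth [simp]: "fps_nth (embed_fps f) k = of_int (fps_nth f k)"
  by (simp add: embed_fps_def)

lemma embed_fps_mult: "embed_fps (f * g) = embed_fps f * embed_fps g"
  by (rule fps_ext) (simp add: fps_mult_nth)

lemma embed_fps_inject: "embed_fps f = embed_fps g \<Longrightarrow> f = g"
  by (simp add: fps_eq_iff)

text \<open>The origin is excluded since the theta series involve negative powers of \<open>q\<close>.\<close>

definition int_series :: "int fps \<Rightarrow> (complex \<Rightarrow> complex) \<Rightarrow> bool"
  where "int_series f F \<longleftrightarrow>
    (\<forall>q. q \<noteq> 0 \<longrightarrow> norm q < 1 \<longrightarrow> (\<lambda>k. of_int (fps_nth f k) * q ^ k) sums F q)"

lemma int_seriesD:
  "int_series f F \<Longrightarrow> q \<noteq> 0 \<Longrightarrow> norm q < 1 \<Longrightarrow> (\<lambda>k. of_int (fps_nth f k) * q ^ k) sums F q"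
  by (simp add: int_series_def)

lemma int_series_radius:
  assumes "int_series f F"
  shows "fps_conv_radius (embed_fps f) \<ge> 1"
  unfolding fps_conv_radius_def
proof (rule conv_radius_geI_ex')
  fix r :: real assume "0 < r" "ereal r < 1"
  then show "summable (\<lambda>n. fps_nth (embed_fps f) n * of_real r ^ n)"
    using int_seriesD[OF assms, of "of_real r"] by (auto dest: sums_summable)
qed

lemma radius_1_less:
  assumes "fps_conv_radius (f :: complex fps) \<ge> 1" "norm q < 1"
  shows "ereal (norm q) < fps_conv_radius f"
  using assms by (metis ereal_less(3) less_le_trans one_ereal_def ereal_less_eq(3) less_ereal.simps(1))

lemma int_series_eval:
  assumes "int_series f F" "q \<noteq> 0" "norm q < 1"
  shows "eval_fps (embed_fps f) q = F q"
proof -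
  have "(\<lambda>k. fps_nth (embed_fps f) k * q ^ k) sums eval_fps (embed_fps f) q"
    by (rule sums_eval_fps[OF radius_1_less[OF int_series_radius[OF assms(1)] assms(3)]])
  with int_seriesD[OF assms] show ?thesis by (simp add: sums_unique2)
qed

lemma int_seriesI:
  assumes "fps_conv_radius (embed_fps f) \<ge> 1"
    and "\<And>q. q \<noteq> 0 \<Longrightarrow> norm q < 1 \<Longrightarrow> eval_fps (embed_fps f) q = F q"
  shows "int_series f F"
  unfolding int_series_def
proof (intro allI impI)
  fix q :: complex assume q: "q \<noteq> 0" "norm q < 1"
  have "(\<lambda>k. fps_nth (embed_fps f) k * q ^ k) sums eval_fps (embed_fps f) q"
    by (rule sums_eval_fps[OF radius_1_less[OF assms(1) q(2)]])
  with assms(2)[OF q] show "(\<lambda>k. of_int (fps_nth f k) * q ^ k) sums F q" by simp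
qed

lemma int_series_mult:
  assumes "int_series f F" "int_series g G"
  shows "int_series (f * g) (\<lambda>q. F q * G q)"
proof (rule int_seriesI)
  note r = int_series_radius[OF assms(1)] int_series_radius[OF assms(2)]
  show "fps_conv_radius (embed_fps (f * g)) \<ge> 1"
    unfolding embed_fps_mult using fps_conv_radius_mult[of "embed_fps f" "embed_fps g"] r by (meson min.boundedI order_trans)
  show "eval_fps (embed_fps (f * g)) q = F q * G q" if "q \<noteq> 0" "norm q < 1" for q
    unfolding embed_fps_mult
    using eval_fps_mult[OF radius_1_less[OF r(1) that(2)] radius_1_less[OF r(2) that(2)]]
      int_series_eval[OF assms(1) that] int_series_eval[OF assms(2) that] by simp
qed

lemma int_series_power:
  assumes "int_series f F"
  shows "int_series (f ^ Suc n) (\<lambda>q. F q ^ Suc n)"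
proof (induction n)
  case (Suc n)
  from int_series_mult[OF assms Suc] show ?case by simp
qed (use assms in simp)

lemma int_series_X_power: "int_series (fps_X ^ m) (\<lambda>q. q ^ m)"
  unfolding int_series_def
proof (intro allI impI)
  fix q :: complex
  have "(\<lambda>k. of_int (fps_nth (fps_X ^ m) k) * q ^ k) = (\<lambda>k. if k = m then q ^ k else 0)"
    by (auto simp: fun_eq_iff fps_X_power_nth)
  then show "(\<lambda>k. of_int (fps_nth (fps_X ^ m) k) * q ^ k) sums q ^ m"
    using sums_single[of m "\<lambda>k. q ^ k"] by (simp only:)
qed

lemma int_series_1: "int_series 1 (\<lambda>_. 1)"
  using int_series_X_power[of 0] by simp

lemma int_series_diff:
  assumes "int_series f F" "int_series g G"
  shows "int_series (f - g) (\<lambda>q. F q - G q)"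
  using assms unfolding int_series_def by (auto simp: left_diff_distrib intro!: sums_diff)

lemma int_series_4:
  assumes "int_series f F"
  shows "int_series (4 * f) (\<lambda>q. 4 * F q)"
  using assms unfolding int_series_def by (auto simp: mult.assoc intro!: sums_mult)

lemma int_series_cong:
  assumes "int_series f F" "\<And>q. q \<noteq> 0 \<Longrightarrow> norm q < 1 \<Longrightarrow> F q = G q"
  shows "int_series f G"
  using assms by (simp add: int_series_def)

text \<open>The hypotheses say nothing about q = 0, but both power series are continuous there. They
  agree near the origin, and this determines their coefficients.\<close>

lemma int_series_unique:
  assumes f: "int_series f F" and g: "int_series g F"
  shows "f = g"
proof (rule embed_fps_inject, rule eval_fps_eqD)
  note r = int_series_radius[OF f] int_series_radius[OF g]
  show r': "fps_conv_radius (embed_fps f) > 0" "fps_conv_radius (embed_fps g) > 0"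
    using r by (auto intro: less_le_trans[of 0 "1 :: ereal"])
  have ev: "eventually (\<lambda>q. eval_fps (embed_fps f) q = eval_fps (embed_fps g) q) (at 0)"
    unfolding eventually_at
  proof (intro exI[of _ 1] conjI ballI impI)
    fix q :: complex assume "q \<noteq> 0 \<and> dist q 0 < 1"
    then show "eval_fps (embed_fps f) q = eval_fps (embed_fps g) q"
      using int_series_eval[OF f, of q] int_series_eval[OF g, of q] by simp
  qed simp
  have "(eval_fps (embed_fps f) \<longlongrightarrow> eval_fps (embed_fps f) 0) (at 0)" "(eval_fps (embed_fps g) \<longlongrightarrow> eval_fps (embed_fps g) 0) (at 0)"
    using r' by (auto intro!: continuous_within[THEN iffD1] continuous_eval_fps simp: zero_ereal_def)
  then have "eval_fps (embed_fps f) 0 = eval_fps (embed_fps g) 0"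
    using tendsto_cong[OF ev] by (metis at_neq_bot tendsto_unique)
  with ev show "eventually (\<lambda>q. eval_fps (embed_fps f) q = eval_fps (embed_fps g) q) (nhds 0)"
    by (simp add: eventually_nhds_conv_at)
qed

text \<open>Turns a theta series into a power series by collecting the finitely many indices with
  the same exponent.\<close>

lemma int_series_of_has_sum:
  fixes s :: "'a \<Rightarrow> int" and g :: "'a \<Rightarrow> nat"
  assumes fin: "\<And>N. finite {n. g n = N}"
    and hs: "\<And>q. q \<noteq> 0 \<Longrightarrow> norm q < 1 \<Longrightarrow> ((\<lambda>n. of_int (s n) * q ^ g n) has_sum F q) UNIV"
  shows "int_series (Abs_fps (\<lambda>N. \<Sum>n | g n = N. s n)) F"
  unfolding int_series_def
proof (intro allI impI)
  fix q :: complex assume q: "q \<noteq> 0" "norm q < 1"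
  have "bij_betw snd (Sigma UNIV (\<lambda>N. {n. g n = N})) UNIV"
    by (rule bij_betwI[where g = "\<lambda>n. (g n, n)"]) auto
  then have "((\<lambda>p. of_int (s (snd p)) * q ^ g (snd p)) has_sum F q) (Sigma UNIV (\<lambda>N. {n. g n = N}))"
    using hs[OF q] by (subst has_sum_reindex_bij_betw)
  then have "((\<lambda>N. of_int (\<Sum>n | g n = N. s n) * q ^ N) has_sum F q) UNIV"
  proof (rule has_sum_SigmaD)
    fix N
    show "((\<lambda>n. of_int (s (snd (N, n))) * q ^ g (snd (N, n))) has_sum (of_int (\<Sum>n | g n = N. s n) * q ^ N)) {n. g n = N}"
      using fin[of N] by (intro has_sum_finiteI) (simp_all add: sum_distrib_right)
  qed
  then show "(\<lambda>N. of_int (fps_nth (Abs_fps (\<lambda>N. \<Sum>n | g n = N. s n)) N) * q ^ N) sums F q"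
    by (simp add: has_sum_imp_sums)
qed

section \<open>Convergence of the series for xi\<close>

definition xi_recip :: "nat \<Rightarrow> int fps"
  where "xi_recip n = fps_right_inverse (xi_denom n) 1"

lemma xi_recip_mult: "xi_recip n * xi_denom n = 1"
  unfolding xi_recip_def by (subst mult.commute, rule fps_right_inverse) (simp add: xi_denom_nth_0)

lemma xi_denom_Suc:
  "xi_denom (Suc n) = xi_denom n * (1 - fps_X ^ (6 * n + 1)) * (1 - fps_X ^ (6 * n + 5))"
  by (simp add: xi_denom_def qpoch_Suc mult_ac power_add flip: power_mult power_Suc)

lemma xi_recip_Suc:
  "xi_recip (Suc n) * (1 - fps_X ^ (6 * n + 5)) * (1 - fps_X ^ (6 * n + 1)) = xi_recip n"
proof -
  have "xi_recip n = xi_recip n * (xi_recip (Suc n) * xi_denom (Suc n))"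
    by (simp add: xi_recip_mult)
  also have "\<dots> = (xi_recip n * xi_denom n) * (xi_recip (Suc n) * (1 - fps_X ^ (6 * n + 5)) * (1 - fps_X ^ (6 * n + 1)))"
    by (simp only: xi_denom_Suc mult_ac)
  finally show ?thesis by (simp add: xi_recip_mult)
qed

text \<open>Division by 1 - X^m is the recurrence f_k = g_k + f_(k-m), which preserves
  nonnegativity. A partial sum S of f at r then satisfies S \<le> G + r^m S, where G is the sum of
  g, so S is at most G / (1 - r^m).\<close>

lemma fps_divide_one_minus_X_power:
  fixes f g :: "int fps"
  assumes fg: "f * (1 - fps_X ^ m) = g" and m: "m > 0" and g: "\<And>k. fps_nth g k \<ge> 0"
  shows "fps_nth f k \<ge> 0"
    and "0 \<le> r \<Longrightarrow> r < 1 \<Longrightarrow> summable (\<lambda>k. real_of_int (fps_nth g k) * r ^ k) \<Longrightarrow>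
      summable (\<lambda>k. real_of_int (fps_nth f k) * r ^ k)"
proof -
  have rec: "fps_nth f k = fps_nth g k + (if k < m then 0 else fps_nth f (k - m))" for k
    unfolding fg[symmetric] by (simp add: right_diff_distrib fps_X_power_mult_right_nth)
  show f: "fps_nth f k \<ge> 0" for k
  proof (induction k rule: less_induct)
    case (less k)
    then show ?case using rec[of k] g[of k] m by simp
  qed
  assume r: "0 \<le> r" "r < 1" and s: "summable (\<lambda>k. real_of_int (fps_nth g k) * r ^ k)"
  let ?a = "\<lambda>k. real_of_int (fps_nth f k) * r ^ k"
  let ?b = "\<lambda>k. real_of_int (fps_nth g k) * r ^ k"
  have rm: "r ^ m < 1" using r m power_strict_mono[of r 1 m] by simp
  show "summable ?a"
  proof (rule summableI_nonneg_bounded)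
    show "0 \<le> ?a k" for k using f r by simp
    show "(\<Sum>k<N. ?a k) \<le> suminf ?b / (1 - r ^ m)" for N
    proof -
      have "(\<Sum>k<N. ?a k) = (\<Sum>k<N. ?b k) + (\<Sum>k<N. if k < m then 0 else r ^ m * ?a (k - m))"
        unfolding sum.distrib[symmetric]
      proof (rule sum.cong[OF refl])
        fix k
        show "?a k = ?b k + (if k < m then 0 else r ^ m * ?a (k - m))"
          using rec[of k] by (auto simp: algebra_simps simp flip: power_add)
      qed
      also have "(\<Sum>k<N. ?b k) \<le> suminf ?b"
        using s g r by (intro sum_le_suminf) auto
      also have "(\<Sum>k<N. if k < m then 0 else r ^ m * ?a (k - m)) \<le> r ^ m * (\<Sum>k<N. ?a k)"
      proof -
        have "(\<Sum>k<N. if k < m then 0 else r ^ m * ?a (k - m)) = (\<Sum>k\<in>{m..<N}. r ^ m * ?a (k - m))"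
          by (rule sum.mono_neutral_cong_right) auto
        also have "\<dots> = (\<Sum>k<N - m. r ^ m * ?a k)"
          by (rule sum.reindex_bij_witness[of _ "\<lambda>k. k + m" "\<lambda>k. k - m"]) auto
        also have "\<dots> \<le> (\<Sum>k<N. r ^ m * ?a k)"
          using f r by (intro sum_mono2) auto
        finally show ?thesis by (simp add: sum_distrib_left)
      qed
      finally have "(\<Sum>k<N. ?a k) * (1 - r ^ m) \<le> suminf ?b" by (simp add: algebra_simps)
      then show ?thesis using rm by (simp add: field_simps)
    qed
  qed
qed

lemma xi_recip_nonneg_summable:
  "fps_nth (xi_recip n) k \<ge> 0 \<and> (\<forall>r. 0 \<le> r \<longrightarrow> r < 1 \<longrightarrow> summable (\<lambda>k. real_of_int (fps_nth (xi_recip n) k) * r ^ k))"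
proof (induction n arbitrary: k)
  case 0
  have "xi_recip 0 = 1" using xi_recip_mult[of 0] by (simp add: xi_denom_def)
  moreover have "(\<lambda>k. real_of_int (fps_nth 1 k) * r ^ k) = (\<lambda>k. if k = 0 then 1 else 0)" for r :: real
    by (auto simp: fun_eq_iff)
  ultimately show ?case using sums_single[of 0 "\<lambda>_. 1 :: real"] by (auto simp: sums_iff)
next
  case (Suc n)
  let ?h = "xi_recip (Suc n) * (1 - fps_X ^ (6 * n + 5))"
  note 1 = fps_divide_one_minus_X_power[OF xi_recip_Suc[of n] _ conjunct1[OF Suc]]
  have h: "fps_nth ?h k \<ge> 0" for k by (rule 1(1)) simp
  note 2 = fps_divide_one_minus_X_power[OF refl[of ?h] _ h]
  show ?case
    using Suc 1(2) 2 by auto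
qed

lemma xi_recip_int_series:
  "int_series (xi_recip n) (\<lambda>q. 1 / (qpoch q (q ^ 6) n * qpoch (q ^ 5) (q ^ 6) n))"
proof (rule int_seriesI)
  show rad: "fps_conv_radius (embed_fps (xi_recip n)) \<ge> 1"
    unfolding fps_conv_radius_def
  proof (rule conv_radius_geI_ex')
    fix r :: real assume "0 < r" "ereal r < 1"
    then have "summable (\<lambda>k. of_real (real_of_int (fps_nth (xi_recip n) k) * r ^ k) :: complex)"
      using xi_recip_nonneg_summable[of n] by (intro summable_of_real) simp
    then show "summable (\<lambda>k. fps_nth (embed_fps (xi_recip n)) k * of_real r ^ k)" by simp
  qed
  have factor: "int_series (1 - fps_X ^ m) (\<lambda>q. 1 - q ^ m)" for m
    by (rule int_series_diff[OF int_series_1 int_series_X_power])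
  have denom: "int_series (xi_denom n) (\<lambda>q. qpoch q (q ^ 6) n * qpoch (q ^ 5) (q ^ 6) n)" for n
  proof (induction n)
    case 0
    then show ?case using int_series_1 by (simp add: xi_denom_def)
  next
    case (Suc n)
    have e: "q * (q ^ 6) ^ n = q ^ (6 * n + 1)" "q ^ 5 * (q ^ 6) ^ n = q ^ (6 * n + 5)" for q :: complex
      by (simp_all add: power_add mult.commute flip: power_mult)
    have "qpoch q (q ^ 6) (Suc n) * qpoch (q ^ 5) (q ^ 6) (Suc n) =
      qpoch q (q ^ 6) n * qpoch (q ^ 5) (q ^ 6) n * (1 - q ^ (6 * n + 1)) * (1 - q ^ (6 * n + 5))" for q :: complex
      unfolding qpoch_Suc e by (simp only: mult_ac)
    then show ?case
      unfolding xi_denom_Suc by (simp only: int_series_mult[OF int_series_mult[OF Suc factor] factor])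
  qed
  have recip: "int_series (xi_recip n) (eval_fps (embed_fps (xi_recip n)))"
    by (rule int_seriesI[OF rad]) simp
  fix q :: complex assume q: "q \<noteq> 0" "norm q < 1"
  have "eval_fps (embed_fps (xi_recip n)) q * (qpoch q (q ^ 6) n * qpoch (q ^ 5) (q ^ 6) n) = 1"
    using int_series_eval[OF int_series_mult[OF recip denom[of n]] q] int_series_eval[OF int_series_1 q]
    by (simp add: xi_recip_mult)
  then show "eval_fps (embed_fps (xi_recip n)) q = 1 / (qpoch q (q ^ 6) n * qpoch (q ^ 5) (q ^ 6) n)"
    by (metis mult_zero_right nonzero_eq_divide_eq zero_neq_one)
qed

text \<open>The value of \<open>xi_term (Suc n)\<close>, with a factor q set apart so that the rest
  is the summand of \<open>xi_g3\<close>.\<close>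

definition xi_value :: "nat \<Rightarrow> complex \<Rightarrow> complex"
  where "xi_value n q = q * ((q ^ 6) ^ (n * (n + 1)) / (qpoch q (q ^ 6) (Suc n) * qpoch (q ^ 5) (q ^ 6) (Suc n)))"

lemma xi_term_eq: "xi_term (Suc n) = fps_X ^ (6 * (n * (n + 1)) + 1) * xi_recip (Suc n)"
proof -
  have "6 * Suc n ^ 2 - 6 * Suc n + 1 = 6 * (n * (n + 1)) + 1"
    by (simp add: power2_eq_square algebra_simps)
  then show ?thesis unfolding xi_term_def xi_recip_def by (simp only:)
qed

lemma xi_term_int_series: "int_series (xi_term (Suc n)) (xi_value n)"
proof -
  have e: "xi_value n = (\<lambda>q. q ^ (6 * (n * (n + 1)) + 1) * (1 / (qpoch q (q ^ 6) (Suc n) * qpoch (q ^ 5) (q ^ 6) (Suc n))))"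
    unfolding xi_value_def power_mult[symmetric] by (simp add: fun_eq_iff)
  show ?thesis
    unfolding xi_term_eq e by (rule int_series_mult[OF int_series_X_power xi_recip_int_series])
qed

lemma xi_term_nonneg: "fps_nth (xi_term (Suc n)) k \<ge> 0"
  unfolding xi_term_eq fps_X_power_mult_nth using xi_recip_nonneg_summable by simp

lemma xi_value_bound:
  assumes q: "q \<noteq> 0" "norm q < 1"
  obtains K where "\<And>n. norm (xi_value n q) \<le> K * norm q ^ n"
proof -
  have q6: "norm (q ^ 6) < 1" by (rule norm_power_lt_1[OF q(2)]) simp
  have "q * (q ^ 6) ^ n \<noteq> 1" "q ^ 5 * (q ^ 6) ^ n \<noteq> 1" for n
    using power_neq_1[OF q(2), of "6 * n + 1"] power_neq_1[OF q(2), of "6 * n + 5"]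
    by (simp_all add: power_add mult.commute flip: power_mult)
  then have nz: "qpinf q (q ^ 6) \<noteq> 0" "qpinf (q ^ 5) (q ^ 6) \<noteq> 0"
    using qpinf_nonzero[OF q6] by blast+
  let ?d = "\<lambda>n. 1 / (qpoch q (q ^ 6) (Suc n) * qpoch (q ^ 5) (q ^ 6) (Suc n))"
  have "?d \<longlonglongrightarrow> 1 / (qpinf q (q ^ 6) * qpinf (q ^ 5) (q ^ 6))"
    by (intro tendsto_intros LIMSEQ_Suc qpoch_LIMSEQ q6) (use nz in simp)
  then have "Bseq ?d" by (intro convergent_imp_Bseq) (auto simp: convergent_def)
  then obtain K where K: "K > 0" "\<And>n. norm (?d n) \<le> K" by (auto elim: BseqE)
  have "norm (xi_value n q) \<le> K * norm q ^ n" for n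
  proof -
    have "xi_value n q = q ^ (6 * (n * (n + 1)) + 1) * ?d n"
      unfolding xi_value_def power_mult[symmetric] by simp
    then have "norm (xi_value n q) = norm q ^ (6 * (n * (n + 1)) + 1) * norm (?d n)"
      by (simp only: norm_mult norm_power)
    also have "\<dots> \<le> norm q ^ n * K"
      by (intro mult_mono K power_decreasing) (use q in auto)
    finally show ?thesis by (simp add: mult.commute)
  qed
  then show thesis by (rule that)
qed

lemma xi_nth: "fps_nth (\<Sum>n. xi_term (Suc n)) k = (\<Sum>n\<le>k. fps_nth (xi_term (Suc n)) k)"
  and xi_term_nth_0: "n > k \<Longrightarrow> fps_nth (xi_term (Suc n)) k = 0"
proof -
  show 0: "fps_nth (xi_term (Suc n)) k = 0" if "n > k" for n
  proof -
    have "k < 6 * (n * (n + 1)) + 1" using that by (simp add: algebra_simps)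
    then show ?thesis unfolding xi_term_eq fps_X_power_mult_nth by simp
  qed
  have "(\<lambda>N. \<Sum>n<N. xi_term (Suc n)) \<longlonglongrightarrow> (\<Sum>n. xi_term (Suc n))"
    by (rule summable_LIMSEQ[OF summable_xi_term])
  then have "eventually (\<lambda>N. fps_nth (\<Sum>n<N. xi_term (Suc n)) k = fps_nth (\<Sum>n. xi_term (Suc n)) k) sequentially"
    unfolding tendsto_fps_iff by blast
  then obtain N where N: "\<And>M. M \<ge> N \<Longrightarrow> fps_nth (\<Sum>n<M. xi_term (Suc n)) k = fps_nth (\<Sum>n. xi_term (Suc n)) k"
    by (auto simp: eventually_sequentially)
  \<comment> \<open>This bound is past N, so the coefficient is stable, and past k, so the remaining
    terms vanish.\<close>
  have "fps_nth (\<Sum>n. xi_term (Suc n)) k = (\<Sum>n<N + Suc k. fps_nth (xi_term (Suc n)) k)"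
    using N[of "N + Suc k"] by (simp add: fps_sum_nth)
  also have "\<dots> = (\<Sum>n\<le>k. fps_nth (xi_term (Suc n)) k)"
    by (rule sum.mono_neutral_right) (auto intro: 0)
  finally show "fps_nth (\<Sum>n. xi_term (Suc n)) k = (\<Sum>n\<le>k. fps_nth (xi_term (Suc n)) k)" .
qed

text \<open>The double series over terms and exponents is summed both ways. The coefficients of the
  terms are nonnegative, so the absolute values in row n add up to \<open>xi_value n\<close> at |q|;
  these are dominated by a geometric series, which gives absolute convergence.\<close>

lemma p_xi_has_sum:
  assumes q: "q \<noteq> 0" "norm q < 1"
  shows "((\<lambda>k. of_int (p_xi k) * q ^ k) has_sum (1 + 2 * (q * xi_g3 q))) UNIV"
proof -
  define f where "f = (\<lambda>(n, k). of_int (fps_nth (xi_term (Suc n)) k) * q ^ k)"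
  define x where "x = complex_of_real (norm q)"
  have x: "x \<noteq> 0" "norm x < 1" using q by (simp_all add: x_def)
  obtain K where K: "\<And>n. norm (xi_value n x) \<le> K * norm x ^ n" by (rule xi_value_bound[OF x]) blast
  have rows: "((\<lambda>k. norm (f (n, k))) has_sum Re (xi_value n x)) UNIV" for n
  proof -
    have "(\<lambda>k. Re (of_int (fps_nth (xi_term (Suc n)) k) * x ^ k)) sums Re (xi_value n x)"
      by (rule sums_Re[OF int_seriesD[OF xi_term_int_series x]])
    moreover have "Re (of_int (fps_nth (xi_term (Suc n)) k) * x ^ k) = norm (f (n, k))" for k
      using xi_term_nonneg[of n k] by (simp add: f_def x_def norm_mult norm_power flip: of_real_power)
    ultimately show ?thesis by (intro sums_nonneg_imp_has_sum) simp_all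
  qed
  have "(\<lambda>n. K * norm x ^ n) summable_on UNIV"
  proof (rule summable_nonneg_imp_summable_on)
    show "summable (\<lambda>n. K * norm x ^ n)" using x by (intro summable_mult summable_geometric) simp
    show "0 \<le> K * norm x ^ n" for n using K[of n] norm_ge_zero order_trans by blast
  qed
  then have "(\<lambda>n. Re (xi_value n x)) summable_on UNIV"
  proof (rule summable_on_comparison_test)
    fix n
    show "Re (xi_value n x) \<le> K * norm x ^ n" using K[of n] complex_Re_le_cmod order_trans by blast
    show "0 \<le> Re (xi_value n x)" by (rule has_sum_nonneg[OF rows]) simp
  qed
  moreover have "Re (xi_value n x) \<ge> 0" for n by (rule has_sum_nonneg[OF rows]) simp
  ultimately have "f abs_summable_on UNIV \<times> UNIV"
    unfolding abs_summable_on_Sigma_iff infsumI[OF rows] using has_sum_imp_summable[OF rows] by simp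
  then have f: "(f has_sum infsum f (UNIV \<times> UNIV)) (UNIV \<times> UNIV)"
    by (rule has_sum_infsum[OF abs_summable_summable])
  let ?T = "infsum f (UNIV \<times> UNIV)"
  have "((\<lambda>n. xi_value n q) has_sum ?T) UNIV"
  proof (rule has_sum_SigmaD[OF f])
    fix n
    have "summable (\<lambda>k. norm (f (n, k)))" by (rule summable_on_imp_summable[OF has_sum_imp_summable[OF rows]])
    moreover have "(\<lambda>k. f (n, k)) sums xi_value n q"
      using int_seriesD[OF xi_term_int_series q] by (simp add: f_def)
    ultimately show "((\<lambda>k. f (n, k)) has_sum xi_value n q) UNIV" by (rule norm_summable_imp_has_sum)
  qed
  then have "((\<lambda>n. (q ^ 6) ^ (n * (n + 1)) / (qpoch q (q ^ 6) (Suc n) * qpoch (q ^ 5) (q ^ 6) (Suc n))) has_sum (?T / q)) UNIV"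
    unfolding xi_value_def using q by (subst (asm) has_sum_cmult_right_iff) auto
  then have T: "?T = q * xi_g3 q"
    unfolding xi_g3_def using q by (simp add: infsumI)
  have cols: "((\<lambda>k. of_int (\<Sum>n\<le>k. fps_nth (xi_term (Suc n)) k) * q ^ k) has_sum ?T) UNIV"
  proof (rule has_sum_SigmaD[OF f[THEN has_sum_swap[THEN iffD1]]])
    fix k
    show "((\<lambda>n. case (k, n) of (x, y) \<Rightarrow> f (y, x)) has_sum of_int (\<Sum>n\<le>k. fps_nth (xi_term (Suc n)) k) * q ^ k) UNIV"
      by (rule has_sum_finite_neutralI[of "{..k}"]) (auto simp: f_def xi_term_nth_0 sum_distrib_right)
  qed
  have one: "((\<lambda>k::nat. if k = 0 then 1 else 0) has_sum (1 :: complex)) UNIV"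
    by (rule has_sum_finite_neutralI[of "{0}"]) auto
  have "of_int (p_xi k) * q ^ k = (if k = 0 then 1 else 0) + 2 * (of_int (\<Sum>n\<le>k. fps_nth (xi_term (Suc n)) k) * q ^ k)" for k
    unfolding p_xi_def xi_def fps_add_nth fps_mult_numeral_left xi_nth by (simp add: algebra_simps)
  with has_sum_add[OF one has_sum_cmult_right[OF cols, of 2]] show ?thesis unfolding T by simp
qed

section \<open>The congruence modulo 5\<close>

text \<open>The generalized pentagonal number n(3n+1)/2, in the form in which
  \<open>theta_3_2\<close> produces it. By \<open>pentagonal_bound\<close> the argument of
  \<open>nat\<close> is nonnegative and each value is taken finitely often.\<close>

definition pentagonal :: "int \<Rightarrow> nat"
  where "pentagonal n = nat (3 * tri n + 2 * n)"

lemma pentagonal_bound: "\<bar>n\<bar> \<le> 3 * tri n + 2 * n"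
proof -
  have "2 * (3 * tri n + 2 * n) = n * (3 * n + 1)"
    using two_tri[of n] by (simp add: algebra_simps)
  moreover have "2 * \<bar>n\<bar> \<le> n * (3 * n + 1)"
  proof (cases "n \<ge> 0")
    case True
    then show ?thesis by (cases "n = 0") (use mult_left_mono[of 2 "3 * n + 1" n] in auto)
  next
    case False
    then have "(- n) * 2 \<le> (- n) * (- (3 * n + 1))" by (intro mult_left_mono) auto
    with False show ?thesis by (simp add: algebra_simps)
  qed
  ultimately show ?thesis by simp
qed

definition euler_fps :: "int fps"
  where "euler_fps = Abs_fps (\<lambda>N. \<Sum>n | pentagonal n = N. if even n then 1 else -1)"

theorem euler_pentagonal: "int_series euler_fps euler"
  unfolding euler_fps_def
proof (rule int_series_of_has_sum)
  fix N
  have "{n. pentagonal n = N} \<subseteq> {- int N..int N}"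
  proof
    fix n assume "n \<in> {n. pentagonal n = N}"
    then have "3 * tri n + 2 * n = int N" using pentagonal_bound[of n] by (auto simp: pentagonal_def)
    with pentagonal_bound[of n] show "n \<in> {- int N..int N}" by auto
  qed
  then show "finite {n. pentagonal n = N}" by (rule finite_subset) simp
next
  fix q :: complex assume q: "q \<noteq> 0" "norm q < 1"
  have q3: "q ^ 3 \<noteq> 0" "norm (q ^ 3) < 1" using q norm_power_lt_1[OF q(2), of 3] by auto
  have "((\<lambda>n. (q ^ 3) powi tri n * (- (q ^ 2)) powi n) has_sum theta (q ^ 3) (- (q ^ 2))) UNIV"
    using q by (intro theta_has_sum q3) simp
  moreover have "(q ^ 3) powi tri n * (- (q ^ 2)) powi n = of_int (if even n then 1 else -1) * q ^ pentagonal n" for n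
  proof -
    have "3 * tri n + 2 * n = int (pentagonal n)" using pentagonal_bound[of n] by (simp add: pentagonal_def)
    then have "q powi (3 * tri n) * q powi (2 * n) = q ^ pentagonal n"
      using q(1) by (metis power_int_add power_int_of_nat)
    then show ?thesis by (cases "even n") (simp_all add: power_int_power)
  qed
  ultimately show "((\<lambda>n. of_int (if even n then 1 else -1) * q ^ pentagonal n) has_sum euler q) UNIV"
    by (simp add: theta_3_2[OF q])
qed

definition triangular :: "nat \<Rightarrow> nat"
  where "triangular n = n * (n + 1) div 2"

lemma tri_of_nat: "tri (int n + 1) = int (triangular n)"
  by (simp add: tri_def triangular_def zdiv_int algebra_simps)

lemma triangular_ge: "n \<le> triangular n"
  unfolding triangular_def by (cases n) auto

text \<open>Jacobi's series for J(c)^3.\<close>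

definition cube_fps :: "nat \<Rightarrow> int fps"
  where "cube_fps c = Abs_fps (\<lambda>N. \<Sum>n | c * triangular n = N. (-1) ^ n * (2 * int n + 1))"

lemma finite_triangular: "c > 0 \<Longrightarrow> finite {n. c * triangular n = N}"
proof (rule finite_subset)
  assume "c > 0"
  show "{n. c * triangular n = N} \<subseteq> {..N}"
  proof
    fix n assume "n \<in> {n. c * triangular n = N}"
    moreover have "n \<le> c * triangular n" using triangular_ge[of n] \<open>c > 0\<close> by (cases c) auto
    ultimately show "n \<in> {..N}" by auto
  qed
qed simp

text \<open>Folds the sum over all integers: j = n + 1 and j = -n have the same exponent, and their
  coefficients n + 1 and -n carry opposite signs, so they combine to 2n + 1 up to sign.\<close>

lemma jacobi_cube:
  assumes q: "q \<noteq> 0" "norm q < 1"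
  shows "((\<lambda>n. of_int ((-1) ^ n * (2 * int n + 1)) * q ^ triangular n) has_sum (euler q ^ 3)) UNIV"
proof -
  define f where "f j = of_int j * (q powi tri j * (-1) powi j)" for j
  have f: "(f has_sum (- (euler q ^ 3))) UNIV"
    unfolding f_def euler_def by (rule jacobi_cube_int[OF q])
  have s: "f summable_on A" for A
    by (rule summable_on_subset_banach[OF has_sum_imp_summable[OF f]]) simp
  have "(f has_sum (infsum f {1..} + infsum f {..0})) ({1..} \<union> {..0})"
    by (intro has_sum_Un_disjoint has_sum_infsum s) auto
  moreover have "{1..} \<union> {..0} = (UNIV :: int set)" by auto
  ultimately have eq: "infsum f {1..} + infsum f {..0} = - (euler q ^ 3)"
    using f has_sum_unique by metis
  have "bij_betw (\<lambda>n. int n + 1) UNIV {1..}"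
    by (rule bij_betwI[where g = "\<lambda>j. nat (j - 1)"]) auto
  then have 1: "((\<lambda>n. f (int n + 1)) has_sum infsum f {1..}) UNIV"
    by (subst has_sum_reindex_bij_betw) (auto intro: has_sum_infsum s)
  have "bij_betw (\<lambda>n. - int n) UNIV {..0}"
    by (rule bij_betwI[where g = "\<lambda>j. nat (- j)"]) auto
  then have 2: "((\<lambda>n. f (- int n)) has_sum infsum f {..0}) UNIV"
    by (subst has_sum_reindex_bij_betw) (auto intro: has_sum_infsum s)
  have "f (int n + 1) + f (- int n) = - (of_int ((-1) ^ n * (2 * int n + 1)) * q ^ triangular n)" for n
  proof -
    have "tri (- int n) = tri (int n + 1)" using tri_reflect[of "int n + 1"] by simp
    then have t: "q powi tri (int n + 1) = q ^ triangular n" "q powi tri (- int n) = q ^ triangular n"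
      by (simp_all only: tri_of_nat power_int_of_nat)
    have "(-1) powi (int n + 1) = - ((-1) ^ n :: complex)" "(-1) powi (- int n) = ((-1) ^ n :: complex)"
      by (simp_all add: power_int_add power_int_minus_one_minus)
    then show ?thesis unfolding f_def t by (simp add: algebra_simps)
  qed
  with has_sum_add[OF 1 2] have "((\<lambda>n. - (of_int ((-1) ^ n * (2 * int n + 1)) * q ^ triangular n)) has_sum (- (euler q ^ 3))) UNIV"
    by (simp add: eq)
  then show ?thesis by (subst (asm) has_sum_uminus) simp
qed

lemma cube_fps_int_series:
  assumes "c > 0"
  shows "int_series (cube_fps c) (\<lambda>q. euler (q ^ c) ^ 3)"
  unfolding cube_fps_def
proof (rule int_series_of_has_sum[OF finite_triangular[OF assms]])
  fix q :: complex assume "q \<noteq> 0" "norm q < 1"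
  then show "((\<lambda>n. of_int ((-1) ^ n * (2 * int n + 1)) * q ^ (c * triangular n)) has_sum euler (q ^ c) ^ 3) UNIV"
    unfolding power_mult using assms by (intro jacobi_cube norm_power_lt_1) auto
qed

text \<open>Modulo 5 a triangular number is 0, 1 or 3, and it is 3 only for n = 2 modulo 5, where 5
  divides 2n + 1.\<close>

lemma triangular_mod_5:
  assumes "triangular n mod 5 \<noteq> 0" "triangular n mod 5 \<noteq> 1"
  shows "(2 * n + 1) mod 5 = 0"
proof -
  have "2 * triangular n = n * (n + 1)" by (simp add: triangular_def)
  then have e: "(2 * triangular n) mod 5 = ((n mod 5) * ((n + 1) mod 5)) mod 5"
    by (simp only: mod_mult_eq)
  have "n mod 5 = 0 \<and> (n + 1) mod 5 = 1 \<or> n mod 5 = 1 \<and> (n + 1) mod 5 = 2 \<or> n mod 5 = 2 \<or>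
      n mod 5 = 3 \<and> (n + 1) mod 5 = 4 \<or> n mod 5 = 4 \<and> (n + 1) mod 5 = 0"
    by presburger
  then have "n mod 5 = 2 \<or> (2 * triangular n) mod 5 = 0 \<or> (2 * triangular n) mod 5 = 2"
    unfolding e by (elim disjE) simp_all
  moreover have "triangular n mod 5 = 0 \<or> triangular n mod 5 = 1"
    if "(2 * triangular n) mod 5 = 0 \<or> (2 * triangular n) mod 5 = 2"
    using that by presburger
  ultimately have "n mod 5 = 2" using assms by argo
  then show ?thesis by presburger
qed

lemma cube_fps_dvd:
  assumes "c mod 5 = 1" "N mod 5 \<noteq> 0" "N mod 5 \<noteq> 1"
  shows "5 dvd fps_nth (cube_fps c) N"
proof -
  have "5 dvd (-1) ^ n * (2 * int n + 1)" if "c * triangular n = N" for n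
  proof -
    have "N mod 5 = triangular n mod 5"
      unfolding that[symmetric] using assms(1) by (metis mod_mult_left_eq mult_1)
    then have "(2 * n + 1) mod 5 = 0" using assms(2,3) by (intro triangular_mod_5) auto
    then have "5 dvd int (2 * n + 1)" by presburger
    then show ?thesis by (simp add: add.commute)
  qed
  then show ?thesis unfolding cube_fps_def by (auto intro!: dvd_sum)
qed

text \<open>Modulo 5 both factors are supported on the exponents 0 and 1, because 6 = 1 modulo 5;
  sums of two of these avoid 3 and 4.\<close>

lemma cube_fps_mult_dvd:
  assumes "N mod 5 = 3 \<or> N mod 5 = 4"
  shows "5 dvd fps_nth (cube_fps 6 * cube_fps 1) N"
  unfolding fps_mult_nth
proof (rule dvd_sum)
  fix i assume "i \<in> {0..N}"
  then have "N mod 5 = (i mod 5 + (N - i) mod 5) mod 5"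
    by (simp add: mod_add_eq)
  then have "i mod 5 \<notin> {0, 1} \<or> (N - i) mod 5 \<notin> {0, 1}"
    using assms by auto
  then show "5 dvd fps_nth (cube_fps 6) i * fps_nth (cube_fps 1) (N - i)"
    using cube_fps_dvd[of 6 i] cube_fps_dvd[of 1 "N - i"] by (auto intro: dvd_mult dvd_mult2)
qed

text \<open>The derivative of f^5 is a multiple of 5, so 5 divides n times the n-th coefficient, and
  n is coprime to 5.\<close>

lemma fps_fifth_power_dvd:
  fixes f :: "int fps"
  assumes "n mod 5 \<noteq> 0"
  shows "5 dvd fps_nth (f ^ 5) n"
proof -
  obtain m where n: "n = m + 1" using assms by (cases n) auto
  have "fps_deriv (f ^ 5) = 5 * (fps_deriv f * f ^ 4)"
    by (simp add: fps_deriv_power' mult.assoc)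
  then have "of_nat (m + 1) * fps_nth (f ^ 5) (m + 1) = 5 * fps_nth (fps_deriv f * f ^ 4) m"
    by (metis fps_deriv_nth fps_mult_numeral_left)
  then have "5 dvd int n * fps_nth (f ^ 5) n"
    unfolding n by (metis dvd_triv_left)
  moreover have "coprime 5 (int n)"
  proof -
    have "\<not> 5 dvd int n" using assms by presburger
    then show ?thesis by (simp add: prime_imp_coprime)
  qed
  ultimately show ?thesis by (simp add: coprime_dvd_mult_right_iff)
qed

section \<open>The coefficients p_xi(9k+6) modulo 5\<close>

definition xi_9k_plus_6_fps :: "int fps"
  where "xi_9k_plus_6_fps = Abs_fps (\<lambda>k. p_xi (9 * k + 6))"

lemma xi_9k_plus_6_fps_int_series: "int_series xi_9k_plus_6_fps (\<lambda>q. 4 * euler (q ^ 6) ^ 3 / euler q ^ 2)"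
  unfolding int_series_def xi_9k_plus_6_fps_def
  using xi_9k_plus_6[OF p_xi_has_sum] by (auto intro: has_sum_imp_sums)

text \<open>Multiplying by J(1)^5 rather than J(1)^2 clears the denominator by a series in q^5
  modulo 5, and leaves the cube J(1)^3 for Jacobi's identity.\<close>

lemma xi_9k_plus_6_fps_mult: "xi_9k_plus_6_fps * euler_fps ^ 5 = 4 * (cube_fps 6 * cube_fps 1)"
proof -
  have "int_series (xi_9k_plus_6_fps * euler_fps ^ Suc 4) (\<lambda>q. 4 * (euler (q ^ 6) ^ 3 * euler (q ^ 1) ^ 3))"
  proof (rule int_series_cong[OF int_series_mult[OF xi_9k_plus_6_fps_int_series int_series_power[OF euler_pentagonal]]])
    fix q :: complex assume "norm q < 1"
    then show "4 * euler (q ^ 6) ^ 3 / euler q ^ 2 * euler q ^ Suc 4 = 4 * (euler (q ^ 6) ^ 3 * euler (q ^ 1) ^ 3)"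
      using euler_nonzero[of q] by (simp add: field_simps eval_nat_numeral)
  qed
  from int_series_unique[OF this int_series_4[OF int_series_mult[OF cube_fps_int_series cube_fps_int_series]]]
  show ?thesis by simp
qed

lemma euler_fps_0: "fps_nth (euler_fps ^ 5) 0 = 1"
proof -
  have "{n. pentagonal n = 0} = {0}"
  proof -
    have "n = 0" if "pentagonal n = 0" for n using that pentagonal_bound[of n] by (simp add: pentagonal_def)
    moreover have "pentagonal 0 = 0" by (simp add: pentagonal_def)
    ultimately show ?thesis by blast
  qed
  then show ?thesis by (simp add: euler_fps_def fps_nth_power_0)
qed

text \<open>Division by J(1)^5 done as an induction: its constant term 1 isolates the N-th
  coefficient, and each earlier one either has an index in the residue class of N or is multiplied
  by a coefficient divisible by 5.\<close>

lemma xi_9k_plus_6_fps_dvd: "N mod 5 = 3 \<or> N mod 5 = 4 \<Longrightarrow> 5 dvd fps_nth xi_9k_plus_6_fps N"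
proof (induction N rule: less_induct)
  case (less N)
  have "fps_nth (xi_9k_plus_6_fps * euler_fps ^ 5) N = (\<Sum>i<N. fps_nth xi_9k_plus_6_fps i * fps_nth (euler_fps ^ 5) (N - i)) + fps_nth xi_9k_plus_6_fps N"
    unfolding fps_mult_nth atLeast0AtMost lessThan_Suc_atMost[symmetric] by (simp add: euler_fps_0)
  moreover have "5 dvd (\<Sum>i<N. fps_nth xi_9k_plus_6_fps i * fps_nth (euler_fps ^ 5) (N - i))"
  proof (rule dvd_sum)
    fix i assume i: "i \<in> {..<N}"
    show "5 dvd fps_nth xi_9k_plus_6_fps i * fps_nth (euler_fps ^ 5) (N - i)"
    proof (cases "(N - i) mod 5 = 0")
      case True
      then have "i mod 5 = N mod 5" using i mod_eq_dvd_iff_nat[of i N 5] by (simp add: dvd_eq_mod_eq_0)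
      then show ?thesis using less.prems i by (intro dvd_mult2 less.IH) auto
    next
      case False
      then show ?thesis by (intro dvd_mult fps_fifth_power_dvd)
    qed
  qed
  moreover have "5 dvd fps_nth (xi_9k_plus_6_fps * euler_fps ^ 5) N"
    unfolding xi_9k_plus_6_fps_mult fps_mult_numeral_left using cube_fps_mult_dvd[OF less.prems] by (rule dvd_mult)
  ultimately show ?case by (simp add: dvd_add_right_iff)
qed

theorem theorem5p3:
  fixes n :: nat
  shows "[p_xi (45 * n + 33) = 0] (mod 5) \<and> [p_xi (45 * n + 42) = 0] (mod 5)"
proof -
  \<comment> \<open>45n + 33 = 9(5n + 3) + 6 and 45n + 42 = 9(5n + 4) + 6.\<close>
  have "5 dvd fps_nth xi_9k_plus_6_fps (5 * n + 3)" "5 dvd fps_nth xi_9k_plus_6_fps (5 * n + 4)"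
    by (intro xi_9k_plus_6_fps_dvd; presburger)+
  then show ?thesis by (simp add: xi_9k_plus_6_fps_def cong_0_iff algebra_simps)
qed

end
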